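(* Let $\beta\in(-1,0)$. Then for every sequence $(N_n)_{n\in\mathbb{N}}$ of positive integers with $N_n^{\frac{-\beta}{1+\beta}}\,n^{-1}\to\infty$ as $n\to\infty$, the finite dimensional distributions of the process $$\Bigl(n^{-1}N_n^{-\frac{1}{2(1+\beta)}}\,S^{(N_n,n)}_t\Bigr)_{t\in\mathbb{R}_+}$$ converge weakly, as $n\to\infty$, to those of the process $(V_{2(1+\beta)}\,t)_{t\in\mathbb{R}_+}$, where $V_{2(1+\beta)}$ is a symmetric $2(1+\beta)$-stable random variable (not depending on $t$) with characteristic function $$\mathbb{E}\bigl(e^{\mathrm{i}\theta V_{2(1+\beta)}}\bigr)=e^{-K_\beta|\theta|^{2(1+\beta)}},\qquad \theta\in\mathbb{R},\qquad\text{where } K_\beta:=\psi_1\Bigl(\frac{\lambda}{2}\Bigr)^{1+\beta}\frac{\Gamma(-\beta)}{1+\beta}.$$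
   Context: Notation: $\mathbb{N}=\{1,2,\dots\}$, $\mathbb{Z}_+=\{0,1,2,\dots\}$, $\mathbb{R}_+=[0,\infty)$, $\mathrm{i}$ is the imaginary unit, $\lfloor\cdot\rfloor$ is the integer part, $\Gamma$ is the Gamma function. Mixing distribution: $\alpha$ is a random variable with values in $(0,1)$ having a probability density of the form $\psi(x)(1-x)^\beta$, $x\in(0,1)$, where $\psi$ is a function on $(0,1)$ having a limit $\lim_{x\uparrow1}\psi(x)=\psi_1\in(0,\infty)$ (here $\beta\in(-1,\infty)$ necessarily). Randomized INAR(1) process with Poisson innovations: let $\lambda\in(0,\infty)$. On some probability space, let $\alpha$ be a random variable with values in $(0,1)$ having the probability density $\psi(x)(1-x)^\beta$, $x\in(0,1)$, where $\lim_{x\uparrow1}\psi(x)=\psi_1\in(0,\infty)$, and let $\{X_0,\ \xi_{k,j},\ \varepsilon_k : k,j\in\mathbb{N}\}$ be random variables which are conditionally independent given $\alpha$ and satisfy, for $k,j\in\mathbb{N}$: $\mathbb{P}(\xi_{k,j}=1\mid\alpha)=\alpha=1-\mathbb{P}(\xi_{k,j}=0\mid\alpha)$; conditionally on $\alpha$, $\varepsilon_k$ is Poisson distributed with parameter $\lambda$; conditionally on $\alpha$, $X_0$ is Poisson distributed with parameter $\lambda/(1-\alpha)$. Define $X_k:=\sum_{j=1}^{X_{k-1}}\xi_{k,j}+\varepsilon_k$, $k\in\mathbb{N}$ (with $\sum_{j=1}^0:=0$). Conditionally on $\alpha$, $(X_k)_{k\in\mathbb{Z}_+}$ is a strictly stationary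 INAR(1) process and $\mathbb{E}(X_k\mid\alpha)=\lambda/(1-\alpha)$. Aggregated process: let $(\alpha^{(j)},(X^{(j)}_k)_{k\in\mathbb{Z}_+})$, $j\in\mathbb{N}$, be independent copies of $(\alpha,(X_k)_{k\in\mathbb{Z}_+})$. For $N,n\in\mathbb{N}$ put $$S^{(N,n)}_t:=\sum_{j=1}^N\sum_{k=1}^{\lfloor nt\rfloor}\Bigl(X^{(j)}_k-\frac{\lambda}{1-\alpha^{(j)}}\Bigr),\qquad t\in\mathbb{R}_+.$$ *)

theory Defs
  imports "HOL-Probability.Probability"
begin

section \<open>Conditional probability and conditional independence\<close>

definition sigma_of :: "'a measure \<Rightarrow> ('a \<Rightarrow> real) \<Rightarrow> 'a measure" where
  "sigma_of M A = vimage_algebra (space M) A borel"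

definition cond_prob_given :: "'a measure \<Rightarrow> ('a \<Rightarrow> real) \<Rightarrow> 'a set \<Rightarrow> 'a \<Rightarrow> real" where
  "cond_prob_given M A E = real_cond_exp M (sigma_of M A) (indicator E)"

definition cond_indep_vars ::
  "'a measure \<Rightarrow> ('a \<Rightarrow> real) \<Rightarrow> ('i \<Rightarrow> 'b measure) \<Rightarrow> ('i \<Rightarrow> 'a \<Rightarrow> 'b) \<Rightarrow> 'i set \<Rightarrow> bool" where
  "cond_indep_vars M A M' Z I \<longleftrightarrow>
     (\<forall>i\<in>I. Z i \<in> measurable M (M' i)) \<and>
     (\<forall>J\<subseteq>I. finite J \<longrightarrow> (\<forall>B. (\<forall>i\<in>J. B i \<in> sets (M' i)) \<longrightarrow>
        (AE w in M. cond_prob_given M A {w' \<in> space M. \<forall>i\<in>J. Z i w' \<in> B i} w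
                  = (\<Prod>i\<in>J. cond_prob_given M A {w' \<in> space M. Z i w' \<in> B i} w))))"

section \<open>The randomized INAR(1) process\<close>

text \<open>Indices of the family \<open>X0\<close>, \<open>\<xi> k j\<close>, \<open>\<epsilon> k\<close>, so that its joint conditional
  independence can be expressed; only \<open>k, j \<ge> 1\<close> are used.\<close>

datatype inar_index = Init | Thin nat nat | Innov nat

definition inar_indices :: "inar_index set" where
  "inar_indices = {Init} \<union> {Thin k j | k j. k \<ge> 1 \<and> j \<ge> 1} \<union> {Innov k | k. k \<ge> 1}"

fun inar_source ::
  "('a \<Rightarrow> nat) \<Rightarrow> (nat \<Rightarrow> nat \<Rightarrow> 'a \<Rightarrow> nat) \<Rightarrow> (nat \<Rightarrow> 'a \<Rightarrow> nat) \<Rightarrow> inar_index \<Rightarrow> 'a \<Rightarrow> nat" where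
  "inar_source X0 \<xi> \<epsilon> Init = X0"
| "inar_source X0 \<xi> \<epsilon> (Thin k j) = \<xi> k j"
| "inar_source X0 \<xi> \<epsilon> (Innov k) = \<epsilon> k"

primrec inar1 ::
  "('a \<Rightarrow> nat) \<Rightarrow> (nat \<Rightarrow> nat \<Rightarrow> 'a \<Rightarrow> nat) \<Rightarrow> (nat \<Rightarrow> 'a \<Rightarrow> nat) \<Rightarrow> nat \<Rightarrow> 'a \<Rightarrow> nat" where
  "inar1 X0 \<xi> \<epsilon> 0 w = X0 w"
| "inar1 X0 \<xi> \<epsilon> (Suc k) w = (\<Sum>j=1..inar1 X0 \<xi> \<epsilon> k w. \<xi> (Suc k) j w) + \<epsilon> (Suc k) w"

text \<open>Since \<open>ennreal\<close> truncates negative reals to \<open>0\<close>, \<open>distributed\<close> alone would ignore a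
  negative part of \<open>\<psi>\<close>; \<open>\<psi>_nonneg\<close> makes \<open>\<psi> x * (1 - x) powr \<beta>\<close> itself the density.\<close>

locale randomized_inar1 = prob_space M
  for M :: "'a measure"
  and lam \<beta> :: real
  and \<psi> :: "real \<Rightarrow> real"
  and \<psi>1 :: real
  and \<alpha> :: "'a \<Rightarrow> real"
  and X0 :: "'a \<Rightarrow> nat"
  and \<xi> :: "nat \<Rightarrow> nat \<Rightarrow> 'a \<Rightarrow> nat"
  and \<epsilon> :: "nat \<Rightarrow> 'a \<Rightarrow> nat" +
  assumes lam_pos: "lam > 0"
    and \<alpha>_range: "\<And>w. w \<in> space M \<Longrightarrow> \<alpha> w \<in> {0<..<1}"
    and \<psi>_nonneg: "AE x in lborel. x \<in> {0<..<1} \<longrightarrow> \<psi> x \<ge> 0"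
    and \<alpha>_density:
      "distributed M lborel \<alpha> (\<lambda>x. ennreal (indicator {0<..<1} x * (\<psi> x * (1 - x) powr \<beta>)))"
    and \<psi>_limit: "(\<psi> \<longlongrightarrow> \<psi>1) (at_left 1)"
    and \<psi>1_pos: "\<psi>1 > 0"
    and cond_indep:
      "cond_indep_vars M \<alpha> (\<lambda>_. count_space UNIV) (inar_source X0 \<xi> \<epsilon>) inar_indices"
    and \<xi>_one: "\<And>k j. k \<ge> 1 \<Longrightarrow> j \<ge> 1 \<Longrightarrow>
      AE w in M. cond_prob_given M \<alpha> {w' \<in> space M. \<xi> k j w' = 1} w = \<alpha> w"
    and \<xi>_zero: "\<And>k j. k \<ge> 1 \<Longrightarrow> j \<ge> 1 \<Longrightarrow>
      AE w in M. cond_prob_given M \<alpha> {w' \<in> space M. \<xi> k j w' = 0} w = 1 - \<alpha> w"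
    and \<epsilon>_poisson: "\<And>k m. k \<ge> 1 \<Longrightarrow>
      AE w in M. cond_prob_given M \<alpha> {w' \<in> space M. \<epsilon> k w' = m} w = pmf (poisson_pmf lam) m"
    and X0_poisson: "\<And>m.
      AE w in M. cond_prob_given M \<alpha> {w' \<in> space M. X0 w' = m} w
               = pmf (poisson_pmf (lam / (1 - \<alpha> w))) m"

section \<open>Independent copies and the aggregated process\<close>

definition pair_space :: "(real \<times> (nat \<Rightarrow> nat)) measure" where
  "pair_space = borel \<Otimes>\<^sub>M (\<Pi>\<^sub>M k\<in>UNIV. count_space UNIV)"

definition independent_copies ::
  "'b measure \<Rightarrow> 'c measure \<Rightarrow> (nat \<Rightarrow> 'b \<Rightarrow> 'c) \<Rightarrow> 'a measure \<Rightarrow> ('a \<Rightarrow> 'c) \<Rightarrow> bool" where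
  "independent_copies M S Y P Z \<longleftrightarrow>
     prob_space.indep_vars M (\<lambda>_. S) Y {1..} \<and>
     (\<forall>j\<ge>1. distr M S (Y j) = distr P S Z)"

definition aggregated ::
  "real \<Rightarrow> (nat \<Rightarrow> 'b \<Rightarrow> real) \<Rightarrow> (nat \<Rightarrow> nat \<Rightarrow> 'b \<Rightarrow> nat) \<Rightarrow> nat \<Rightarrow> nat \<Rightarrow> real \<Rightarrow> 'b \<Rightarrow> real" where
  "aggregated lam A X N n t w =
     (\<Sum>j=1..N. \<Sum>k=1..nat \<lfloor>real n * t\<rfloor>. real (X j k w) - lam / (1 - A j w))"

section \<open>Weak convergence of finite dimensional distributions\<close>

definition converges_in_distribution ::
  "'v topology \<Rightarrow> 'b measure \<Rightarrow> (nat \<Rightarrow> 'b \<Rightarrow> 'v) \<Rightarrow> 'c measure \<Rightarrow> ('c \<Rightarrow> 'v) \<Rightarrow> bool" where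
  "converges_in_distribution T M Y Q Z \<longleftrightarrow>
     (\<forall>f. continuous_map T euclideanreal f \<and> bounded (f ` topspace T) \<longrightarrow>
        (\<lambda>n. \<integral>w. f (Y n w) \<partial>M) \<longlonglongrightarrow> (\<integral>w. f (Z w) \<partial>Q))"

text \<open>For a finite set \<open>I\<close> of times, \<open>\<real>\<^sup>I\<close> is the product topology over \<open>I\<close>, whose points are
  the functions that are \<open>undefined\<close> outside \<open>I\<close>; hence the use of \<open>restrict\<close>.\<close>

definition fdd_converge ::
  "real set \<Rightarrow> 'b measure \<Rightarrow> (nat \<Rightarrow> real \<Rightarrow> 'b \<Rightarrow> real) \<Rightarrow> 'c measure \<Rightarrow> (real \<Rightarrow> 'c \<Rightarrow> real) \<Rightarrow> bool" where
  "fdd_converge T M Y Q Z \<longleftrightarrow>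
     (\<forall>I\<subseteq>T. finite I \<longrightarrow>
        converges_in_distribution (product_topology (\<lambda>_. euclideanreal) I)
          M (\<lambda>n w. restrict (\<lambda>t. Y n t w) I) Q (\<lambda>w. restrict (\<lambda>t. Z t w) I))"

section \<open>Symmetric stable laws\<close>

definition symmetric_law :: "real measure \<Rightarrow> bool" where
  "symmetric_law \<nu> \<longleftrightarrow> distr \<nu> borel (\<lambda>x. - x) = \<nu>"

definition stable_law :: "real \<Rightarrow> real measure \<Rightarrow> bool" where
  "stable_law p \<nu> \<longleftrightarrow>
     (\<forall>a>0. \<forall>b>0. \<exists>d. distr (\<nu> \<Otimes>\<^sub>M \<nu>) borel (\<lambda>(x, y). a * x + b * y)
                    = distr \<nu> borel (\<lambda>x. (a powr p + b powr p) powr (1 / p) * x + d))"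

end

theory Submission
  imports Defs "HOL-Real_Asymp.Real_Asymp"
begin

text \<open>
  Write \<open>S\<^sub>t = (\<Sum>j. \<Sum>k\<le>m. X\<^sub>k - X\<^sub>0) + m (\<Sum>j. X\<^sub>0 - lam / (1 - \<alpha>))\<close> with \<open>m = \<lfloor>n t\<rfloor>\<close>.  The summands
  \<open>X\<^sub>k - X\<^sub>0\<close> are centred and, although \<open>X\<^sub>k\<close> has infinite mean, have second moment
  \<open>E (2 lam (1 - \<alpha>^k) / (1 - \<alpha>)) \<le> 2 lam k\<close>; hence after scaling the squared \<open>L\<^sup>2\<close>-norm of the
  first part is at most of order \<open>N^(\<beta> / (1 + \<beta>)) n\<close>, which tends to \<open>0\<close> by the growth condition.
  The second part is \<open>m / n\<close> times a normalised sum of independent identically distributed variables,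
  so all times share one random slope.  Given \<open>\<alpha>\<close>, a summand is a centred Poisson variable, so its
  characteristic function is \<open>E (exp (lam / (1 - \<alpha>) (e^(i s) - 1 - i s)))\<close>; substituting
  \<open>1 - \<alpha> = s\<^sup>2 u\<close> shows that it is \<open>1 - K \<bar>s\<bar>^(2 (1 + \<beta>)) (1 + o(1))\<close>.
\<close>

section \<open>Weak limits from characteristic functions\<close>

text \<open>The obstacle is that a centred summand has infinite variance: for \<beta> < 0 the rate
  \<open>lam / (1 - \<alpha>)\<close> has infinite mean, so no L2 estimate of the whole sum is
  possible. Subtracting \<open>X 0\<close> cancels the pole at \<alpha> = 1, because 1 - \<alpha>^k
  is at most k (1 - \<alpha>), and leaves the heavy tail in one variable per copy. Cauchy-Schwarz
  over m times and orthogonality over the N copies then bound the second moment of the remainder by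
  2 lam N m^3; with m at most n t and the squared normalisation this is where the growth condition
  enters. The constant is the integral of u^\<beta> (1 - exp (- c / u)) over the half line with c =
  lam / 2; integration by parts and the substitution y = c / u reduce it to a Gamma integral. The
  stable law is not constructed in advance. Its characteristic function is continuous at 0, so
  tightness extracts a limit law from the normalised sums themselves; symmetry and stability are
  read off afterwards. The same tightness allows floor(n t) / n to be replaced by t.\<close>

lemma (in real_distribution) integral_std_normal_char:
  "(CLINT z|std_normal_distribution. char M (\<sigma> * z)) = of_real (LINT x|M. exp (- (\<sigma> * x)\<^sup>2 / 2))"
proof -
  interpret Nd: real_distribution std_normal_distribution by (rule real_dist_normal_dist)
  interpret PP: pair_prob_space M std_normal_distribution ..
  have "(CLINT z|std_normal_distribution. char M (\<sigma> * z)) =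
        (CLINT z|std_normal_distribution. CLINT x|M. iexp (\<sigma> * z * x))"
    by (simp add: char_def)
  also have "\<dots> = (CLINT x|M. CLINT z|std_normal_distribution. iexp (\<sigma> * z * x))"
    by (rule PP.Fubini_integral, rule PP.P.integrable_const_bound[where B = 1]) auto
  also have "\<dots> = (CLINT x|M. char std_normal_distribution (\<sigma> * x))"
    by (simp add: char_def mult_ac)
  also have "\<dots> = (CLINT x|M. of_real (exp (- (\<sigma> * x)\<^sup>2 / 2)))"
    by (simp add: char_std_normal_distribution)
  finally show ?thesis by (simp add: integral_complex_of_real)
qed

text \<open>
  Averaging the characteristic function over a Gaussian argument replaces the usual average over an
  interval: \<open>1 - exp (- (\<sigma> x)\<^sup>2 / 2)\<close> is bounded below on \<open>\<bar>x\<bar> \<ge> 1 / \<sigma>\<close>.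
\<close>

lemma (in real_distribution) tail_le_integral_char:
  assumes "\<sigma> > 0"
  shows "(1 - exp (-1/2)) * prob {x. \<bar>x\<bar> \<ge> 1 / \<sigma>} \<le>
         cmod ((CLINT z|std_normal_distribution. char M (\<sigma> * z)) - 1)"
proof -
  have int: "integrable M (\<lambda>x. exp (- (\<sigma> * x)\<^sup>2 / 2))"
    by (rule integrable_const_bound[where B = 1]) auto
  have "(1 - exp (-1/2)) * prob {x. \<bar>x\<bar> \<ge> 1 / \<sigma>} =
        (LINT x|M. (1 - exp (-1/2)) * indicator {x. \<bar>x\<bar> \<ge> 1 / \<sigma>} x)"
    by simp
  also have "\<dots> \<le> (LINT x|M. 1 - exp (- (\<sigma> * x)\<^sup>2 / 2))"
  proof (rule integral_mono)
    fix x :: real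
    show "(1 - exp (-1/2)) * indicator {x. \<bar>x\<bar> \<ge> 1 / \<sigma>} x \<le> 1 - exp (- (\<sigma> * x)\<^sup>2 / 2)"
    proof (cases "\<bar>x\<bar> \<ge> 1 / \<sigma>")
      case True
      then have "1 \<le> \<bar>\<sigma> * x\<bar>" using assms by (simp add: field_simps abs_mult)
      then have "1 \<le> (\<sigma> * x)\<^sup>2" by (metis abs_le_square_iff abs_one one_power2)
      then show ?thesis using True by simp
    qed (auto simp: indicator_def)
  qed (use int in \<open>auto intro!: integrable_real_mult_indicator simp: emeasure_eq_measure\<close>)
  also have "\<dots> = 1 - (LINT x|M. exp (- (\<sigma> * x)\<^sup>2 / 2))"
    using int prob_space by (subst Bochner_Integration.integral_diff) auto
  also have "\<dots> \<le> cmod ((CLINT z|std_normal_distribution. char M (\<sigma> * z)) - 1)"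
    unfolding integral_std_normal_char
    using norm_of_real[of "(LINT x|M. exp (- (\<sigma> * x)\<^sup>2 / 2)) - 1", where 'a = complex] by simp
  finally show ?thesis .
qed

text \<open>Continuity of \<phi> at 0 selects one \<sigma> at which the Gaussian average of \<phi>
  is close to 1. Dominated convergence carries this over to \<open>char (\<mu> n)\<close> for all
  large n, and \<open>tail_le_integral_char\<close> turns it into a uniform tail bound; the finitely
  many remaining laws are tight individually.\<close>

lemma char_tendsto_imp_tight:
  fixes \<mu> :: "nat \<Rightarrow> real measure" and \<phi> :: "real \<Rightarrow> complex"
  assumes rd: "\<And>n. real_distribution (\<mu> n)"
    and conv: "\<And>t. (\<lambda>n. char (\<mu> n) t) \<longlonglongrightarrow> \<phi> t"
    and cont: "isCont \<phi> 0"
  shows "tight \<mu>"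
proof -
  interpret Nd: real_distribution std_normal_distribution by (rule real_dist_normal_dist)
  interpret \<mu>: real_distribution "\<mu> n" for n by (rule rd)
  have [measurable]: "\<phi> \<in> borel_measurable borel"
    by (rule borel_measurable_LIMSEQ_metric[OF _ conv]) simp
  have \<phi>_le: "cmod (\<phi> t) \<le> 1" for t
    by (rule LIMSEQ_le_const2[OF tendsto_norm[OF conv]]) (auto intro: \<mu>.cmod_char_le_1)
  have \<phi>0: "\<phi> 0 = 1"
    using conv[of 0] \<mu>.char_zero by (simp add: LIMSEQ_const_iff)
  have lim1: "(\<lambda>m. CLINT z|std_normal_distribution. \<phi> (inverse (real (Suc m)) * z)) \<longlonglongrightarrow>
              (CLINT z|std_normal_distribution. 1)"
  proof (rule integral_dominated_convergence[where w = "\<lambda>_. 1"])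
    show "AE z in std_normal_distribution. (\<lambda>m. \<phi> (inverse (real (Suc m)) * z)) \<longlonglongrightarrow> 1"
    proof (rule AE_I2)
      fix z :: real
      have "(\<lambda>m. inverse (real (Suc m)) * z) \<longlonglongrightarrow> 0 * z"
        by (intro tendsto_intros LIMSEQ_inverse_real_of_nat)
      then show "(\<lambda>m. \<phi> (inverse (real (Suc m)) * z)) \<longlonglongrightarrow> 1"
        using isCont_tendsto_compose[OF cont] \<phi>0 by fastforce
    qed
  qed (auto simp: \<phi>_le)
  have "\<exists>a b. a < b \<and> (\<forall>n. measure (\<mu> n) {a<..b} > 1 - e)" if "e > 0" for e :: real
  proof -
    \<comment> \<open>The factor is the lower bound of the averaged integrand on the tail, so that
      dividing by it leaves exactly \<open>e\<close>.\<close>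
    define \<eta> where "\<eta> = (1 - exp (-1/2)) * e"
    have \<eta>: "\<eta> > 0" using that by (simp add: \<eta>_def)
    obtain m where m: "cmod ((CLINT z|std_normal_distribution. \<phi> (inverse (real (Suc m)) * z)) - 1) < \<eta>"
      using lim1[THEN LIMSEQ_D, OF \<eta>] Nd.prob_space by auto
    define \<sigma> where "\<sigma> = inverse (real (Suc m))"
    have \<sigma>: "\<sigma> > 0" by (simp add: \<sigma>_def)
    have "(\<lambda>n. CLINT z|std_normal_distribution. char (\<mu> n) (\<sigma> * z)) \<longlonglongrightarrow>
            (CLINT z|std_normal_distribution. \<phi> (\<sigma> * z))"
      by (rule integral_dominated_convergence[where w = "\<lambda>_. 1"])
         (auto simp: \<mu>.cmod_char_le_1 conv)
    then have "(\<lambda>n. cmod ((CLINT z|std_normal_distribution. char (\<mu> n) (\<sigma> * z)) - 1)) \<longlonglongrightarrow>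
            cmod ((CLINT z|std_normal_distribution. \<phi> (\<sigma> * z)) - 1)"
      by (intro tendsto_intros)
    from order_tendstoD(2)[OF this m[folded \<sigma>_def]]
    obtain n0 where n0: "\<And>n. n \<ge> n0 \<Longrightarrow>
        cmod ((CLINT z|std_normal_distribution. char (\<mu> n) (\<sigma> * z)) - 1) < \<eta>"
      by (auto simp: eventually_sequentially)
    have tail: "measure (\<mu> n) {x. \<bar>x\<bar> \<ge> 1 / \<sigma>} < e" if "n \<ge> n0" for n
    proof -
      have "(1 - exp (-1/2)) * measure (\<mu> n) {x. \<bar>x\<bar> \<ge> 1 / \<sigma>} < (1 - exp (-1/2)) * e"
        using \<mu>.tail_le_integral_char[OF \<sigma>, of n] n0[OF that] unfolding \<eta>_def by linarith
      moreover have "(0::real) < 1 - exp (-1/2)" by simp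
      ultimately show ?thesis by (metis mult_less_cancel_left_pos)
    qed
    \<comment> \<open>Each single law is exhausted by growing intervals; this serves the indices
      below \<open>n0\<close>.\<close>
    have ev: "eventually (\<lambda>k. measure (\<mu> n) {- real k<..real k} > 1 - e) sequentially" for n
    proof -
      have "(\<lambda>k. measure (\<mu> n) {- real k<..real k}) \<longlonglongrightarrow> measure (\<mu> n) (\<Union>k. {- real k<..real k})"
        by (rule \<mu>.finite_Lim_measure_incseq) (auto simp: incseq_def)
      also have "(\<Union>k. {- real k<..real k}) = UNIV"
        by (auto, metis leI le_less_trans less_imp_le minus_less_iff reals_Archimedean2)
      finally have "(\<lambda>k. measure (\<mu> n) {- real k<..real k}) \<longlonglongrightarrow> 1"
        using \<mu>.prob_space by simp
      then show ?thesis using that order_tendstoD(1) by fastforce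
    qed
    have "eventually (\<lambda>k. \<forall>n\<in>{..<n0}. measure (\<mu> n) {- real k<..real k} > 1 - e) sequentially"
      by (rule eventually_ball_finite) (use ev in auto)
    then obtain k where k: "\<And>n. n < n0 \<Longrightarrow> measure (\<mu> n) {- real k<..real k} > 1 - e"
      by (auto simp: eventually_sequentially)
    define K where "K = max (real k) (1 / \<sigma>)"
    have "measure (\<mu> n) {-K<..K} > 1 - e" for n
    proof (cases "n < n0")
      case True
      have "measure (\<mu> n) {- real k<..real k} \<le> measure (\<mu> n) {-K<..K}"
        by (rule \<mu>.finite_measure_mono) (auto simp: K_def)
      then show ?thesis using k[OF True] by linarith
    next
      case False
      have "measure (\<mu> n) (UNIV - {x. \<bar>x\<bar> \<ge> 1 / \<sigma>}) = 1 - measure (\<mu> n) {x. \<bar>x\<bar> \<ge> 1 / \<sigma>}"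
        using \<mu>.prob_compl[of "{x. \<bar>x\<bar> \<ge> 1 / \<sigma>}"] by simp
      moreover have "measure (\<mu> n) (UNIV - {x. \<bar>x\<bar> \<ge> 1 / \<sigma>}) \<le> measure (\<mu> n) {-K<..K}"
        by (rule \<mu>.finite_measure_mono) (auto simp: K_def)
      ultimately show ?thesis using tail[of n] False by linarith
    qed
    moreover have "-K < K" using \<sigma> by (simp add: K_def less_max_iff_disj minus_less_iff)
    ultimately show ?thesis by blast
  qed
  then show ?thesis by (auto simp: tight_def rd)
qed

text \<open>No limit law is assumed: tightness yields a subsequential limit, whose characteristic
  function must be \<phi>, and with this law in hand the usual continuity theorem applies to the
  full sequence. This is how the stable law comes into existence.\<close>

theorem levy_continuity_limit_exists:
  fixes \<mu> :: "nat \<Rightarrow> real measure" and \<phi> :: "real \<Rightarrow> complex"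
  assumes rd: "\<And>n. real_distribution (\<mu> n)"
    and conv: "\<And>t. (\<lambda>n. char (\<mu> n) t) \<longlonglongrightarrow> \<phi> t"
    and cont: "isCont \<phi> 0"
  obtains \<nu> where "real_distribution \<nu>" "char \<nu> = \<phi>" "weak_conv_m \<mu> \<nu>"
proof -
  have "tight \<mu>" by (rule char_tendsto_imp_tight[OF assms])
  from tight_imp_convergent_subsubsequence[OF this strict_mono_id]
  obtain r \<nu> where r: "strict_mono (r :: nat \<Rightarrow> nat)" "real_distribution \<nu>" "weak_conv_m (\<mu> \<circ> id \<circ> r) \<nu>"
    by auto
  have "char \<nu> t = \<phi> t" for t
  proof (rule LIMSEQ_unique)
    show "(\<lambda>n. char ((\<mu> \<circ> id \<circ> r) n) t) \<longlonglongrightarrow> char \<nu> t"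
      by (rule levy_continuity1) (use rd r in \<open>auto simp: comp_def\<close>)
    show "(\<lambda>n. char ((\<mu> \<circ> id \<circ> r) n) t) \<longlonglongrightarrow> \<phi> t"
      using LIMSEQ_subseq_LIMSEQ[OF conv r(1), of t] by (simp add: comp_def)
  qed
  then have "char \<nu> = \<phi>" by auto
  moreover from this conv have "weak_conv_m \<mu> \<nu>"
    by (intro levy_continuity rd r) auto
  ultimately show ?thesis using that r by blast
qed

section \<open>Symmetry and stability from the characteristic function\<close>

lemma symmetric_law_if_char_even:
  assumes Q: "real_distribution Q" and "\<And>t. char Q (- t) = char Q t"
  shows "symmetric_law Q"
proof -
  interpret real_distribution Q by fact
  have rd: "real_distribution (distr Q borel uminus)" by simp
  have "distr Q borel uminus = Q"
  proof (rule Levy_uniqueness[OF rd Q], rule ext)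
    fix t
    have "char (distr Q borel uminus) t = char Q (- t)"
      by (simp add: char_def integral_distr)
    then show "char (distr Q borel uminus) t = char Q t" using assms(2) by simp
  qed
  then show ?thesis by (simp add: symmetric_law_def)
qed

text \<open>The characteristic function of \<open>a * x + b * y\<close> factorises, and the
  exponents add because |t|^p is homogeneous: a^p + b^p is the p-th power of the required
  scale.\<close>

lemma stable_law_if_char:
  assumes Q: "real_distribution Q" and p: "p > 0"
    and char: "\<And>t. char Q t = of_real (exp (- K * \<bar>t\<bar> powr p))"
  shows "stable_law p Q"
  unfolding stable_law_def
\<comment> \<open>The exponent has no linear term, so the shift is 0.\<close>
proof (intro allI impI exI[of _ 0])
  fix a b :: real assume ab: "a > 0" "b > 0"
  interpret real_distribution Q by fact
  interpret QQ: pair_prob_space Q Q ..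
  define c where "c = (a powr p + b powr p) powr (1 / p)"
  have c: "c powr p = a powr p + b powr p" using ab p by (simp add: c_def powr_powr)
  have c0: "c \<ge> 0" by (simp add: c_def)
  have m: "(\<lambda>(x, y). a * x + b * y) \<in> borel_measurable (Q \<Otimes>\<^sub>M Q)" by measurable
  have rd: "real_distribution (distr (Q \<Otimes>\<^sub>M Q) borel (\<lambda>(x, y). a * x + b * y))"
    by (intro prob_space.real_distribution_distr QQ.prob_space_axioms m)
  have rd': "real_distribution (distr Q borel (\<lambda>x. c * x + 0))" by simp
  have "char (distr (Q \<Otimes>\<^sub>M Q) borel (\<lambda>(x, y). a * x + b * y)) = char (distr Q borel (\<lambda>x. c * x + 0))"
  proof
    fix t
    have "char (distr (Q \<Otimes>\<^sub>M Q) borel (\<lambda>(x, y). a * x + b * y)) t =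
        (CLINT z|Q \<Otimes>\<^sub>M Q. iexp (t * (a * fst z + b * snd z)))"
      unfolding char_def by (subst integral_distr[OF m]) (auto simp: case_prod_beta)
    also have "\<dots> = (CLINT x|Q. CLINT y|Q. iexp (t * (a * x + b * y)))"
      by (subst QQ.integral_fst'[symmetric]) (auto intro!: QQ.integrable_const_bound[where B = 1])
    also have "\<dots> = (CLINT x|Q. CLINT y|Q. iexp (t * a * x) * iexp (t * b * y))"
      by (simp add: exp_add[symmetric] algebra_simps)
    also have "\<dots> = char Q (t * a) * char Q (t * b)" by (simp add: char_def)
    also have "\<dots> = of_real (exp (- K * \<bar>t * a\<bar> powr p) * exp (- K * \<bar>t * b\<bar> powr p))"
      by (simp only: char of_real_mult)
    also have "exp (- K * \<bar>t * a\<bar> powr p) * exp (- K * \<bar>t * b\<bar> powr p) = exp (- K * \<bar>t * c\<bar> powr p)"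
      using ab c0 by (simp add: abs_mult powr_mult c algebra_simps flip: exp_add)
    also have "of_real \<dots> = char Q (t * c)" by (simp only: char)
    also have "\<dots> = char (distr Q borel (\<lambda>x. c * x + 0)) t"
      by (simp add: char_def integral_distr mult_ac)
    finally show "char (distr (Q \<Otimes>\<^sub>M Q) borel (\<lambda>(x, y). a * x + b * y)) t = char (distr Q borel (\<lambda>x. c * x + 0)) t" .
  qed
  from Levy_uniqueness[OF rd rd' this]
  show "distr (Q \<Otimes>\<^sub>M Q) borel (\<lambda>(x, y). a * x + b * y) =
      distr Q borel (\<lambda>x. (a powr p + b powr p) powr (1 / p) * x + 0)" by (simp add: c_def)
qed

section \<open>Powers near 1 and second moments of independent sums\<close>

text \<open>Comparison with an exact root avoids the complex logarithm: for z and w in the closed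
  unit disc, z^N and w^N differ by at most N |z - w|, and N (1 - z) and N (1 - w) have the same
  limit.\<close>

lemma power_tendsto_exp:
  fixes z :: "nat \<Rightarrow> complex" and N :: "nat \<Rightarrow> nat" and \<kappa> :: real
  assumes z: "\<And>n. cmod (z n) \<le> 1" and N: "filterlim N at_top sequentially"
    and lim: "(\<lambda>n. of_nat (N n) * (1 - z n)) \<longlonglongrightarrow> of_real \<kappa>" and \<kappa>: "\<kappa> \<ge> 0"
  shows "(\<lambda>n. z n ^ N n) \<longlonglongrightarrow> of_real (exp (- \<kappa>))"
proof -
  \<comment> \<open>The real N-th root of \<open>exp (- \<kappa>)\<close>.\<close>
  define w where "w n = exp (- \<kappa> / real (N n))" for n
  have "((\<lambda>x. x * (1 - exp (- \<kappa> / x))) \<longlongrightarrow> \<kappa>) at_top" by real_asymp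
  moreover have "filterlim (\<lambda>n. real (N n)) at_top sequentially"
    by (rule filterlim_compose[OF filterlim_real_sequentially N])
  ultimately have "(\<lambda>n. real (N n) * (1 - w n)) \<longlonglongrightarrow> \<kappa>"
    unfolding w_def by (rule filterlim_compose)
  then have "(\<lambda>n. of_real (real (N n) * (1 - w n)) :: complex) \<longlonglongrightarrow> of_real \<kappa>"
    by (rule tendsto_of_real)
  from tendsto_norm_zero[OF tendsto_diff[OF this lim, simplified]]
  have null: "(\<lambda>n. cmod (of_real (real (N n) * (1 - w n)) - of_nat (N n) * (1 - z n))) \<longlonglongrightarrow> 0"
    by simp
  have "(\<lambda>n. z n ^ N n - of_real (w n) ^ N n) \<longlonglongrightarrow> 0"
  proof (rule Lim_null_comparison[OF always_eventually null], rule allI)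
    fix n
    have "cmod (z n ^ N n - of_real (w n) ^ N n) \<le> real (N n) * cmod (z n - of_real (w n))"
      using \<kappa> by (intro norm_power_diff z) (simp add: w_def)
    also have "\<dots> = cmod (of_nat (N n) * (z n - of_real (w n)))" by (simp add: norm_mult)
    also have "of_nat (N n) * (z n - of_real (w n)) = of_real (real (N n) * (1 - w n)) - of_nat (N n) * (1 - z n)"
      by (simp add: algebra_simps)
    finally show "cmod (z n ^ N n - of_real (w n) ^ N n) \<le>
        cmod (of_real (real (N n) * (1 - w n)) - of_nat (N n) * (1 - z n))" .
  qed
  moreover have "eventually (\<lambda>n. z n ^ N n - of_real (w n) ^ N n = z n ^ N n - of_real (exp (- \<kappa>))) sequentially"
    using N[unfolded filterlim_at_top, rule_format, of 1]
  proof (eventually_elim)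
    case (elim n)
    then have "w n ^ N n = exp (- \<kappa>)" by (simp add: w_def flip: exp_of_nat_mult)
    then show ?case by (metis of_real_power)
  qed
  ultimately have "(\<lambda>n. z n ^ N n - of_real (exp (- \<kappa>))) \<longlonglongrightarrow> 0"
    by (rule Lim_transform_eventually)
  then show ?thesis by (rule LIM_zero_cancel)
qed

text \<open>Induction on the index set: a new summand is centred and independent of the partial sum,
  so the cross term has expectation 0. The bound thus grows linearly, not quadratically, in the
  number of summands.\<close>

lemma (in prob_space) expectation_sum_indep_square:
  fixes D :: "'i \<Rightarrow> 'a \<Rightarrow> real"
  assumes "finite I" "indep_vars (\<lambda>_. borel) D I"
    and "\<And>i. i \<in> I \<Longrightarrow> integrable M (D i)" "\<And>i. i \<in> I \<Longrightarrow> expectation (D i) = 0"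
    and "\<And>i. i \<in> I \<Longrightarrow> integrable M (\<lambda>w. (D i w)\<^sup>2)" "\<And>i. i \<in> I \<Longrightarrow> expectation (\<lambda>w. (D i w)\<^sup>2) \<le> c"
  shows "integrable M (\<lambda>w. (\<Sum>i\<in>I. D i w)\<^sup>2) \<and> expectation (\<lambda>w. (\<Sum>i\<in>I. D i w)\<^sup>2) \<le> real (card I) * c"
  using assms
proof (induction I rule: finite_induct)
  case empty
  then show ?case by simp
next
  case (insert i I)
  define S where "S w = (\<Sum>i\<in>I. D i w)" for w
  have IH: "integrable M (\<lambda>w. (S w)\<^sup>2)" "expectation (\<lambda>w. (S w)\<^sup>2) \<le> real (card I) * c"
    using insert.IH[OF indep_vars_subset[OF insert.prems(1)]] insert.prems by (auto simp: S_def)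
  have ind: "indep_var borel (D i) borel S"
    unfolding S_def by (rule indep_vars_sum[OF insert.hyps insert.prems(1)])
  have S: "integrable M S" unfolding S_def using insert.prems by (intro Bochner_Integration.integrable_sum) auto
  have Di: "integrable M (D i)" using insert.prems by auto
  have prod: "integrable M (\<lambda>w. D i w * S w)" "expectation (\<lambda>w. D i w * S w) = 0"
    using indep_var_integrable[OF ind Di S] indep_var_lebesgue_integral[OF ind Di S] insert.prems(3) by auto
  have eq: "(\<Sum>i\<in>insert i I. D i w)\<^sup>2 = (D i w)\<^sup>2 + 2 * (D i w * S w) + (S w)\<^sup>2" for w
    using insert.hyps by (simp add: S_def power2_sum)
  have sq: "integrable M (\<lambda>w. (D i w)\<^sup>2)" using insert.prems(4) by auto
  have "expectation (\<lambda>w. (D i w)\<^sup>2 + 2 * (D i w * S w) + (S w)\<^sup>2) =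
      expectation (\<lambda>w. (D i w)\<^sup>2) + expectation (\<lambda>w. (S w)\<^sup>2)"
    using sq prod IH(1) by simp
  also have "\<dots> \<le> real (card (insert i I)) * c"
    using IH(2) insert.prems(5)[of i] insert.hyps by (simp add: algebra_simps)
  finally show ?case unfolding eq using sq prod IH(1) by simp
qed

lemma (in prob_space) prob_abs_ge_le_second_moment:
  assumes int: "integrable M (\<lambda>w. (T w)\<^sup>2 :: real)" and [measurable]: "T \<in> borel_measurable M" and e: "e > 0"
  shows "prob {w \<in> space M. \<bar>T w\<bar> \<ge> e} \<le> expectation (\<lambda>w. (T w)\<^sup>2) / e\<^sup>2"
proof -
  have "prob {w \<in> space M. \<bar>T w\<bar> \<ge> e} = expectation (indicat_real {w \<in> space M. \<bar>T w\<bar> \<ge> e})"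
    by simp
  also have "\<dots> \<le> expectation (\<lambda>w. (T w)\<^sup>2 / e\<^sup>2)"
  proof (rule integral_mono)
    fix w
    show "indicat_real {w \<in> space M. \<bar>T w\<bar> \<ge> e} w \<le> (T w)\<^sup>2 / e\<^sup>2"
    proof (cases "\<bar>T w\<bar> \<ge> e")
      case True
      then have "e\<^sup>2 \<le> (T w)\<^sup>2" using e power_mono[of e "\<bar>T w\<bar>" 2] by simp
      then show ?thesis using e by (auto simp: indicator_def)
    qed (auto simp: indicator_def)
  qed (use int in \<open>auto simp: emeasure_eq_measure intro!: integrable_real_indicator\<close>)
  finally show ?thesis by simp
qed

section \<open>Weak convergence to a random line\<close>

lemma tight_imp_tail:
  assumes tight: "tight (\<lambda>n. distr M borel (U n))" and U: "\<And>n. U n \<in> borel_measurable M"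
    and M: "prob_space M" and e: "e > 0"
  obtains K :: real where "K > 0" "\<And>n. measure M {w \<in> space M. \<bar>U n w\<bar> > K} < e"
proof -
  interpret prob_space M by fact
  obtain a b where ab: "a < b" "\<And>n. measure (distr M borel (U n)) {a<..b} > 1 - e"
    using tight e unfolding tight_def by blast
  define K where "K = max 1 (max \<bar>a\<bar> \<bar>b\<bar>)"
  have "measure M {w \<in> space M. \<bar>U n w\<bar> > K} < e" for n
  proof -
    have [measurable]: "U n \<in> borel_measurable M" by (rule U)
    have "measure (distr M borel (U n)) {a<..b} = prob {w \<in> space M. U n w \<in> {a<..b}}"
      by (subst measure_distr) (auto intro!: arg_cong[where f = prob])
    moreover have "prob {w \<in> space M. U n w \<notin> {a<..b}} = 1 - prob {w \<in> space M. U n w \<in> {a<..b}}"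
      by (rule prob_neg) measurable
    ultimately have "prob {w \<in> space M. U n w \<notin> {a<..b}} < e" using ab(2)[of n] by linarith
    moreover have "prob {w \<in> space M. \<bar>U n w\<bar> > K} \<le> prob {w \<in> space M. U n w \<notin> {a<..b}}"
      by (rule finite_measure_mono) (auto simp: K_def)
    ultimately show ?thesis by linarith
  qed
  moreover have "K > 0" by (simp add: K_def)
  ultimately show ?thesis using that by blast
qed

text \<open>Up to an event of probability below \<open>r\<close> the variables are bounded by one
  \<open>K\<close>, and \<open>a n\<close> eventually drops below \<open>e / K\<close>. This later
  absorbs the rounding error between floor(n t) / n and t.\<close>

lemma tight_mult_null:
  assumes tight: "tight (\<lambda>n. distr M borel (U n))" and U: "\<And>n. U n \<in> borel_measurable M"
    and M: "prob_space M" and a: "a \<longlonglongrightarrow> (0 :: real)" and e: "e > 0"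
  shows "(\<lambda>n. measure M {w \<in> space M. \<bar>a n * U n w\<bar> \<ge> e}) \<longlonglongrightarrow> 0"
proof (rule LIMSEQ_I)
  interpret prob_space M by fact
  fix r :: real assume "r > 0"
  then obtain K where K: "K > 0" "\<And>n. measure M {w \<in> space M. \<bar>U n w\<bar> > K} < r"
    using tight_imp_tail[OF tight U M] by metis
  have "eventually (\<lambda>n. \<bar>a n\<bar> < e / K) sequentially"
    using order_tendstoD(2)[OF tendsto_rabs_zero[OF a], of "e / K"] e K(1) by simp
  then obtain n0 where n0: "\<And>n. n \<ge> n0 \<Longrightarrow> \<bar>a n\<bar> < e / K" by (auto simp: eventually_sequentially)
  have "norm (measure M {w \<in> space M. \<bar>a n * U n w\<bar> \<ge> e} - 0) < r" if "n \<ge> n0" for n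
  proof -
    have [measurable]: "U n \<in> borel_measurable M" by (rule U)
    have "{w \<in> space M. \<bar>a n * U n w\<bar> \<ge> e} \<subseteq> {w \<in> space M. \<bar>U n w\<bar> > K}"
    proof safe
      fix w assume "e \<le> \<bar>a n * U n w\<bar>"
      show "K < \<bar>U n w\<bar>"
      proof (rule ccontr)
        assume "\<not> K < \<bar>U n w\<bar>"
        then have "\<bar>a n * U n w\<bar> \<le> \<bar>a n\<bar> * K" by (simp add: abs_mult mult_left_mono)
        also have "\<dots> < e" using n0[OF that] K(1) by (simp add: field_simps)
        finally show False using \<open>e \<le> \<bar>a n * U n w\<bar>\<close> by simp
      qed
    qed
    then have "measure M {w \<in> space M. \<bar>a n * U n w\<bar> \<ge> e} \<le> measure M {w \<in> space M. \<bar>U n w\<bar> > K}"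
      by (rule finite_measure_mono) measurable
    then show ?thesis using K(2)[of n] by simp
  qed
  then show "\<exists>no. \<forall>n\<ge>no. norm (measure M {w \<in> space M. \<bar>a n * U n w\<bar> \<ge> e} - 0) < r" by blast
qed

lemma tendsto_fun_coordinatewise:
  fixes f :: "'c \<Rightarrow> 'i \<Rightarrow> real"
  assumes "\<And>i. ((\<lambda>x. f x i) \<longlongrightarrow> l i) F"
  shows "(f \<longlongrightarrow> l) F"
proof -
  have "limitin (product_topology (\<lambda>i. euclidean) UNIV) f l F"
    using assms by (simp add: limitin_componentwise limitin_canonical_iff)
  then show ?thesis by (simp add: euclidean_product_topology limitin_canonical_iff)
qed

text \<open>\<open>F\<close> is merely continuous, but the segment of all x e with |x| at most K is
  compact. Counterexamples for tolerances tending to 0 would have a subsequence along which both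
  arguments approach the same point of the segment, against continuity there.\<close>

lemma uniformly_close_to_line:
  fixes F :: "(nat \<Rightarrow> real) \<Rightarrow> real" and e :: "nat \<Rightarrow> real"
  assumes F: "continuous_on UNIV F" and r: "r > 0"
  shows "\<exists>\<delta>>0. \<forall>x\<in>{-K..K}. \<forall>y. (\<forall>i. \<bar>y i - x * e i\<bar> < \<delta>) \<longrightarrow> \<bar>F y - F (\<lambda>i. x * e i)\<bar> < r"
proof (rule ccontr)
  assume "\<not> ?thesis"
  then have "\<forall>n. \<exists>x y. x \<in> {-K..K} \<and> (\<forall>i. \<bar>y i - x * e i\<bar> < inverse (real (Suc n))) \<and> \<bar>F y - F (\<lambda>i. x * e i)\<bar> \<ge> r"
    by (metis inverse_positive_iff_positive of_nat_0_less_iff zero_less_Suc not_less)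
  then obtain x y where xy: "\<And>n. x n \<in> {-K..K}" "\<And>n i. \<bar>y n i - x n * e i\<bar> < inverse (real (Suc n))"
    "\<And>n. \<bar>F (y n) - F (\<lambda>i. x n * e i)\<bar> \<ge> r" by metis
  obtain l \<rho> where l: "strict_mono (\<rho> :: nat \<Rightarrow> nat)" "(x \<circ> \<rho>) \<longlonglongrightarrow> l"
    using compact_Icc[of "-K" K, unfolded compact_def, THEN spec, of x] xy(1) by blast
  have cont: "isCont F z" for z using F by (simp add: continuous_on_eq_continuous_at)
  have xl: "(\<lambda>n. x (\<rho> n) * e i) \<longlonglongrightarrow> l * e i" for i
    using l(2) unfolding comp_def by (intro tendsto_intros)
  have yl: "(\<lambda>n. y (\<rho> n) i) \<longlonglongrightarrow> l * e i" for i
  proof -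
    have "(\<lambda>n. y n i - x n * e i) \<longlonglongrightarrow> 0"
      by (rule Lim_null_comparison[OF _ LIMSEQ_inverse_real_of_nat])
         (use xy(2) in \<open>auto intro!: always_eventually less_imp_le\<close>)
    from LIMSEQ_subseq_LIMSEQ[OF this l(1)] have "(\<lambda>n. y (\<rho> n) i - x (\<rho> n) * e i) \<longlonglongrightarrow> 0"
      by (simp add: comp_def)
    from tendsto_add[OF this xl[of i]] show ?thesis by simp
  qed
  have "(\<lambda>n. F (y (\<rho> n))) \<longlonglongrightarrow> F (\<lambda>i. l * e i)"
    by (rule isCont_tendsto_compose[OF cont tendsto_fun_coordinatewise[OF yl]])
  moreover have "(\<lambda>n. F (\<lambda>i. x (\<rho> n) * e i)) \<longlonglongrightarrow> F (\<lambda>i. l * e i)"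
    by (rule isCont_tendsto_compose[OF cont tendsto_fun_coordinatewise[OF xl]])
  ultimately have "(\<lambda>n. \<bar>F (y (\<rho> n)) - F (\<lambda>i. x (\<rho> n) * e i)\<bar>) \<longlonglongrightarrow> \<bar>F (\<lambda>i. l * e i) - F (\<lambda>i. l * e i)\<bar>"
    by (intro tendsto_intros)
  then have "r \<le> \<bar>F (\<lambda>i. l * e i) - F (\<lambda>i. l * e i)\<bar>"
    by (rule LIMSEQ_le_const) (use xy(3) in auto)
  with r show False by simp
qed

text \<open>Up to small probability tightness confines \<open>U n\<close> to a compact interval,
  where \<open>uniformly_close_to_line\<close> replaces the values \<open>Y n t\<close> by
  \<open>U n * t\<close>. What remains is a bounded continuous function of the single real variable
  \<open>U n\<close>, to which weak convergence applies.\<close>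

theorem fdd_converge_to_line:
  fixes M :: "'b measure" and Y :: "nat \<Rightarrow> real \<Rightarrow> 'b \<Rightarrow> real" and U :: "nat \<Rightarrow> 'b \<Rightarrow> real"
  assumes M: "prob_space M" and Q: "real_distribution Q"
    and U: "\<And>n. U n \<in> borel_measurable M" and Y: "\<And>n t. t \<in> T \<Longrightarrow> Y n t \<in> borel_measurable M"
    and tight: "tight (\<lambda>n. distr M borel (U n))"
    and weak: "weak_conv_m (\<lambda>n. distr M borel (U n)) Q"
    and close: "\<And>t e. t \<in> T \<Longrightarrow> e > 0 \<Longrightarrow> (\<lambda>n. measure M {w \<in> space M. \<bar>Y n t w - U n w * t\<bar> \<ge> e}) \<longlonglongrightarrow> 0"
  shows "fdd_converge T M Y Q (\<lambda>t x. x * t)"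
  unfolding fdd_converge_def converges_in_distribution_def
proof (intro allI impI, elim conjE)
  fix I f
  assume I: "I \<subseteq> T" "finite I" and cont_f: "continuous_map (product_topology (\<lambda>_. euclideanreal) I) euclideanreal f"
    and bdd: "bounded (f ` topspace (product_topology (\<lambda>_. euclideanreal) I))"
  interpret prob_space M by fact
  interpret Q: real_distribution Q by fact
  show "(\<lambda>n. \<integral>w. f (restrict (\<lambda>t. Y n t w) I) \<partial>M) \<longlonglongrightarrow> (\<integral>x. f (restrict (\<lambda>t. x * t) I) \<partial>Q)"
  \<comment> \<open>\<open>from_nat_into\<close> needs a nonempty set; without any times both sides
    integrate the same constant over a probability space.\<close>
  proof (cases "I = {}")
    case True
    then show ?thesis by (simp add: prob_space Q.prob_space[simplified] restrict_def)
  next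
    case False
    have cI: "countable I" using I(2) by (rule countable_finite)
    \<comment> \<open>\<open>e\<close> lists the times along the naturals, with indices outside the
      numbering of \<open>I\<close> sent to some element of \<open>I\<close>. This moves the test
      function from extensional functions on \<open>I\<close> to the type
      \<open>nat \<Rightarrow> real\<close>, which has a topology and a Borel structure of its
      own.\<close>
    define e where "e = from_nat_into I"
    define g where "g y = restrict (\<lambda>t. y (to_nat_on I t)) I" for y :: "nat \<Rightarrow> real"
    define F where "F y = f (g y)" for y
    have e_in: "e i \<in> I" for i unfolding e_def by (rule from_nat_into[OF False])
    have g_e: "g (\<lambda>i. h (e i)) = restrict h I" for h
      using cI by (auto simp: g_def e_def fun_eq_iff restrict_def)
    have "continuous_map euclidean (product_topology (\<lambda>_. euclideanreal) I) g"
      unfolding continuous_map_componentwise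
    proof (intro conjI ballI)
      show "g ` topspace euclidean \<subseteq> extensional I" by (auto simp: g_def)
      show "continuous_map euclidean euclideanreal (\<lambda>y. g y t)" if "t \<in> I" for t
        using that by (simp add: g_def)
    qed
    from continuous_map_compose[OF this cont_f]
    have F: "continuous_on UNIV F" by (simp add: comp_def F_def[abs_def])
    then have [measurable]: "F \<in> borel_measurable borel" by (rule borel_measurable_continuous_onI)
    have g_top: "g y \<in> topspace (product_topology (\<lambda>_. euclideanreal) I)" for y
      by (auto simp: g_def)
    obtain B where B: "\<And>y. \<bar>F y\<bar> \<le> B"
      using bdd g_top unfolding bounded_iff F_def by (metis imageI real_norm_def)
    have B0: "B \<ge> 0" using B[of undefined] by linarith
    define H where "H x = F (\<lambda>i. x * e i)" for x :: real
    have HB: "\<bar>H x\<bar> \<le> B" for x by (simp add: B H_def)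
    have Hc: "continuous_on UNIV H"
      unfolding H_def by (rule continuous_on_compose2[OF F]) (auto intro!: continuous_intros)
    have [measurable]: "H \<in> borel_measurable borel" using Hc by (rule borel_measurable_continuous_onI)
    define y where "y n w = (\<lambda>i. Y n (e i) w)" for n w
    have [measurable]: "y n \<in> borel_measurable M" for n
      unfolding y_def using e_in I(1) Y by (intro measurable_coordinatewise_then_product) auto
    note U[measurable]
    have Ym[measurable]: "t \<in> I \<Longrightarrow> Y n t \<in> borel_measurable M" for n t using Y I(1) by auto
    have fY: "f (restrict (\<lambda>t. Y n t w) I) = F (y n w)" for n w
      unfolding F_def y_def using g_e[of "\<lambda>t. Y n t w"] by simp
    have fH: "f (restrict (\<lambda>t. x * t) I) = H x" for x
      unfolding F_def H_def using g_e[of "\<lambda>t. x * t"] by simp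
    have intF: "integrable M (\<lambda>w. F (y n w))" for n
      by (rule integrable_const_bound[where B = B]) (auto simp: B)
    have intH: "integrable M (\<lambda>w. H (U n w))" for n
      by (rule integrable_const_bound[where B = B]) (auto simp: HB)
    have lim1: "(\<lambda>n. \<integral>w. H (U n w) \<partial>M) \<longlonglongrightarrow> (\<integral>x. H x \<partial>Q)"
    proof -
      have "(\<lambda>n. \<integral>x. H x \<partial>distr M borel (U n)) \<longlonglongrightarrow> (\<integral>x. H x \<partial>Q)"
      proof (rule weak_conv_imp_integral_bdd_continuous_conv[OF _ Q weak])
        show "real_distribution (distr M borel (U n))" for n by simp
        show "isCont H x" for x using Hc by (simp add: continuous_on_eq_continuous_at)
        show "norm (H x) \<le> B" for x by (simp add: HB)
      qed
      then show ?thesis by (simp add: integral_distr)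
    qed
    have lim2: "(\<lambda>n. (\<integral>w. F (y n w) \<partial>M) - (\<integral>w. H (U n w) \<partial>M)) \<longlonglongrightarrow> 0"
    proof (rule LIMSEQ_I)
      fix r0 :: real assume r0: "r0 > 0"
      \<comment> \<open>The error terms below add up to at most \<open>r * (1 + 4 * B)\<close>,
        which this choice keeps strictly under \<open>r0\<close>.\<close>
      define r where "r = r0 / (2 + 4 * B)"
      have r: "r > 0" using r0 B0 by (simp add: r_def)
      obtain K where K: "K > 0" "\<And>n. measure M {w \<in> space M. \<bar>U n w\<bar> > K} < r"
        using tight_imp_tail[OF tight U M r] by metis
      from uniformly_close_to_line[OF F r, of K e]
      obtain \<delta> where \<delta>: "\<delta> > 0"
        "\<And>x y. x \<in> {-K..K} \<Longrightarrow> (\<And>i. \<bar>y i - x * e i\<bar> < \<delta>) \<Longrightarrow> \<bar>F y - F (\<lambda>i. x * e i)\<bar> < r" by blast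
      define p where "p n = (\<Sum>t\<in>I. measure M {w \<in> space M. \<bar>Y n t w - U n w * t\<bar> \<ge> \<delta>})" for n
      have "p \<longlonglongrightarrow> (\<Sum>t\<in>I. 0)"
        unfolding p_def using I(1) by (intro tendsto_sum close \<delta>(1)) auto
      then have "eventually (\<lambda>n. p n < r) sequentially"
        using r by (intro order_tendstoD(2)) auto
      then obtain n0 where n0: "\<And>n. n \<ge> n0 \<Longrightarrow> p n < r" by (auto simp: eventually_sequentially)
      have "norm ((\<integral>w. F (y n w) \<partial>M) - (\<integral>w. H (U n w) \<partial>M) - 0) < r0" if n: "n \<ge> n0" for n
      proof -
        \<comment> \<open>A majorant of the difference: \<open>r\<close> where everything is close,
          plus the trivial bound \<open>2 * B\<close> on each exceptional event.\<close>
        define D where "D w = r + 2 * B * indicator {w \<in> space M. \<bar>U n w\<bar> > K} w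
             + (\<Sum>t\<in>I. 2 * B * indicator {w \<in> space M. \<bar>Y n t w - U n w * t\<bar> \<ge> \<delta>} w)" for w
        have ind: "integrable M (indicat_real {w \<in> space M. \<bar>U n w\<bar> > K})"
          "\<And>t. t \<in> I \<Longrightarrow> integrable M (indicat_real {w \<in> space M. \<bar>Y n t w - U n w * t\<bar> \<ge> \<delta>})"
          by (auto intro!: integrable_real_indicator simp: emeasure_eq_measure)
        have "norm ((\<integral>w. F (y n w) \<partial>M) - (\<integral>w. H (U n w) \<partial>M) - 0) = norm (\<integral>w. F (y n w) - H (U n w) \<partial>M)"
          using intF intH by simp
        also have "\<dots> \<le> (\<integral>w. D w \<partial>M)"
        proof (rule order_trans[OF integral_norm_bound integral_mono])
          show "integrable M D" unfolding D_def using ind by (intro Bochner_Integration.integrable_add integrable_mult_right Bochner_Integration.integrable_sum integrable_const)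
          fix w assume w: "w \<in> space M"
          show "norm (F (y n w) - H (U n w)) \<le> D w"
          proof (cases "\<bar>U n w\<bar> > K \<or> (\<exists>t\<in>I. \<bar>Y n t w - U n w * t\<bar> \<ge> \<delta>)")
            case True
            have nn: "(0::real) \<le> 2 * B * indicator A w" for A using B0 by simp
            have sum_nn: "0 \<le> (\<Sum>t\<in>I. 2 * B * indicat_real {w \<in> space M. \<bar>Y n t w - U n w * t\<bar> \<ge> \<delta>} w)"
              by (intro sum_nonneg nn)
            have "2 * B \<le> D w"
            proof (cases "\<bar>U n w\<bar> > K")
              case True
              then show ?thesis unfolding D_def using sum_nn r w by simp
            next
              case False
              then obtain t where t: "t \<in> I" "\<bar>Y n t w - U n w * t\<bar> \<ge> \<delta>" using True by auto
              have "2 * B = 2 * B * indicat_real {w \<in> space M. \<bar>Y n t w - U n w * t\<bar> \<ge> \<delta>} w" using t w by simp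
              also have "\<dots> \<le> (\<Sum>t\<in>I. 2 * B * indicat_real {w \<in> space M. \<bar>Y n t w - U n w * t\<bar> \<ge> \<delta>} w)"
                by (rule member_le_sum[OF t(1) nn I(2)])
              finally show ?thesis unfolding D_def using r nn[of "{w \<in> space M. \<bar>U n w\<bar> > K}"] by linarith
            qed
            moreover have "norm (F (y n w) - H (U n w)) \<le> 2 * B"
              using B[of "y n w"] B[of "\<lambda>i. U n w * e i"] unfolding H_def by simp
            ultimately show ?thesis by linarith
          next
            case False
            then have "\<bar>F (y n w) - F (\<lambda>i. U n w * e i)\<bar> < r"
              by (intro \<delta>(2)) (use e_in in \<open>auto simp: y_def not_le\<close>)
            moreover have "D w = r" using False by (auto simp: D_def indicator_def intro!: sum.neutral)
            ultimately show ?thesis by (simp add: H_def)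
          qed
        qed (use intF intH in auto)
        also have "(\<integral>w. D w \<partial>M) = r + 2 * B * prob {w \<in> space M. \<bar>U n w\<bar> > K} + 2 * B * p n"
          unfolding D_def p_def using ind
          by (subst Bochner_Integration.integral_add, (auto simp: prob_space sum_distrib_left)[2])+
             (auto simp: prob_space sum_distrib_left Bochner_Integration.integral_sum)
        also have "\<dots> \<le> r + 2 * B * r + 2 * B * r"
          using K(2)[of n] n0[OF n] B0 by (intro add_mono mult_left_mono) auto
        also have "\<dots> = r * (1 + 4 * B)" by (simp add: algebra_simps)
        also have "\<dots> < r0" using B0 r0 by (simp add: r_def divide_simps)
        finally show ?thesis .
      qed
      then show "\<exists>no. \<forall>n\<ge>no. norm ((\<integral>w. F (y n w) \<partial>M) - (\<integral>w. H (U n w) \<partial>M) - 0) < r0" by blast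
    qed
    have "(\<lambda>n. \<integral>w. F (y n w) \<partial>M) \<longlonglongrightarrow> (\<integral>x. H x \<partial>Q)"
      using tendsto_add[OF lim2 lim1] by simp
    then show ?thesis by (simp add: fY fH)
  qed
qed

section \<open>Asymptotics of the mixed characteristic exponent\<close>

text \<open>Nonnegativity makes a gauge integral absolutely convergent; this moves closed forms
  available for \<open>has_integral\<close> to \<open>lborel\<close>.\<close>

lemma has_integral_nonneg_lborel:
  fixes f :: "real \<Rightarrow> real"
  assumes [measurable]: "f \<in> borel_measurable borel" "S \<in> sets borel"
    and "\<And>x. x \<in> S \<Longrightarrow> 0 \<le> f x" and "(f has_integral I) S"
  shows "integrable lborel (\<lambda>x. indicator S x * f x)" "(LINT x|lborel. indicator S x * f x) = I"
proof -
  have I: "I \<ge> 0" using assms(3,4) by (rule has_integral_nonneg[rotated])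
  have nn: "(\<integral>\<^sup>+x. ennreal (indicator S x * f x) \<partial>lborel) = ennreal I"
    using nn_integral_has_integral_lebesgue[OF assms(3,4)] by simp
  have pos: "AE x in lborel. 0 \<le> indicator S x * f x"
    using assms(3) by (auto simp: indicator_def)
  show "integrable lborel (\<lambda>x. indicator S x * f x)"
    by (rule integrableI_nn_integral_finite[OF _ pos nn]) measurable
  show "(LINT x|lborel. indicator S x * f x) = I"
    by (subst integral_eq_nn_integral[OF _ pos]) (auto simp: nn I)
qed

text \<open>Near 0 the constant 2 suffices because \<beta> > -1, near infinity the decay
  \<open>d / u\<close> suffices because \<beta> < 0. This is the majorant for the dominated
  convergence in \<open>mixture_exp_asymptotics\<close>.\<close>

lemma integrable_powr_min:
  fixes \<beta> d :: real
  assumes \<beta>: "-1 < \<beta>" "\<beta> < 0" and d: "d \<ge> 0"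
  shows "integrable lborel (\<lambda>u. indicator {0<..} u * (u powr \<beta> * min 2 (d / u)))"
proof (rule Bochner_Integration.integrable_bound)
  have 1: "integrable lborel (\<lambda>u. indicator {0..1} u * (u powr \<beta>))"
    by (rule has_integral_nonneg_lborel(1)[OF _ _ _ has_integral_powr_from_0]) (use \<beta> in auto)
  have 2: "integrable lborel (\<lambda>u. indicator {1..} u * (u powr (\<beta> - 1)))"
    by (rule has_integral_nonneg_lborel(1)[OF _ _ _ has_integral_powr_to_inf]) (use \<beta> in auto)
  show "integrable lborel (\<lambda>u. 2 * (indicator {0..1} u * (u powr \<beta>)) + d * (indicator {1..} u * (u powr (\<beta> - 1))))"
    using 1 2 by auto
  show "AE u in lborel. norm (indicator {0<..} u * (u powr \<beta> * min 2 (d / u))) \<le>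
      norm (2 * (indicator {0..1} u * (u powr \<beta>)) + d * (indicator {1..} u * (u powr (\<beta> - 1))))"
  proof (intro AE_I2)
    fix u :: real
    consider "u \<le> 0" | "0 < u" "u \<le> 1" | "u > 1" by linarith
    then show "norm (indicator {0<..} u * (u powr \<beta> * min 2 (d / u))) \<le>
      norm (2 * (indicator {0..1} u * (u powr \<beta>)) + d * (indicator {1..} u * (u powr (\<beta> - 1))))"
    proof cases
      case 2
      have "u powr \<beta> * min 2 (d / u) \<le> u powr \<beta> * 2" by (intro mult_left_mono) auto
      also have "\<dots> \<le> 2 * u powr \<beta> + d * (indicator {1..} u * (u powr (\<beta> - 1)))" using d by simp
      finally show ?thesis using 2 d by (simp add: indicator_def)
    next
      case 3
      have "u powr \<beta> * min 2 (d / u) \<le> u powr \<beta> * (d / u)" by (intro mult_left_mono) auto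
      also have "\<dots> = d * u powr (\<beta> - 1)" using 3 by (simp add: powr_diff)
      finally show ?thesis using 3 d by (simp add: indicator_def)
    qed auto
  qed
qed measurable

text \<open>The substitution y = c / u maps the half line onto itself and produces the Gamma
  integral with exponent -\<beta> - 1, convergent at 0 because \<beta> < 0.\<close>

lemma integral_powr_exp_neg_inverse:
  fixes \<beta> c :: real
  assumes \<beta>: "\<beta> < 0" and c: "c > 0"
  shows "integrable lborel (\<lambda>u. indicator {0<..} u * (u powr (\<beta> - 1) * exp (- (c / u))))"
    and "(LINT u|lborel. indicator {0<..} u * (u powr (\<beta> - 1) * exp (- (c / u)))) = c powr \<beta> * Gamma (- \<beta>)"
proof -
  define f where "f y = c powr \<beta> * (y powr (- \<beta> - 1) / exp y)" for y :: real
  have im: "(\<lambda>x. c / x) ` {0<..} = {0<..}"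
  proof safe
    fix y :: real assume "y > 0"
    then show "y \<in> (\<lambda>x. c / x) ` {0<..}" using c by (intro image_eqI[where x = "c / y"]) auto
  qed (use c in auto)
  have "((\<lambda>t. t powr (- \<beta> - 1) / exp t) has_integral Gamma (- \<beta>)) {0..}"
    using \<beta> by (intro Gamma_integral_real) auto
  then have "(f has_integral (c powr \<beta> * Gamma (- \<beta>))) {0..}"
    unfolding f_def by (rule has_integral_mult_right)
  then have hf: "(f has_integral (c powr \<beta> * Gamma (- \<beta>))) {0<..}"
    by (rule has_integral_spike_set_eq[THEN iffD1, rotated -1]) (auto intro: negligible_subset[of "{0}"])
  then have abs: "f absolutely_integrable_on {0<..}"
    by (intro nonnegative_absolutely_integrable_1) (auto simp: f_def has_integral_integrable)
  have "(\<lambda>x. \<bar>- c / x\<^sup>2\<bar> * f (c / x)) absolutely_integrable_on {0<..} \<and>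
      integral {0<..} (\<lambda>x. \<bar>- c / x\<^sup>2\<bar> * f (c / x)) = c powr \<beta> * Gamma (- \<beta>)"
  proof (rule has_absolute_integral_change_of_variables_1'[where g = "\<lambda>x. c / x" and g' = "\<lambda>x. - c / x\<^sup>2" and S = "{0<..}", THEN iffD2])
    show "((\<lambda>x. c / x) has_real_derivative - c / x\<^sup>2) (at x within {0<..})" if "x \<in> {0<..}" for x
      using that by (auto intro!: derivative_eq_intros simp: power2_eq_square)
    show "inj_on (\<lambda>x. c / x) {0<..}" using c by (auto simp: inj_on_def)
    show "f absolutely_integrable_on (\<lambda>x. c / x) ` {0<..} \<and> integral ((\<lambda>x. c / x) ` {0<..}) f = c powr \<beta> * Gamma (- \<beta>)"
      unfolding im using abs hf by (simp add: integral_unique)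
  qed auto
  then have "((\<lambda>x. \<bar>- c / x\<^sup>2\<bar> * f (c / x)) has_integral (c powr \<beta> * Gamma (- \<beta>))) {0<..}"
    using absolutely_integrable_on_def has_integral_integral by metis
  moreover have "\<bar>- c / x\<^sup>2\<bar> * f (c / x) = x powr (\<beta> - 1) * exp (- (c / x))" if "x \<in> {0<..}" for x
  proof -
    have x: "x > 0" using that by simp
    have "c powr \<beta> * (c / x) powr (- \<beta> - 1) = x powr (\<beta> + 1) / c"
      using x c by (simp add: powr_divide powr_diff powr_minus powr_add field_simps)
    then have "\<bar>- c / x\<^sup>2\<bar> * f (c / x) = (c / x\<^sup>2) * (x powr (\<beta> + 1) / c) / exp (c / x)"
      using x c by (simp add: f_def abs_mult)
    also have "(c / x\<^sup>2) * (x powr (\<beta> + 1) / c) = x powr (\<beta> - 1)"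
      using x c by (simp add: powr_diff powr_add power2_eq_square field_simps)
    finally show ?thesis by (simp add: exp_minus divide_inverse)
  qed
  ultimately have hi: "((\<lambda>x. x powr (\<beta> - 1) * exp (- (c / x))) has_integral (c powr \<beta> * Gamma (- \<beta>))) {0<..}"
    by (rule has_integral_eq[rotated])
  show "integrable lborel (\<lambda>u. indicator {0<..} u * (u powr (\<beta> - 1) * exp (- (c / u))))"
    "(LINT u|lborel. indicator {0<..} u * (u powr (\<beta> - 1) * exp (- (c / u)))) = c powr \<beta> * Gamma (- \<beta>)"
    using has_integral_nonneg_lborel[OF _ _ _ hi] by auto
qed

lemma one_minus_exp_le_min: "x \<ge> 0 \<Longrightarrow> \<bar>1 - exp (- x)\<bar> \<le> min 2 (x :: real)"
proof -
  assume "x \<ge> 0"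
  then have "0 < exp (- x)" "exp (- x) \<le> 1" "1 - x \<le> exp (- x)"
    using exp_ge_add_one_self[of "- x"] by auto
  then show ?thesis by (intro min.boundedI) linarith+
qed

lemma integrable_powr_one_minus_exp:
  fixes \<beta> c :: real
  assumes \<beta>: "-1 < \<beta>" "\<beta> < 0" and c: "c > 0"
  shows "integrable lborel (\<lambda>u. indicator {0<..} u * (u powr \<beta> * (1 - exp (- (c / u)))))"
proof (rule Bochner_Integration.integrable_bound[OF integrable_powr_min[OF \<beta>, of c]])
  show "AE u in lborel. norm (indicator {0<..} u * (u powr \<beta> * (1 - exp (- (c / u))))) \<le>
      norm (indicator {0<..} u * (u powr \<beta> * min 2 (c / u)))"
  proof (intro AE_I2)
    fix u :: real
    show "norm (indicator {0<..} u * (u powr \<beta> * (1 - exp (- (c / u))))) \<le>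
      norm (indicator {0<..} u * (u powr \<beta> * min 2 (c / u)))"
    proof (cases "u > 0")
      case True
      then have "\<bar>1 - exp (- (c / u))\<bar> \<le> \<bar>min 2 (c / u)\<bar>"
        using one_minus_exp_le_min[of "c / u"] c by simp
      then show ?thesis by (simp add: abs_mult mult_left_mono)
    qed simp
  qed
qed (use c in auto)

text \<open>Integration by parts: differentiating 1 - exp (- c / u) trades u^(\<beta> + 1) /
  (\<beta> + 1) for the integrand of \<open>integral_powr_exp_neg_inverse\<close>, and the boundary
  function \<open>F\<close> vanishes at both ends.\<close>

lemma integral_powr_one_minus_exp:
  fixes \<beta> c :: real
  assumes \<beta>: "-1 < \<beta>" "\<beta> < 0" and c: "c > 0"
  shows "(LINT u|lborel. indicator {0<..} u * (u powr \<beta> * (1 - exp (- (c / u))))) =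
         c powr (1 + \<beta>) * Gamma (- \<beta>) / (1 + \<beta>)"
proof -
  define F where "F u = u powr (\<beta> + 1) / (\<beta> + 1) * (1 - exp (- (c / u)))" for u :: real
  define g where "g u = u powr \<beta> * (1 - exp (- (c / u)))" for u :: real
  define h where "h u = u powr (\<beta> - 1) * exp (- (c / u))" for u :: real
  have int_g: "integrable lborel (\<lambda>u. indicator {0<..} u * g u)"
    unfolding g_def by (rule integrable_powr_one_minus_exp[OF assms])
  note int_h = integral_powr_exp_neg_inverse[OF \<beta>(2) c, folded h_def]
  have ein: "einterval 0 \<infinity> = {0<..}" by (auto simp: einterval_def)
  \<comment> \<open>The first bound gives the limit at 0, where \<beta> + 1 > 0; the second, from 1
    - exp (- x) at most x, gives the limit at infinity, where \<beta> < 0.\<close>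
  have F_le: "\<bar>F u\<bar> \<le> u powr (\<beta> + 1) / (\<beta> + 1)" "\<bar>F u\<bar> \<le> c / (\<beta> + 1) * u powr \<beta>" if "u > 0" for u
  proof -
    have *: "0 \<le> 1 - exp (- (c / u))" "1 - exp (- (c / u)) \<le> 1" "1 - exp (- (c / u)) \<le> c / u"
      using that c exp_ge_add_one_self[of "- (c / u)"] by auto
    have F: "\<bar>F u\<bar> = u powr (\<beta> + 1) / (\<beta> + 1) * (1 - exp (- (c / u)))"
      using * \<beta> that by (simp add: F_def abs_mult)
    show "\<bar>F u\<bar> \<le> u powr (\<beta> + 1) / (\<beta> + 1)"
      unfolding F using * \<beta> by (intro mult_left_le) auto
    have "\<bar>F u\<bar> \<le> u powr (\<beta> + 1) / (\<beta> + 1) * (c / u)"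
      unfolding F using * \<beta> by (intro mult_left_mono) auto
    also have "\<dots> = c / (\<beta> + 1) * u powr \<beta>" using that by (simp add: powr_add)
    finally show "\<bar>F u\<bar> \<le> c / (\<beta> + 1) * u powr \<beta>" .
  qed
  have "(LBINT u=0..\<infinity>. g u - c / (\<beta> + 1) * h u) = 0 - 0"
  proof (rule interval_integral_FTC_integrable)
    show "(F has_vector_derivative g u - c / (\<beta> + 1) * h u) (at u)" if "0 < ereal u" for u
    proof -
      have u: "u > 0" using that by simp
      have D: "((\<lambda>u. u powr (\<beta> + 1)) has_real_derivative (\<beta> + 1) * u powr \<beta>) (at u)"
        using has_real_derivative_powr[OF u, of "\<beta> + 1"] by simp
      have E: "((\<lambda>u. 1 - exp (- (c / u))) has_real_derivative - (exp (- (c / u)) * (c / u\<^sup>2))) (at u)"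
        using u by (auto intro!: derivative_eq_intros simp: power2_eq_square)
      have "(\<beta> + 1) * u powr \<beta> / (\<beta> + 1) * (1 - exp (- (c / u))) +
          - (exp (- (c / u)) * (c / u\<^sup>2)) * (u powr (\<beta> + 1) / (\<beta> + 1)) = g u - c / (\<beta> + 1) * h u"
        unfolding g_def h_def using u \<beta> by (simp add: powr_add powr_diff power2_eq_square mult_ac)
      with DERIV_mult[OF DERIV_cdivide[OF D, of "\<beta> + 1"] E]
      have "(F has_real_derivative g u - c / (\<beta> + 1) * h u) (at u)"
        unfolding F_def by simp
      then show ?thesis by (simp add: has_real_derivative_iff_has_vector_derivative)
    qed
    show "isCont (\<lambda>u. g u - c / (\<beta> + 1) * h u) u" if "0 < ereal u" for u
      using that \<beta> unfolding g_def h_def by (auto intro!: continuous_intros)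
    show "set_integrable lborel (einterval 0 \<infinity>) (\<lambda>u. g u - c / (\<beta> + 1) * h u)"
      using Bochner_Integration.integrable_diff[OF int_g integrable_mult_right[OF int_h(1), of "c / (\<beta> + 1)"]]
      unfolding ein set_integrable_def by (simp add: algebra_simps)
    have "((\<lambda>u. u powr (\<beta> + 1) / (\<beta> + 1)) \<longlongrightarrow> 0) (at_right 0)"
      using \<beta> by real_asymp
    then have "(F \<longlongrightarrow> 0) (at_right 0)"
      by (rule Lim_null_comparison[rotated]) (use F_le in \<open>auto simp: eventually_at_filter\<close>)
    then show "((F \<circ> real_of_ereal) \<longlongrightarrow> 0) (at_right 0)"
      unfolding zero_ereal_def by (simp add: ereal_tendsto_simps)
    have "((\<lambda>u. c / (\<beta> + 1) * u powr \<beta>) \<longlongrightarrow> 0) at_top"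
      using \<beta> by real_asymp
    then have "(F \<longlongrightarrow> 0) at_top"
      by (rule Lim_null_comparison[rotated]) (use F_le in \<open>auto intro: eventually_mono[OF eventually_gt_at_top[of 0]]\<close>)
    then show "((F \<circ> real_of_ereal) \<longlongrightarrow> 0) (at_left \<infinity>)"
      by (simp add: ereal_tendsto_simps)
  qed simp
  then have "(LINT u|lborel. indicator {0<..} u * g u - c / (\<beta> + 1) * (indicator {0<..} u * h u)) = 0"
    by (simp add: interval_lebesgue_integral_def set_lebesgue_integral_def ein algebra_simps)
  then have "(LINT u|lborel. indicator {0<..} u * g u) = c / (\<beta> + 1) * (c powr \<beta> * Gamma (- \<beta>))"
    using int_g int_h by (subst (asm) Bochner_Integration.integral_diff) auto
  also have "\<dots> = c powr (1 + \<beta>) * Gamma (- \<beta>) / (1 + \<beta>)"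
    using c by (simp add: powr_add add.commute)
  finally show ?thesis by (simp add: g_def)
qed

section \<open>The exponent of a centred Poisson variable\<close>

text \<open>Mean value inequality on the closed left half plane, a convex set on which the
  derivative \<open>exp\<close> has norm at most 1.\<close>

lemma norm_exp_minus_one_le:
  assumes "Re z \<le> 0" shows "cmod (1 - exp z) \<le> cmod z"
proof -
  have "cmod (exp z - exp 0) \<le> 1 * cmod (z - 0)"
  proof (rule field_differentiable_bound[where S = "{z. Re z \<le> 0}" and f' = exp])
    show "convex {z. Re z \<le> 0}" by (rule convex_halfspace_Re_le)
    show "(exp has_field_derivative exp z) (at z within {z. Re z \<le> 0})" for z
      by (auto intro!: derivative_eq_intros)
  qed (use assms in auto)
  then show ?thesis by (simp add: norm_minus_commute)
qed

text \<open>For a Poisson variable of rate \<open>r\<close> minus its mean, the characteristic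
  function at \<open>s\<close> is the exponential of \<open>r * iexp_rem s\<close>.\<close>

definition iexp_rem :: "real \<Rightarrow> complex" where
  "iexp_rem s = iexp s - 1 - \<i> * of_real s"

lemma cmod_iexp_rem: "cmod (iexp_rem s) \<le> s\<^sup>2 / 2"
proof -
  have sum: "(\<Sum>k\<le>1. (\<i> * of_real s) ^ k / fact k) = 1 + (\<i> * of_real s :: complex)" by simp
  have "(fact (Suc 1) :: real) = 2" "Suc 1 = 2" by simp_all
  then have "cmod (iexp s - (1 + \<i> * of_real s)) \<le> \<bar>s\<bar>\<^sup>2 / 2"
    using iexp_approx1[of s 1] unfolding sum by (simp add: power2_eq_square)
  then show ?thesis by (simp add: iexp_rem_def diff_diff_eq)
qed

lemma Re_iexp_rem: "Re (iexp_rem s) \<le> 0"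
proof -
  have "Re (iexp s) = cos s" by (simp add: Re_exp)
  then show ?thesis by (simp add: iexp_rem_def)
qed

lemma tendsto_iexp_rem:
  fixes s :: "nat \<Rightarrow> real"
  assumes "s \<longlonglongrightarrow> 0" "\<And>n. s n \<noteq> 0"
  shows "(\<lambda>n. iexp_rem (s n) /\<^sub>R (s n)\<^sup>2) \<longlonglongrightarrow> - (1 / 2)"
proof (rule LIM_zero_cancel, rule Lim_null_comparison)
  show "(\<lambda>n. \<bar>s n\<bar> / 6) \<longlonglongrightarrow> 0"
    using assms(1) by (auto intro!: tendsto_eq_intros)
  show "eventually (\<lambda>n. norm (iexp_rem (s n) /\<^sub>R (s n)\<^sup>2 - - (1 / 2)) \<le> \<bar>s n\<bar> / 6) sequentially"
  proof (rule always_eventually, rule allI)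
    fix n
    define x where "x = s n"
    have x: "x \<noteq> 0" using assms(2) by (simp add: x_def)
    have sum: "(\<Sum>k\<le>2. (\<i> * of_real x) ^ k / fact k) = 1 + \<i> * of_real x - (of_real (x\<^sup>2 / 2) :: complex)"
      by (simp add: numeral_2_eq_2 power2_eq_square algebra_simps)
    have "cmod (iexp_rem x + of_real (x\<^sup>2 / 2)) \<le> \<bar>x\<bar> ^ 3 / 6"
    proof -
      have "(fact (Suc 2) :: real) = 6" "Suc 2 = 3" by (simp_all add: fact_numeral)
      then have "cmod (iexp x - (1 + \<i> * of_real x - of_real (x\<^sup>2 / 2))) \<le> \<bar>x\<bar> ^ 3 / 6"
        using iexp_approx1[of x 2] unfolding sum by simp
      moreover have "iexp x - (1 + \<i> * of_real x - of_real (x\<^sup>2 / 2)) = iexp_rem x + of_real (x\<^sup>2 / 2)"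
        by (simp add: iexp_rem_def)
      ultimately show ?thesis by (simp only:)
    qed
    moreover have "iexp_rem x /\<^sub>R x\<^sup>2 - - (1 / 2) = (iexp_rem x + of_real (x\<^sup>2 / 2)) /\<^sub>R x\<^sup>2"
      using x by (simp add: scaleR_conv_of_real field_simps)
    moreover have "\<bar>x\<bar> ^ 3 / 6 / x\<^sup>2 = \<bar>x\<bar> / 6"
    proof -
      have "\<bar>x\<bar> ^ 3 = \<bar>x\<bar> * x\<^sup>2" by (simp add: power3_eq_cube power2_eq_square mult.assoc)
      then show ?thesis using x by simp
    qed
    moreover have "cmod (z /\<^sub>R x\<^sup>2) = cmod z / x\<^sup>2" for z
      by (simp add: divide_inverse mult.commute)
    moreover have "cmod (iexp_rem x + of_real (x\<^sup>2 / 2)) / x\<^sup>2 \<le> \<bar>x\<bar> ^ 3 / 6 / x\<^sup>2"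
      using calculation(1) by (rule divide_right_mono) simp
    ultimately show "norm (iexp_rem (s n) /\<^sub>R (s n)\<^sup>2 - - (1 / 2)) \<le> \<bar>s n\<bar> / 6"
      unfolding x_def[symmetric] by (simp only:)
  qed
qed

text \<open>The bound 2 is the size of a difference of two numbers in the unit disc, the other one
  is the quadratic size of \<open>iexp_rem\<close>. For r = lam / (1 - x) and 1 - x = s^2 u the
  latter becomes lam / (2 u), free of s, which is the shape of
  \<open>integrable_powr_min\<close>.\<close>

lemma one_minus_exp_iexp_rem_bound:
  assumes "r \<ge> 0" shows "cmod (1 - exp (of_real r * iexp_rem s)) \<le> min 2 (r * s\<^sup>2 / 2)"
proof -
  have Re: "Re (of_real r * iexp_rem s) \<le> 0" using assms Re_iexp_rem[of s] by (simp add: mult_nonneg_nonpos)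
  have "cmod (1 - exp (of_real r * iexp_rem s)) \<le> cmod 1 + cmod (exp (of_real r * iexp_rem s))"
    by (rule norm_triangle_ineq4)
  also have "\<dots> \<le> 2"
  proof -
    have "cmod (exp z) \<le> 1" if "Re z \<le> 0" for z using that by (simp add: norm_exp_eq_Re)
    from this[OF Re] show ?thesis by simp
  qed
  finally have "cmod (1 - exp (of_real r * iexp_rem s)) \<le> 2" .
  moreover have "cmod (1 - exp (of_real r * iexp_rem s)) \<le> cmod (of_real r * iexp_rem s)"
    by (rule norm_exp_minus_one_le[OF Re])
  moreover have "cmod (of_real r * iexp_rem s) \<le> r * (s\<^sup>2 / 2)"
    unfolding norm_mult using mult_left_mono[OF cmod_iexp_rem[of s] assms] assms by simp
  ultimately show ?thesis by simp
qed

text \<open>The quotient of the density by (1 - x)^\<beta> is controlled only near 1, so the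
  integral is cut at \<open>1 - \<delta>\<close>. The far part is of order s^2 and negligible
  against |s|^p because p < 2; the near part converges by dominated convergence after
  rescaling.\<close>

lemma mixture_exp_asymptotics:
  fixes q :: "real \<Rightarrow> real" and s :: "nat \<Rightarrow> real" and \<beta> lam \<psi>1 :: real
  assumes q: "integrable lborel q" and q_nonneg: "\<And>x. q x \<ge> 0"
    and supp: "\<And>x. x \<notin> {0<..<1} \<Longrightarrow> q x = 0"
    and lim: "((\<lambda>x. q x / (1 - x) powr \<beta>) \<longlongrightarrow> \<psi>1) (at_left 1)" and \<psi>1: "\<psi>1 > 0"
    and \<beta>: "-1 < \<beta>" "\<beta> < 0" and lam: "lam > 0"
    and s: "s \<longlonglongrightarrow> 0" "\<And>n. s n \<noteq> 0"
  shows "(\<lambda>n. (CLINT x|lborel. q x *\<^sub>R (1 - exp (of_real (lam / (1 - x)) * iexp_rem (s n)))) /\<^sub>R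
            \<bar>s n\<bar> powr (2 * (1 + \<beta>)))
      \<longlonglongrightarrow> of_real (\<psi>1 * (lam / 2) powr (1 + \<beta>) * (Gamma (- \<beta>) / (1 + \<beta>)))"
proof -
  have [measurable]: "q \<in> borel_measurable borel" using q by auto
  have [measurable]: "iexp_rem \<in> borel_measurable borel" unfolding iexp_rem_def by measurable
  define p where "p = 2 * (1 + \<beta>)"
  have p2: "p < 2" using \<beta> by (simp add: p_def)
  define G where "G n x = 1 - exp (of_real (lam / (1 - x)) * iexp_rem (s n))" for n and x :: real
  have [measurable]: "G n \<in> borel_measurable borel" for n unfolding G_def by measurable
  have G_bound: "cmod (G n x) \<le> min 2 (lam / (1 - x) * (s n)\<^sup>2 / 2)" if "x < 1" for n x
    unfolding G_def using that lam by (intro one_minus_exp_iexp_rem_bound) auto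
  \<comment> \<open>The limit supplies both the cut and the constant \<open>\<psi>1 + 1\<close> that
    dominates the density quotient on the near part.\<close>
  have "eventually (\<lambda>x. q x / (1 - x) powr \<beta> < \<psi>1 + 1) (at_left 1)"
    using lim by (rule order_tendstoD) simp
  then obtain d0 where d0: "d0 < 1" "\<And>x. d0 < x \<Longrightarrow> x < 1 \<Longrightarrow> q x / (1 - x) powr \<beta> < \<psi>1 + 1"
    unfolding eventually_at_left[OF zero_less_one] by auto
  define \<delta> where "\<delta> = 1 - d0"
  have \<delta>: "\<delta> > 0" using d0 by (simp add: \<delta>_def)
  have int_qG: "integrable lborel (\<lambda>x. q x *\<^sub>R G n x)" for n
  proof (rule Bochner_Integration.integrable_bound[of _ "\<lambda>x. 2 * q x"])
    show "AE x in lborel. norm (q x *\<^sub>R G n x) \<le> norm (2 * q x)"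
    proof (rule AE_I2)
      fix x show "norm (q x *\<^sub>R G n x) \<le> norm (2 * q x)"
      proof (cases "x < 1")
        case True
        then have "cmod (G n x) \<le> 2" using G_bound[of x n] by simp
        then show ?thesis using q_nonneg[of x] mult_left_mono[of "cmod (G n x)" 2 "q x"] by (simp add: mult.commute)
      qed (use supp[of x] in auto)
    qed
  qed (use q in auto)
  define f where "f n x = indicator {1-\<delta><..} x *\<^sub>R (q x *\<^sub>R G n x)" for n x
  define f' where "f' n x = indicator {..1-\<delta>} x *\<^sub>R (q x *\<^sub>R G n x)" for n x
  have int_f: "integrable lborel (f n)" "integrable lborel (f' n)" for n
    unfolding f_def f'_def by (rule integrable_mult_indicator[OF _ int_qG], simp)+
  have split: "(CLINT x|lborel. q x *\<^sub>R G n x) = (CLINT x|lborel. f n x) + (CLINT x|lborel. f' n x)" for n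
  proof -
    have "(CLINT x|lborel. q x *\<^sub>R G n x) = (CLINT x|lborel. f n x + f' n x)"
      by (rule Bochner_Integration.integral_cong) (auto simp: f_def f'_def indicator_def)
    then show ?thesis using int_f by simp
  qed

  have lim': "(\<lambda>n. (CLINT x|lborel. f' n x) /\<^sub>R \<bar>s n\<bar> powr p) \<longlonglongrightarrow> 0"
  proof (rule Lim_null_comparison)
    define K where "K = (LINT x|lborel. q x) * (lam / (2 * \<delta>))"
    show "eventually (\<lambda>n. norm ((CLINT x|lborel. f' n x) /\<^sub>R \<bar>s n\<bar> powr p) \<le> K * \<bar>s n\<bar> powr (2 - p)) sequentially"
    proof (rule always_eventually, rule allI)
      fix n
      have "norm (CLINT x|lborel. f' n x) \<le> (LINT x|lborel. q x * (lam / (2 * \<delta>) * (s n)\<^sup>2))"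
      proof (rule Bochner_Integration.integral_norm_bound_integral)
        fix x
        show "norm (f' n x) \<le> q x * (lam / (2 * \<delta>) * (s n)\<^sup>2)"
        proof (cases "x \<le> 1 - \<delta>")
          case True
          have "cmod (G n x) \<le> lam / (1 - x) * (s n)\<^sup>2 / 2" using G_bound[of x n] True \<delta> by simp
          also have "\<dots> \<le> lam / \<delta> * (s n)\<^sup>2 / 2"
            using True \<delta> lam by (intro divide_right_mono mult_right_mono divide_left_mono) auto
          finally have "q x * cmod (G n x) \<le> q x * (lam / \<delta> * (s n)\<^sup>2 / 2)"
            using q_nonneg by (rule mult_left_mono)
          then show ?thesis using True q_nonneg[of x] by (simp add: f'_def mult_ac)
        qed (use q_nonneg[of x] \<delta> lam in \<open>simp add: f'_def\<close>)
      qed (use int_f q in auto)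
      also have "\<dots> = K * (s n)\<^sup>2" by (simp add: K_def)
      finally have "norm (CLINT x|lborel. f' n x) / \<bar>s n\<bar> powr p \<le> K * (s n)\<^sup>2 / \<bar>s n\<bar> powr p"
        by (rule divide_right_mono) simp
      then have "norm ((CLINT x|lborel. f' n x) /\<^sub>R \<bar>s n\<bar> powr p) \<le> K * (s n)\<^sup>2 / \<bar>s n\<bar> powr p"
        by (simp add: divide_inverse mult.commute)
      also have "\<dots> = K * \<bar>s n\<bar> powr (2 - p)"
        using s(2)[of n] by (simp add: powr_diff)
      finally show "norm ((CLINT x|lborel. f' n x) /\<^sub>R \<bar>s n\<bar> powr p) \<le> K * \<bar>s n\<bar> powr (2 - p)" .
    qed
    have "(\<lambda>n. \<bar>s n\<bar> powr (2 - p)) \<longlonglongrightarrow> 0 powr (2 - p)"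
      using s(1) p2 by (intro tendsto_powr2 tendsto_rabs_zero tendsto_const) (auto intro!: always_eventually)
    then show "(\<lambda>n. K * \<bar>s n\<bar> powr (2 - p)) \<longlonglongrightarrow> 0"
      using tendsto_mult_right_zero[of "\<lambda>n. \<bar>s n\<bar> powr (2 - p)" sequentially K] by simp
  qed

  \<comment> \<open>The rescaled integrand. The Jacobian (s n)^2 and the power ((s n)^2)^\<beta>
    taken out of the density multiply to |s n|^p, which is the normalisation.\<close>
  define h where "h n u = (if 0 < u \<and> (s n)\<^sup>2 * u < \<delta> then q (1 - (s n)\<^sup>2 * u) / ((s n)\<^sup>2 * u) powr \<beta> else 0)
      *\<^sub>R (u powr \<beta> *\<^sub>R G n (1 - (s n)\<^sup>2 * u))" for n u
  have [measurable]: "h n \<in> borel_measurable borel" for n unfolding h_def by measurable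
  have f_eq: "(CLINT x|lborel. f n x) /\<^sub>R \<bar>s n\<bar> powr p = (CLINT u|lborel. h n u)" for n
  proof -
    define c where "c = (s n)\<^sup>2"
    have c: "c > 0" using s(2) by (simp add: c_def)
    have cp: "c / \<bar>s n\<bar> powr p = c powr (- \<beta>)"
    proof -
      have "\<bar>s n\<bar> powr p = (\<bar>s n\<bar> powr 2) powr (1 + \<beta>)" by (simp only: powr_powr p_def)
      also have "\<bar>s n\<bar> powr 2 = c" using s(2)[of n] by (simp add: c_def)
      finally show ?thesis using c by (simp add: powr_add powr_minus divide_inverse)
    qed
    have "(CLINT x|lborel. f n x) = \<bar>- c\<bar> *\<^sub>R (CLINT u|lborel. f n (1 + (- c) * u))"
      by (rule lborel_integral_real_affine) (use c in auto)
    then have "(CLINT x|lborel. f n x) /\<^sub>R \<bar>s n\<bar> powr p = (c / \<bar>s n\<bar> powr p) *\<^sub>R (CLINT u|lborel. f n (1 - c * u))"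
      using c by (simp add: divide_inverse mult.commute)
    also have "\<dots> = (CLINT u|lborel. c powr (- \<beta>) *\<^sub>R f n (1 - c * u))" unfolding cp by simp
    also have "\<dots> = (CLINT u|lborel. h n u)"
    proof (rule Bochner_Integration.integral_cong)
      fix u :: real
      show "c powr (- \<beta>) *\<^sub>R f n (1 - c * u) = h n u"
      proof (cases "0 < u \<and> c * u < \<delta>")
        case True
        then have "q (1 - c * u) / (c * u) powr \<beta> * u powr \<beta> = c powr (- \<beta>) * q (1 - c * u)"
          using c by (simp add: powr_mult powr_minus divide_inverse)
        then show ?thesis using True c
          by (simp add: f_def h_def c_def[symmetric])
      next
        case False
        then have "q (1 - c * u) = 0 \<or> 1 - c * u \<notin> {1-\<delta><..}"
          using supp[of "1 - c * u"] c by (auto simp: not_less mult_nonneg_nonpos mult_le_0_iff)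
        then show ?thesis using False by (auto simp: f_def h_def c_def[symmetric])
      qed
    qed simp
    finally show ?thesis .
  qed
  have lim_h: "(\<lambda>n. CLINT u|lborel. h n u) \<longlonglongrightarrow>
      (CLINT u|lborel. of_real (\<psi>1 * (indicator {0<..} u * (u powr \<beta> * (1 - exp (- (lam / 2 / u)))))))"
  proof (rule integral_dominated_convergence)
    show "integrable lborel (\<lambda>u. (\<psi>1 + 1) * (indicator {0<..} u * (u powr \<beta> * min 2 ((lam / 2) / u))))"
      using \<beta> lam by (intro integrable_mult_right integrable_powr_min) auto
    show "AE u in lborel. norm (h n u) \<le> (\<psi>1 + 1) * (indicator {0<..} u * (u powr \<beta> * min 2 ((lam / 2) / u)))" for n
    proof (rule AE_I2)
      fix u :: real
      show "norm (h n u) \<le> (\<psi>1 + 1) * (indicator {0<..} u * (u powr \<beta> * min 2 ((lam / 2) / u)))"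
      proof (cases "0 < u \<and> (s n)\<^sup>2 * u < \<delta>")
        case True
        define c where "c = (s n)\<^sup>2"
        have c: "c > 0" using s(2) by (simp add: c_def)
        have cu: "0 < c * u" "c * u < \<delta>" using True c by (auto simp: c_def)
        have "q (1 - c * u) / (c * u) powr \<beta> < \<psi>1 + 1"
          using d0(2)[of "1 - c * u"] cu by (simp add: \<delta>_def)
        moreover have "cmod (G n (1 - c * u)) \<le> min 2 ((lam / 2) / u)"
          using G_bound[of "1 - c * u" n] cu c by (simp add: c_def[symmetric])
        ultimately have "(q (1 - c * u) / (c * u) powr \<beta>) * (u powr \<beta> * cmod (G n (1 - c * u))) \<le>
            (\<psi>1 + 1) * (u powr \<beta> * min 2 ((lam / 2) / u))"
          using q_nonneg[of "1 - c * u"] \<psi>1 by (intro mult_mono) auto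
        then show ?thesis using True q_nonneg[of "1 - c * u"]
          by (simp add: h_def c_def[symmetric])
      next
        case False
        then have "h n u = 0" unfolding h_def by (simp only: if_False scaleR_zero_left)
        then show ?thesis using \<psi>1 lam by (auto simp: indicator_def)
      qed
    qed
    show "AE u in lborel. (\<lambda>n. h n u) \<longlonglongrightarrow> of_real (\<psi>1 * (indicator {0<..} u * (u powr \<beta> * (1 - exp (- (lam / 2 / u))))))"
    proof (rule AE_I2)
      fix u :: real
      show "(\<lambda>n. h n u) \<longlonglongrightarrow> of_real (\<psi>1 * (indicator {0<..} u * (u powr \<beta> * (1 - exp (- (lam / 2 / u))))))"
      proof (cases "u > 0")
        case True
        have su: "(\<lambda>n. (s n)\<^sup>2 * u) \<longlonglongrightarrow> 0"
          using s(1) by (auto intro!: tendsto_eq_intros)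
        have "filterlim (\<lambda>n. 1 - (s n)\<^sup>2 * u) (at_left 1) sequentially"
          unfolding filterlim_at
        proof
          show "(\<lambda>n. 1 - (s n)\<^sup>2 * u) \<longlonglongrightarrow> 1"
            using tendsto_diff[OF tendsto_const su, of 1] by simp
          show "eventually (\<lambda>n. 1 - (s n)\<^sup>2 * u \<in> {..<1} \<and> 1 - (s n)\<^sup>2 * u \<noteq> 1) sequentially"
            using True s(2) by (auto intro!: always_eventually)
        qed
        from filterlim_compose[OF lim this]
        have 1: "(\<lambda>n. q (1 - (s n)\<^sup>2 * u) / ((s n)\<^sup>2 * u) powr \<beta>) \<longlonglongrightarrow> \<psi>1" by simp
        \<comment> \<open>The factor (s n)^2 in 1 - x turns into the divisor of
          \<open>iexp_rem (s n)\<close>, so that \<open>tendsto_iexp_rem\<close> yields the limiting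
          exponent - lam / (2 u).\<close>
        have G_eq: "G n (1 - (s n)\<^sup>2 * u) = 1 - exp (of_real (lam / u) * (iexp_rem (s n) /\<^sub>R (s n)\<^sup>2))" for n
          by (simp add: G_def scaleR_conv_of_real divide_inverse mult_ac)
        have "(\<lambda>n. 1 - exp (of_real (lam / u) * (iexp_rem (s n) /\<^sub>R (s n)\<^sup>2))) \<longlonglongrightarrow> 1 - exp (of_real (lam / u) * (- (1 / 2)))"
          by (intro tendsto_intros tendsto_iexp_rem s)
        also have "1 - exp (of_real (lam / u) * (- (1 / 2))) = (of_real (1 - exp (- (lam / 2 / u))) :: complex)"
          by (simp add: mult.commute flip: exp_of_real)
        finally have 2: "(\<lambda>n. G n (1 - (s n)\<^sup>2 * u)) \<longlonglongrightarrow> of_real (1 - exp (- (lam / 2 / u)))"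
          unfolding G_eq .
        have "eventually (\<lambda>n. (s n)\<^sup>2 * u < \<delta>) sequentially"
          using su \<delta> by (rule order_tendstoD)
        then have ev: "eventually (\<lambda>n. (q (1 - (s n)\<^sup>2 * u) / ((s n)\<^sup>2 * u) powr \<beta>) *\<^sub>R (u powr \<beta> *\<^sub>R G n (1 - (s n)\<^sup>2 * u)) = h n u) sequentially"
          by eventually_elim (simp add: h_def True)
        have "(\<lambda>n. (q (1 - (s n)\<^sup>2 * u) / ((s n)\<^sup>2 * u) powr \<beta>) *\<^sub>R (u powr \<beta> *\<^sub>R G n (1 - (s n)\<^sup>2 * u)))
            \<longlonglongrightarrow> \<psi>1 *\<^sub>R (u powr \<beta> *\<^sub>R of_real (1 - exp (- (lam / 2 / u))))"
          by (intro tendsto_intros 1 2)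
        then have "(\<lambda>n. h n u) \<longlonglongrightarrow> \<psi>1 *\<^sub>R (u powr \<beta> *\<^sub>R of_real (1 - exp (- (lam / 2 / u))))"
          by (rule Lim_transform_eventually) (rule ev)
        then show ?thesis using True by (simp add: scaleR_conv_of_real)
      qed (simp add: h_def)
    qed
  qed measurable
  have "(CLINT u|lborel. of_real (\<psi>1 * (indicator {0<..} u * (u powr \<beta> * (1 - exp (- (lam / 2 / u))))))) =
      (of_real (\<psi>1 * (lam / 2) powr (1 + \<beta>) * (Gamma (- \<beta>) / (1 + \<beta>))) :: complex)"
    using integral_powr_one_minus_exp[OF \<beta>, of "lam / 2"] lam
    by (simp only: integral_complex_of_real integral_mult_right_zero) simp
  note const = this
  have eq: "(CLINT x|lborel. q x *\<^sub>R (1 - exp (of_real (lam / (1 - x)) * iexp_rem (s n)))) /\<^sub>R \<bar>s n\<bar> powr (2 * (1 + \<beta>)) =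
      (CLINT u|lborel. h n u) + (CLINT x|lborel. f' n x) /\<^sub>R \<bar>s n\<bar> powr p" for n
    unfolding f_eq[symmetric] p_def[symmetric] split[unfolded G_def] by (rule scaleR_add_right)
  show ?thesis
    using tendsto_add[OF lim_h lim'] unfolding eq const by (simp only: add_0_right)
qed

section \<open>Conditioning on the mixing variable\<close>

lemma subalgebra_sigma_of:
  assumes "A \<in> borel_measurable M" shows "subalgebra M (sigma_of M A)"
  using assms by (auto simp: subalgebra_def sigma_of_def sets_vimage_algebra2 measurable_sets)

section \<open>Poisson masses and their moments\<close>

text \<open>Written as a formula instead of through \<open>poisson_pmf\<close>, so that it is
  defined for every real rate and visibly measurable in it; the rate will be random.\<close>

definition poi :: "real \<Rightarrow> nat \<Rightarrow> real" where
  "poi r k = r ^ k / fact k * exp (- r)"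

lemma poi_nonneg: "r \<ge> 0 \<Longrightarrow> poi r k \<ge> 0"
  by (simp add: poi_def)

lemma measurable_poi [measurable]: "(\<lambda>r. poi r k) \<in> borel_measurable borel"
  unfolding poi_def by measurable

lemma pmf_poisson_poi: "r > 0 \<Longrightarrow> pmf (poisson_pmf r) k = poi r k"
  by (simp add: poi_def)

lemma poi_sums: "poi r sums 1"
proof -
  have "(\<lambda>k. r ^ k /\<^sub>R fact k * exp (- r)) sums (exp r * exp (- r))"
    by (intro sums_mult2 exp_converges)
  then show ?thesis by (simp add: poi_def[abs_def] divide_inverse mult_ac flip: exp_add)
qed

text \<open>The size-bias identity of the Poisson law: one factor k is traded for a shift of the
  index. Both moments below follow by shifting the series.\<close>

lemma poi_Suc: "real (Suc k) * poi r (Suc k) = r * poi r k"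
proof -
  have "real (Suc k) * (r * r ^ k / (real (Suc k) * fact k)) = r * (r ^ k / fact k)"
    by (simp del: of_nat_Suc)
  then show ?thesis
    unfolding poi_def by (simp del: of_nat_Suc add: mult.assoc[symmetric])
qed

lemma poi_mean: "(\<lambda>k. real k * poi r k) sums r"
proof -
  have "(\<lambda>k. real (Suc k) * poi r (Suc k)) sums (r * 1)"
    unfolding poi_Suc by (intro sums_mult poi_sums)
  then show ?thesis using sums_Suc[of "\<lambda>k. real k * poi r k" "r * 1"] by simp
qed

lemma poi_second_moment: "(\<lambda>k. (real k)\<^sup>2 * poi r k) sums (r + r\<^sup>2)"
proof -
  have "(real (Suc k))\<^sup>2 * poi r (Suc k) = r * (real k * poi r k) + r * poi r k" for k
  proof -
    have "(real (Suc k))\<^sup>2 * poi r (Suc k) = real (Suc k) * (real (Suc k) * poi r (Suc k))"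
      by (simp add: power2_eq_square)
    then show ?thesis unfolding poi_Suc by (simp add: algebra_simps)
  qed
  moreover have "(\<lambda>k. r * (real k * poi r k) + r * poi r k) sums (r * r + r * 1)"
    by (intro sums_add sums_mult poi_mean poi_sums)
  ultimately show ?thesis
    using sums_Suc[of "\<lambda>k. (real k)\<^sup>2 * poi r k" "r * r + r * 1"] by (simp add: power2_eq_square add.commute)
qed

lemma poi_char_sums: "(\<lambda>k. poi r k *\<^sub>R iexp (t * real k)) sums exp (of_real r * (iexp t - 1))"
proof -
  have "(\<lambda>k. (of_real r * iexp t) ^ k /\<^sub>R fact k * exp (- of_real r)) sums
      (exp (of_real r * iexp t) * exp (- of_real r))"
    by (intro sums_mult2 exp_converges)
  also have "(\<lambda>k. (of_real r * iexp t) ^ k /\<^sub>R fact k * exp (- of_real r)) = (\<lambda>k. poi r k *\<^sub>R iexp (t * real k))"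
  proof
    fix k
    have "iexp (t * real k) = iexp t ^ k" by (simp add: mult_ac flip: exp_of_nat_mult)
    then show "(of_real r * iexp t) ^ k /\<^sub>R fact k * exp (- of_real r) = poi r k *\<^sub>R iexp (t * real k)"
      by (simp add: poi_def power_mult_distrib scaleR_conv_of_real divide_inverse mult_ac exp_of_real[symmetric])
  qed
  also have "exp (of_real r * iexp t) * exp (- of_real r) = exp (of_real r * (iexp t - 1))"
    by (simp add: algebra_simps flip: exp_add)
  finally show ?thesis .
qed

lemma suminf_poi_ennreal:
  assumes "r \<ge> 0" "c \<ge> 0"
  shows "(\<Sum>n. ennreal (real n) * ennreal (poi r n * c)) = ennreal (r * c)"
    and "(\<Sum>n. ennreal ((real n)\<^sup>2) * ennreal (poi r n * c)) = ennreal ((r + r\<^sup>2) * c)"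
proof -
  have "(\<lambda>n. real n * poi r n * c) sums (r * c)" by (intro sums_mult2 poi_mean)
  moreover have "(\<lambda>n. (real n)\<^sup>2 * poi r n * c) sums ((r + r\<^sup>2) * c)"
    by (intro sums_mult2 poi_second_moment)
  ultimately show "(\<Sum>n. ennreal (real n) * ennreal (poi r n * c)) = ennreal (r * c)"
    "(\<Sum>n. ennreal ((real n)\<^sup>2) * ennreal (poi r n * c)) = ennreal ((r + r\<^sup>2) * c)"
    using assms by (auto intro!: suminf_ennreal_eq simp: poi_nonneg mult.assoc simp flip: ennreal_mult)
qed

text \<open>Serves the second moment of a thinned count: a success indicator times itself has
  conditional mean \<alpha>, times a different one \<alpha>^2.\<close>

lemma sum_square_diag:
  "(\<Sum>i=1..n. \<Sum>j=1..n. if i = j then a else b) = real n * a + (real n * real n - real n) * (b::real)"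
proof -
  have "(\<Sum>j=1..n. if i = j then a else b) = real n * b + (a - b)" if "i \<in> {1..n}" for i
  proof -
    have "(\<Sum>j=1..n. if i = j then a else b) = (\<Sum>j=1..n. b + (if i = j then a - b else 0))"
      by (rule sum.cong) auto
    also have "\<dots> = real n * b + (a - b)" using that by (simp add: sum.distrib)
    finally show ?thesis .
  qed
  then have "(\<Sum>i=1..n. \<Sum>j=1..n. if i = j then a else b) = (\<Sum>i=1..n. real n * b + (a - b))"
    by (intro sum.cong) auto
  then show ?thesis by (simp add: algebra_simps)
qed

text \<open>The doubled cross term is a sum over a two-element set, so that the right side consists
  of finite sums only and \<open>cexp_add\<close> and \<open>cexp_sum\<close> apply to it. The
  semiring generality covers \<open>ennreal\<close>.\<close>

lemma square_sum_plus:
  fixes a :: "nat \<Rightarrow> 'c :: comm_semiring_1"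
  shows "((\<Sum>j=1..n. a j) + e)\<^sup>2 =
    (\<Sum>i=1..n. \<Sum>j=1..n. a i * a j) + (\<Sum>i\<in>{1,2::nat}. \<Sum>j=1..n. e * a j) + e\<^sup>2"
proof -
  have "(\<Sum>i=1..n. \<Sum>j=1..n. a i * a j) = (\<Sum>j=1..n. a j) * (\<Sum>j=1..n. a j)"
    by (simp add: sum_product)
  moreover have "(\<Sum>j=1..n. e * a j) = e * (\<Sum>j=1..n. a j)" by (simp add: sum_distrib_left)
  ultimately show ?thesis by (simp add: power2_eq_square mult_2 algebra_simps)
qed

lemma abs_le_one_plus_square: "\<bar>x\<bar> \<le> 1 + (x::real)\<^sup>2"
  using zero_le_power2[of "\<bar>x\<bar> - 1"] zero_le_power2[of x] unfolding power2_diff by simp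

context randomized_inar1
begin

abbreviation "Z \<equiv> inar_source X0 \<xi> \<epsilon>"

lemma \<alpha>_measurable [measurable]: "\<alpha> \<in> borel_measurable M"
  using distributed_measurable[OF \<alpha>_density] by simp

lemma Z_measurable: "i \<in> inar_indices \<Longrightarrow> Z i \<in> measurable M (count_space UNIV)"
  using cond_indep unfolding cond_indep_vars_def by blast

lemma sets_Z_event:
  assumes "finite J" "J \<subseteq> inar_indices"
  shows "{w \<in> space M. \<forall>i\<in>J. Z i w \<in> B i} \<in> sets M"
proof -
  have "{w \<in> space M. Z i w \<in> B i} \<in> sets M" if "i \<in> J" for i
    using measurable_sets[OF Z_measurable, of i "B i"] assms(2) that
    by (auto simp: vimage_def Int_def conj_commute)
  then show ?thesis by (rule sets.sets_Collect_finite_All[OF _ assms(1)])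
qed

sublocale \<alpha>_subalg: finite_measure_subalgebra M "sigma_of M \<alpha>"
  by unfold_locales (rule subalgebra_sigma_of, measurable)

lemma comp_\<alpha>_measurable_sigma_of:
  "g \<in> measurable borel N' \<Longrightarrow> (\<lambda>w. g (\<alpha> w)) \<in> measurable (sigma_of M \<alpha>) N'"
  unfolding sigma_of_def by (rule measurable_compose[OF measurable_vimage_algebra1]) auto

text \<open>\<open>real_cond_exp\<close> is a difference of converted \<open>ennreal\<close>
  expectations. For an indicator the negative part vanishes and the positive part is at most 1, so
  the conversion loses nothing.\<close>

lemma AE_cond_prob_eq_nn_cond_exp:
  assumes [measurable]: "E \<in> sets M"
  shows "AE w in M. ennreal (cond_prob_given M \<alpha> E w) = nn_cond_exp M (sigma_of M \<alpha>) (indicator E) w"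
proof -
  let ?F = "sigma_of M \<alpha>"
  have "AE w in M. nn_cond_exp M ?F (\<lambda>x. ennreal (- indicat_real E x)) w = ennreal (- 0)"
    using \<alpha>_subalg.nn_cond_exp_F_meas[of "\<lambda>_. 0"]
    by (auto simp: ennreal_neg elim: AE_mp)
  moreover have "AE w in M. nn_cond_exp M ?F (indicator E) w \<le> nn_cond_exp M ?F (\<lambda>_. 1) w"
    by (rule \<alpha>_subalg.nn_cond_exp_mono) (auto simp: indicator_def)
  moreover have "AE w in M. (1::ennreal) = nn_cond_exp M ?F (\<lambda>_. 1) w"
    by (rule \<alpha>_subalg.nn_cond_exp_F_meas) auto
  ultimately show ?thesis
  proof eventually_elim
    case (elim w)
    then have "nn_cond_exp M ?F (indicator E) w < \<top>"
      by (metis ennreal_one_less_top order_le_less_trans)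
    with elim show ?case
      by (simp add: cond_prob_given_def real_cond_exp_def ennreal_indicator)
  qed
qed

lemma nn_integral_cond_prob:
  assumes [measurable]: "E \<in> sets M" "g \<in> borel_measurable borel"
  shows "(\<integral>\<^sup>+w. g (\<alpha> w) * ennreal (cond_prob_given M \<alpha> E w) \<partial>M) = (\<integral>\<^sup>+w. g (\<alpha> w) * indicator E w \<partial>M)"
proof -
  have "(\<integral>\<^sup>+w. g (\<alpha> w) * ennreal (cond_prob_given M \<alpha> E w) \<partial>M) =
        (\<integral>\<^sup>+w. g (\<alpha> w) * nn_cond_exp M (sigma_of M \<alpha>) (indicator E) w \<partial>M)"
    using AE_cond_prob_eq_nn_cond_exp[OF assms(1)] by (intro nn_integral_cong_AE) (auto elim: AE_mp)
  also have "\<dots> = (\<integral>\<^sup>+w. g (\<alpha> w) * indicator E w \<partial>M)"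
    by (rule \<alpha>_subalg.nn_cond_exp_intg) (auto intro: comp_\<alpha>_measurable_sigma_of)
  finally show ?thesis .
qed

lemma AE_cond_prob_prod:
  assumes "finite J" "J \<subseteq> inar_indices"
  shows "AE w in M. cond_prob_given M \<alpha> {w' \<in> space M. \<forall>i\<in>J. Z i w' \<in> B i} w
                  = (\<Prod>i\<in>J. cond_prob_given M \<alpha> {w' \<in> space M. Z i w' \<in> B i} w)"
  using cond_indep assms unfolding cond_indep_vars_def by auto

section \<open>Histories and conditional expectations with respect to them\<close>

text \<open>Cylinder events form a pi-system and are what conditional independence speaks about;
  \<alpha> is included so that every history contains the conditioning variable.\<close>

definition past_events :: "inar_index set \<Rightarrow> 'a set set" where
  "past_events H = {{w \<in> space M. \<alpha> w \<in> C \<and> (\<forall>i\<in>J. Z i w \<in> B i)} | C J B.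
     C \<in> sets borel \<and> finite J \<and> J \<subseteq> H}"

text \<open>For \<open>H = {}\<close> this is the sigma-algebra of \<alpha> alone, so
  \<open>past {}\<close> expresses conditioning on the mixing variable.\<close>

definition past :: "inar_index set \<Rightarrow> 'a measure" where
  "past H = sigma (space M) (past_events H)"

lemma past_events_subset: "H \<subseteq> inar_indices \<Longrightarrow> past_events H \<subseteq> sets M"
proof
  fix E assume H: "H \<subseteq> inar_indices" and "E \<in> past_events H"
  then obtain C J B where E: "E = {w \<in> space M. \<alpha> w \<in> C \<and> (\<forall>i\<in>J. Z i w \<in> B i)}"
    and C[measurable]: "C \<in> sets borel" and J: "finite J" "J \<subseteq> H" unfolding past_events_def by blast
  have [measurable]: "{w \<in> space M. \<forall>i\<in>J. Z i w \<in> B i} \<in> sets M"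
    using sets_Z_event[OF J(1)] J(2) H by blast
  have "{w \<in> space M. \<alpha> w \<in> C} \<inter> {w \<in> space M. \<forall>i\<in>J. Z i w \<in> B i} \<in> sets M" by measurable
  also have "{w \<in> space M. \<alpha> w \<in> C} \<inter> {w \<in> space M. \<forall>i\<in>J. Z i w \<in> B i} = E" unfolding E by auto
  finally show "E \<in> sets M" .
qed

lemma past_events_Pow: "past_events H \<subseteq> Pow (space M)"
  by (auto simp: past_events_def)

lemma space_past [simp]: "space (past H) = space M"
  by (simp add: past_def space_measure_of_conv)

lemma sets_past: "sets (past H) = sigma_sets (space M) (past_events H)"
  by (simp add: past_def past_events_Pow)

lemma subalgebra_past: "H \<subseteq> inar_indices \<Longrightarrow> subalgebra M (past H)"
  using past_events_subset[of H] by (simp add: subalgebra_def sets_past sets.sigma_sets_subset)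

lemma measurable_past_mono:
  assumes "H \<subseteq> H'" shows "f \<in> measurable (past H) N' \<Longrightarrow> f \<in> measurable (past H') N'"
proof -
  have "past_events H \<subseteq> past_events H'" using assms unfolding past_events_def by blast
  then have "sets (past H) \<subseteq> sets (past H')" by (simp add: sets_past sigma_sets_mono')
  then show "f \<in> measurable (past H) N' \<Longrightarrow> f \<in> measurable (past H') N'"
    by (auto simp: measurable_def)
qed

lemma past_eventI:
  assumes "C \<in> sets borel" "finite J" "J \<subseteq> H"
  shows "{w \<in> space M. \<alpha> w \<in> C \<and> (\<forall>i\<in>J. Z i w \<in> B i)} \<in> past_events H"
  using assms unfolding past_events_def by blast

lemma \<alpha>_measurable_past [measurable]: "\<alpha> \<in> borel_measurable (past H)"
proof (rule measurableI)
  fix C :: "real set" assume "C \<in> sets borel"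
  then have "{w \<in> space M. \<alpha> w \<in> C \<and> (\<forall>i\<in>{}. Z i w \<in> UNIV)} \<in> past_events H"
    by (intro past_eventI) auto
  also have "{w \<in> space M. \<alpha> w \<in> C \<and> (\<forall>i\<in>{}. Z i w \<in> UNIV)} = \<alpha> -` C \<inter> space (past H)" by auto
  finally show "\<alpha> -` C \<inter> space (past H) \<in> sets (past H)" by (auto simp: sets_past)
qed auto

lemma Z_measurable_past: "i \<in> H \<Longrightarrow> Z i \<in> measurable (past H) (count_space UNIV)"
proof (rule measurableI)
  fix B :: "nat set" assume "i \<in> H"
  then have "{w \<in> space M. \<alpha> w \<in> UNIV \<and> (\<forall>i\<in>{i}. Z i w \<in> B)} \<in> past_events H"
    by (intro past_eventI) auto
  also have "{w \<in> space M. \<alpha> w \<in> UNIV \<and> (\<forall>i\<in>{i}. Z i w \<in> B)} = Z i -` B \<inter> space (past H)" by auto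
  finally show "Z i -` B \<inter> space (past H) \<in> sets (past H)" by (auto simp: sets_past)
qed auto

lemma Int_stable_past_events: "Int_stable (past_events H)"
proof (rule Int_stableI)
  fix E E' assume "E \<in> past_events H" "E' \<in> past_events H"
  then obtain C J B C' J' B' where
    E: "E = {w \<in> space M. \<alpha> w \<in> C \<and> (\<forall>i\<in>J. Z i w \<in> B i)}" "C \<in> sets borel" "finite J" "J \<subseteq> H" and
    E': "E' = {w \<in> space M. \<alpha> w \<in> C' \<and> (\<forall>i\<in>J'. Z i w \<in> B' i)}" "C' \<in> sets borel" "finite J'" "J' \<subseteq> H"
    unfolding past_events_def by blast
  have "E \<inter> E' = {w \<in> space M. \<alpha> w \<in> C \<inter> C' \<and> (\<forall>i\<in>J \<union> J'. Z i w \<in>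
      (if i \<in> J then B i else UNIV) \<inter> (if i \<in> J' then B' i else UNIV))}"
    unfolding E(1) E'(1) by (auto; metis)
  also have "\<dots> \<in> past_events H" by (rule past_eventI) (use E E' in auto)
  finally show "E \<inter> E' \<in> past_events H" .
qed

text \<open>Given \<alpha>, the cylinder over the disjoint union of \<open>J\<close> and
  \<open>J'\<close> factorises. The factor of \<open>J'\<close> is a function of \<alpha>, hence can
  join the weight, after which the conditional probability of the past cylinder is integrated back
  to its indicator.\<close>

lemma emeasure_past_event_Int:
  assumes H: "H \<subseteq> inar_indices" and E: "E \<in> past_events H"
    and J': "finite J'" "J' \<subseteq> inar_indices - H"
    and h [measurable]: "h \<in> borel_measurable borel" and h_nonneg: "\<And>x. x \<in> {0<..<1} \<Longrightarrow> h x \<ge> 0"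
    and cond: "AE w in M. (\<Prod>i\<in>J'. cond_prob_given M \<alpha> {w' \<in> space M. Z i w' \<in> B' i} w) = h (\<alpha> w)"
  shows "emeasure M (E \<inter> {w \<in> space M. \<forall>i\<in>J'. Z i w \<in> B' i}) = (\<integral>\<^sup>+w. ennreal (h (\<alpha> w)) * indicator E w \<partial>M)"
proof -
  obtain C J B where
    E: "E = {w \<in> space M. \<alpha> w \<in> C \<and> (\<forall>i\<in>J. Z i w \<in> B i)}" and C[measurable]: "C \<in> sets borel"
    and J: "finite J" "J \<subseteq> H"
    using E unfolding past_events_def by blast
  define K where "K = {w \<in> space M. \<forall>i\<in>J. Z i w \<in> B i}"
  define B'' where "B'' i = (if i \<in> J then B i else B' i)" for i
  define G where "G = {w \<in> space M. \<forall>i\<in>J \<union> J'. Z i w \<in> B'' i}"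
  have disj: "J \<inter> J' = {}" using J J' by auto
  have [measurable]: "K \<in> sets M" unfolding K_def using J H by (intro sets_Z_event) auto
  have [measurable]: "G \<in> sets M" unfolding G_def using J J' H by (intro sets_Z_event) auto
  have B'': "\<And>i. i \<in> J' \<Longrightarrow> B'' i = B' i" "\<And>i. i \<in> J \<Longrightarrow> B'' i = B i"
    using disj by (auto simp: B''_def)
  have EG: "E \<inter> {w \<in> space M. \<forall>i\<in>J'. Z i w \<in> B' i} = {w \<in> space M. \<alpha> w \<in> C} \<inter> G"
    unfolding E G_def using B'' by (auto simp: ball_Un)
  have condG: "AE w in M. cond_prob_given M \<alpha> G w = cond_prob_given M \<alpha> K w * h (\<alpha> w)"
  proof -
    have "AE w in M. cond_prob_given M \<alpha> G w =
        (\<Prod>i\<in>J\<union>J'. cond_prob_given M \<alpha> {w' \<in> space M. Z i w' \<in> B'' i} w)"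
      unfolding G_def using J J' H by (intro AE_cond_prob_prod) auto
    moreover have "AE w in M. cond_prob_given M \<alpha> K w =
        (\<Prod>i\<in>J. cond_prob_given M \<alpha> {w' \<in> space M. Z i w' \<in> B i} w)"
      unfolding K_def using J H by (intro AE_cond_prob_prod) auto
    ultimately show ?thesis using cond
    proof eventually_elim
      case (elim w)
      have "(\<Prod>i\<in>J\<union>J'. cond_prob_given M \<alpha> {w' \<in> space M. Z i w' \<in> B'' i} w) =
          (\<Prod>i\<in>J. cond_prob_given M \<alpha> {w' \<in> space M. Z i w' \<in> B i} w) *
          (\<Prod>i\<in>J'. cond_prob_given M \<alpha> {w' \<in> space M. Z i w' \<in> B' i} w)"
        using J J' disj by (simp add: prod.union_disjoint B'')
      with elim show ?case by simp
    qed
  qed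
  have "emeasure M ({w \<in> space M. \<alpha> w \<in> C} \<inter> G) = (\<integral>\<^sup>+w. indicator C (\<alpha> w) * indicator G w \<partial>M)"
  proof -
    have "emeasure M ({w \<in> space M. \<alpha> w \<in> C} \<inter> G) =
        (\<integral>\<^sup>+w. indicator ({w \<in> space M. \<alpha> w \<in> C} \<inter> G) w \<partial>M)"
      by (rule nn_integral_indicator[symmetric]) measurable
    also have "\<dots> = (\<integral>\<^sup>+w. indicator C (\<alpha> w) * indicator G w \<partial>M)"
      by (intro nn_integral_cong) (auto simp: indicator_def)
    finally show ?thesis .
  qed
  also have "\<dots> = (\<integral>\<^sup>+w. indicator C (\<alpha> w) * ennreal (cond_prob_given M \<alpha> G w) \<partial>M)"
    by (rule nn_integral_cond_prob[symmetric]) auto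
  also have "\<dots> = (\<integral>\<^sup>+w. (indicator C (\<alpha> w) * ennreal (h (\<alpha> w))) * ennreal (cond_prob_given M \<alpha> K w) \<partial>M)"
  proof (intro nn_integral_cong_AE)
    show "AE w in M. indicator C (\<alpha> w) * ennreal (cond_prob_given M \<alpha> G w) =
        indicator C (\<alpha> w) * ennreal (h (\<alpha> w)) * ennreal (cond_prob_given M \<alpha> K w)"
      using condG AE_space
    proof eventually_elim
      case (elim w)
      then show ?case using h_nonneg[OF \<alpha>_range[of w]]
        by (simp add: ennreal_mult' mult_ac)
    qed
  qed
  also have "\<dots> = (\<integral>\<^sup>+w. (indicator C (\<alpha> w) * ennreal (h (\<alpha> w))) * indicator K w \<partial>M)"
    by (rule nn_integral_cond_prob) auto
  also have "\<dots> = (\<integral>\<^sup>+w. ennreal (h (\<alpha> w)) * indicator E w \<partial>M)"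
    by (intro nn_integral_cong) (auto simp: E K_def indicator_def)
  finally show ?thesis unfolding EG .
qed

text \<open>The measures with densities \<open>indicator F\<close> and \<open>h (\<alpha> w)\<close>
  agree on the generating pi-system, hence on the whole history, and \<open>U\<close> integrates
  equally against both.\<close>

lemma nn_integral_past_factor:
  assumes H: "H \<subseteq> inar_indices"
    and J': "finite J'" "J' \<subseteq> inar_indices - H"
    and h [measurable]: "h \<in> borel_measurable borel" and h_nonneg: "\<And>x. x \<in> {0<..<1} \<Longrightarrow> h x \<ge> 0"
    and cond: "AE w in M. (\<Prod>i\<in>J'. cond_prob_given M \<alpha> {w' \<in> space M. Z i w' \<in> B' i} w) = h (\<alpha> w)"
    and U: "U \<in> borel_measurable (past H)"
  shows "(\<integral>\<^sup>+w. U w * indicator {w \<in> space M. \<forall>i\<in>J'. Z i w \<in> B' i} w \<partial>M) = (\<integral>\<^sup>+w. U w * ennreal (h (\<alpha> w)) \<partial>M)"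
proof -
  define F where "F = {w \<in> space M. \<forall>i\<in>J'. Z i w \<in> B' i}"
  have [measurable]: "F \<in> sets M" unfolding F_def using J' by (intro sets_Z_event) auto
  have UM [measurable]: "U \<in> borel_measurable M"
    by (rule measurable_from_subalg[OF subalgebra_past[OF H] U])
  let ?D1 = "density M (indicator F)" and ?D2 = "density M (\<lambda>w. ennreal (h (\<alpha> w)))"
  have sub: "subalgebra ?D1 (past H)" "subalgebra ?D2 (past H)"
    using subalgebra_past[OF H] by (auto simp: subalgebra_def)
  have gen: "E \<in> past_events H \<Longrightarrow> emeasure ?D1 E = emeasure ?D2 E" for E
    using past_events_subset[OF H] emeasure_past_event_Int[OF H _ J' h h_nonneg cond, of E]
    by (subst (1 2) emeasure_density)
       (auto simp: F_def[symmetric] nn_integral_indicator[symmetric] indicator_inter_arith mult.commute)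
  have in_past: "E \<in> past_events H \<Longrightarrow> E \<in> sets (past H)" for E by (auto simp: sets_past)
  have space_ev: "space M \<in> past_events H"
    using past_eventI[of UNIV "{}" H "\<lambda>_. UNIV"] by simp
  have eq: "restr_to_subalg ?D1 (past H) = restr_to_subalg ?D2 (past H)"
  proof (rule measure_eqI_generator_eq[where E = "past_events H" and \<Omega> = "space M" and A = "\<lambda>_. space M"])
    show "Int_stable (past_events H)" by (rule Int_stable_past_events)
    show "past_events H \<subseteq> Pow (space M)" by (rule past_events_Pow)
    show "emeasure (restr_to_subalg ?D1 (past H)) E = emeasure (restr_to_subalg ?D2 (past H)) E"
      if "E \<in> past_events H" for E
      using gen[OF that] by (simp add: emeasure_restr_to_subalg[OF _ in_past[OF that]] sub)
    show "emeasure (restr_to_subalg ?D1 (past H)) (space M) \<noteq> \<infinity>" for i :: nat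
      by (simp add: emeasure_restr_to_subalg[OF sub(1) in_past[OF space_ev]] emeasure_density
            nn_integral_indicator' flip: indicator_inter_arith)
  qed (auto simp: sets_restr_to_subalg sub sets_past space_ev)
  have "(\<integral>\<^sup>+w. U w * indicator F w \<partial>M) = (\<integral>\<^sup>+w. U w \<partial>?D1)"
    by (subst nn_integral_density) (auto simp: mult.commute)
  also have "\<dots> = (\<integral>\<^sup>+w. U w \<partial>restr_to_subalg ?D1 (past H))"
    by (rule nn_integral_subalgebra2[OF sub(1) U, symmetric])
  also have "\<dots> = (\<integral>\<^sup>+w. U w \<partial>?D2)"
    unfolding eq by (rule nn_integral_subalgebra2[OF sub(2) U])
  also have "\<dots> = (\<integral>\<^sup>+w. U w * ennreal (h (\<alpha> w)) \<partial>M)"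
    by (subst nn_integral_density) (auto simp: mult.commute)
  finally show ?thesis unfolding F_def .
qed

text \<open>
  \<open>h\<close> is a version of the conditional expectation of \<open>f\<close> given \<open>past H\<close>.  Everything is \<open>ennreal\<close>-valued
  because \<open>X\<^sub>k\<close> is not integrable.
\<close>

definition cexp :: "inar_index set \<Rightarrow> ('a \<Rightarrow> ennreal) \<Rightarrow> ('a \<Rightarrow> ennreal) \<Rightarrow> bool" where
  "cexp H f h \<longleftrightarrow> f \<in> borel_measurable M \<and> h \<in> borel_measurable M \<and>
     (\<forall>U\<in>borel_measurable (past H). (\<integral>\<^sup>+w. U w * f w \<partial>M) = (\<integral>\<^sup>+w. U w * h w \<partial>M))"

lemma cexpD:
  assumes "cexp H f h"
  shows "f \<in> borel_measurable M" "h \<in> borel_measurable M"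
    "U \<in> borel_measurable (past H) \<Longrightarrow> (\<integral>\<^sup>+w. U w * f w \<partial>M) = (\<integral>\<^sup>+w. U w * h w \<partial>M)"
  using assms by (auto simp: cexp_def)

lemma borel_measurable_past_M:
  "H \<subseteq> inar_indices \<Longrightarrow> f \<in> measurable (past H) N' \<Longrightarrow> f \<in> measurable M N'"
  by (rule measurable_from_subalg[OF subalgebra_past])

lemma cexp_add:
  assumes "cexp H f h" "cexp H f' h'" "H \<subseteq> inar_indices"
  shows "cexp H (\<lambda>w. f w + f' w) (\<lambda>w. h w + h' w)"
  unfolding cexp_def
proof (intro conjI ballI)
  fix U :: "'a \<Rightarrow> ennreal" assume U: "U \<in> borel_measurable (past H)"
  note [measurable] = borel_measurable_past_M[OF assms(3) U] cexpD(1,2)[OF assms(1)] cexpD(1,2)[OF assms(2)]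
  show "(\<integral>\<^sup>+w. U w * (f w + f' w) \<partial>M) = (\<integral>\<^sup>+w. U w * (h w + h' w) \<partial>M)"
    using cexpD(3)[OF assms(1) U] cexpD(3)[OF assms(2) U]
    by (simp add: distrib_left nn_integral_add)
qed (use cexpD(1,2)[OF assms(1)] cexpD(1,2)[OF assms(2)] in measurable)

lemma cexp_self: "H \<subseteq> inar_indices \<Longrightarrow> b \<in> borel_measurable (past H) \<Longrightarrow> cexp H b b"
  by (auto simp: cexp_def intro: borel_measurable_past_M)

lemma cexp_mult:
  assumes "cexp H f h" "b \<in> borel_measurable (past H)" "H \<subseteq> inar_indices"
  shows "cexp H (\<lambda>w. b w * f w) (\<lambda>w. b w * h w)"
  unfolding cexp_def
proof (intro conjI ballI)
  fix U :: "'a \<Rightarrow> ennreal" assume U: "U \<in> borel_measurable (past H)"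
  have "(\<lambda>w. U w * b w) \<in> borel_measurable (past H)" using U assms(2) by measurable
  from cexpD(3)[OF assms(1) this]
  show "(\<integral>\<^sup>+w. U w * (b w * f w) \<partial>M) = (\<integral>\<^sup>+w. U w * (b w * h w) \<partial>M)"
    by (simp add: mult.assoc)
qed (use cexpD(1,2)[OF assms(1)] borel_measurable_past_M[OF assms(3,2)] in measurable)

lemma cexp_sum:
  assumes "finite I" "\<And>i. i \<in> I \<Longrightarrow> cexp H (f i) (h i)" "H \<subseteq> inar_indices"
  shows "cexp H (\<lambda>w. \<Sum>i\<in>I. f i w) (\<lambda>w. \<Sum>i\<in>I. h i w)"
  using assms(1,2)
proof (induction I rule: finite_induct)
  case empty
  then show ?case by (simp add: cexp_def)
next
  case (insert i I)
  then show ?case using cexp_add[OF _ _ assms(3), of "f i" "h i"] by simp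
qed

lemma cexp_suminf:
  assumes "\<And>i. cexp H (f i) (h i)" "H \<subseteq> inar_indices"
  shows "cexp H (\<lambda>w. \<Sum>i. f i w) (\<lambda>w. \<Sum>i. h i w)"
  unfolding cexp_def
proof (intro conjI ballI)
  fix U :: "'a \<Rightarrow> ennreal" assume U: "U \<in> borel_measurable (past H)"
  note [measurable] = borel_measurable_past_M[OF assms(2) U] cexpD(1,2)[OF assms(1)]
  show "(\<integral>\<^sup>+w. U w * (\<Sum>i. f i w) \<partial>M) = (\<integral>\<^sup>+w. U w * (\<Sum>i. h i w) \<partial>M)"
    using cexpD(3)[OF assms(1) U] by (simp add: nn_integral_suminf flip: ennreal_suminf_cmult)
qed (use cexpD(1,2)[OF assms(1)] in measurable)

lemma cexp_cong:
  assumes "cexp H f h" "AE w in M. f' w = f w" "\<And>w. w \<in> space M \<Longrightarrow> h' w = h w"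
    "f' \<in> borel_measurable M"
  shows "cexp H f' h'"
  unfolding cexp_def
proof (intro conjI ballI)
  fix U :: "'a \<Rightarrow> ennreal" assume U: "U \<in> borel_measurable (past H)"
  have "(\<integral>\<^sup>+w. U w * f' w \<partial>M) = (\<integral>\<^sup>+w. U w * f w \<partial>M)"
    using assms(2) by (intro nn_integral_cong_AE) auto
  also have "\<dots> = (\<integral>\<^sup>+w. U w * h w \<partial>M)" by (rule cexpD(3)[OF assms(1) U])
  also have "\<dots> = (\<integral>\<^sup>+w. U w * h' w \<partial>M)" using assms(3) by (intro nn_integral_cong) auto
  finally show "(\<integral>\<^sup>+w. U w * f' w \<partial>M) = (\<integral>\<^sup>+w. U w * h' w \<partial>M)" .
next
  show "h' \<in> borel_measurable M"
    using cexpD(2)[OF assms(1)] measurable_cong[of M h' h] assms(3) by simp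
qed (rule assms(4))

lemma cexp_tower:
  assumes "cexp H' f h" "cexp H h h'" "H \<subseteq> H'"
  shows "cexp H f h'"
  unfolding cexp_def
proof (intro conjI ballI)
  fix U :: "'a \<Rightarrow> ennreal" assume U: "U \<in> borel_measurable (past H)"
  show "(\<integral>\<^sup>+w. U w * f w \<partial>M) = (\<integral>\<^sup>+w. U w * h' w \<partial>M)"
    using cexpD(3)[OF assms(1) measurable_past_mono[OF assms(3) U]] cexpD(3)[OF assms(2) U] by simp
qed (use cexpD[OF assms(1)] cexpD[OF assms(2)] in auto)

text \<open>The index takes countably many values and is known from the past, so the statement
  splits over its values. It handles the random number of summands in the thinning.\<close>

lemma cexp_random_index:
  fixes Y :: "'a \<Rightarrow> nat"
  assumes "\<And>n. cexp H (f n) (h n)" "Y \<in> measurable (past H) (count_space UNIV)" "H \<subseteq> inar_indices"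
  shows "cexp H (\<lambda>w. f (Y w) w) (\<lambda>w. h (Y w) w)"
proof -
  have YM: "Y \<in> measurable M (count_space UNIV)" by (rule borel_measurable_past_M[OF assms(3,2)])
  have *: "cexp H (\<lambda>w. \<Sum>n. indicator {n} (Y w) * f n w) (\<lambda>w. \<Sum>n. indicator {n} (Y w) * h n w)"
  proof (intro cexp_suminf cexp_mult assms(1,3))
    fix n
    show "(\<lambda>w. indicator {n} (Y w) :: ennreal) \<in> borel_measurable (past H)"
      by (rule measurable_compose[OF assms(2)]) simp
  qed
  have eq: "(\<Sum>n. indicator {n} y * g n) = g y" for y :: nat and g :: "nat \<Rightarrow> ennreal"
    using suminf_cmult_indicator[of "\<lambda>n. {n}" y y g] by (simp add: disjoint_family_on_def mult.commute)
  show ?thesis using * by (simp add: eq)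
qed

text \<open>
  The conditional probability of \<open>Z i = m\<close> at \<open>\<alpha> = x\<close>; for \<open>Thin\<close> it is only meant for \<open>m = 1\<close>.
\<close>

fun mass1 :: "inar_index \<Rightarrow> nat \<Rightarrow> real \<Rightarrow> real" where
  "mass1 Init m x = poi (lam / (1 - x)) m"
| "mass1 (Thin k j) m x = x"
| "mass1 (Innov k) m x = poi lam m"

lemma measurable_mass1 [measurable]: "mass1 i m \<in> borel_measurable borel"
proof -
  have "mass1 Init m = (\<lambda>x. poi (lam / (1 - x)) m)" "mass1 (Thin k j) m = (\<lambda>x. x)"
    "mass1 (Innov k) m = (\<lambda>x. poi lam m)" for k j by auto
  then show ?thesis by (cases i) (simp_all only:, measurable)
qed

lemma mass1_nonneg: "x \<in> {0<..<1} \<Longrightarrow> mass1 i m x \<ge> 0"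
  using lam_pos by (cases i) (auto intro!: poi_nonneg)

lemma AE_cond_prob_mass1:
  assumes "i \<in> inar_indices" "\<And>k j. i = Thin k j \<Longrightarrow> m = 1"
  shows "AE w in M. cond_prob_given M \<alpha> {w' \<in> space M. Z i w' \<in> {m}} w = mass1 i m (\<alpha> w)"
proof (cases i)
  case Init
  show ?thesis using X0_poisson[of m] AE_space
  proof eventually_elim
    case (elim w)
    then show ?case using \<alpha>_range[of w] lam_pos by (simp add: Init poi_def)
  qed
next
  case (Thin k j)
  then show ?thesis using \<xi>_one[of k j] assms by (simp add: inar_indices_def)
next
  case (Innov k)
  then show ?thesis using \<epsilon>_poisson[of k m] assms lam_pos
    by (simp add: inar_indices_def poi_def)
qed

lemma cexp_event:
  assumes H: "H \<subseteq> inar_indices" and J: "finite J" "J \<subseteq> inar_indices - H"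
    and v: "\<And>k j. Thin k j \<in> J \<Longrightarrow> v (Thin k j) = 1"
  shows "cexp H (indicator {w \<in> space M. \<forall>i\<in>J. Z i w = v i}) (\<lambda>w. ennreal (\<Prod>i\<in>J. mass1 i (v i) (\<alpha> w)))"
  unfolding cexp_def
proof (intro conjI ballI)
  have "{w \<in> space M. \<forall>i\<in>J. Z i w = v i} = {w \<in> space M. \<forall>i\<in>J. Z i w \<in> {v i}}" by simp
  also have "\<dots> \<in> sets M" using J by (intro sets_Z_event) auto
  finally show "indicator {w \<in> space M. \<forall>i\<in>J. Z i w = v i} \<in> borel_measurable M" by simp
  show "(\<lambda>w. ennreal (\<Prod>i\<in>J. mass1 i (v i) (\<alpha> w))) \<in> borel_measurable M" by measurable
  fix U :: "'a \<Rightarrow> ennreal" assume U: "U \<in> borel_measurable (past H)"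
  have "AE w in M. \<forall>i\<in>J. cond_prob_given M \<alpha> {w' \<in> space M. Z i w' \<in> {v i}} w = mass1 i (v i) (\<alpha> w)"
    using J v by (intro AE_finite_allI AE_cond_prob_mass1) auto
  then have "AE w in M. (\<Prod>i\<in>J. cond_prob_given M \<alpha> {w' \<in> space M. Z i w' \<in> {v i}} w) =
      (\<Prod>i\<in>J. mass1 i (v i) (\<alpha> w))"
    by (rule AE_mp) (auto intro!: AE_I2 prod.cong)
  from nn_integral_past_factor[OF H J _ _ this U]
  show "(\<integral>\<^sup>+w. U w * indicator {w \<in> space M. \<forall>i\<in>J. Z i w = v i} w \<partial>M) =
    (\<integral>\<^sup>+w. U w * ennreal (\<Prod>i\<in>J. mass1 i (v i) (\<alpha> w)) \<partial>M)"
    by (simp add: prod_nonneg mass1_nonneg)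
qed

abbreviation "X \<equiv> inar1 X0 \<xi> \<epsilon>"

section \<open>One step of the recursion given the history\<close>

fun ind_time :: "inar_index \<Rightarrow> nat" where
  "ind_time Init = 0" | "ind_time (Thin k j) = k" | "ind_time (Innov k) = k"

text \<open>The corresponding \<open>past\<close> is the history up to time \<open>k\<close>,
  recording all source variables and not only the path; those of time \<open>Suc k\<close> then have
  indices outside it.\<close>

definition indices_upto :: "nat \<Rightarrow> inar_index set" where
  "indices_upto k = {i \<in> inar_indices. ind_time i \<le> k}"

lemma indices_upto_subset: "indices_upto k \<subseteq> inar_indices" by (auto simp: indices_upto_def)

lemma indices_upto_mono: "k \<le> l \<Longrightarrow> indices_upto k \<subseteq> indices_upto l" by (auto simp: indices_upto_def)

lemma measurable_X_past: "X k \<in> measurable (past (indices_upto k)) (count_space UNIV)"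
proof (induction k)
  case 0
  have "Z Init \<in> measurable (past (indices_upto 0)) (count_space UNIV)"
    by (rule Z_measurable_past) (auto simp: indices_upto_def inar_indices_def)
  then show ?case by simp
next
  case (Suc k)
  have X: "X k \<in> measurable (past (indices_upto (Suc k))) (count_space UNIV)"
    by (rule measurable_past_mono[OF indices_upto_mono Suc]) simp
  have \<epsilon>: "\<epsilon> (Suc k) \<in> measurable (past (indices_upto (Suc k))) (count_space UNIV)"
    using Z_measurable_past[of "Innov (Suc k)" "indices_upto (Suc k)"] by (auto simp: indices_upto_def inar_indices_def)
  have \<xi>: "\<xi> (Suc k) j \<in> measurable (past (indices_upto (Suc k))) (count_space UNIV)" if "j \<ge> 1" for j
    using Z_measurable_past[of "Thin (Suc k) j" "indices_upto (Suc k)"] that by (auto simp: indices_upto_def inar_indices_def)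
  have bc: "measurable (past H) (borel :: nat measure) = measurable (past H) (count_space UNIV)" for H
    by (rule measurable_cong_sets) (auto simp: sets_borel_eq_count_space)
  \<comment> \<open>First for a deterministic number n of summands; the random number
    \<open>X k\<close> is then inserted as a countable parameter.\<close>
  have "(\<lambda>w. (\<Sum>j=1..n. \<xi> (Suc k) j w) + \<epsilon> (Suc k) w) \<in> borel_measurable (past (indices_upto (Suc k)))" for n
    using \<epsilon> \<xi> by (intro borel_measurable_add borel_measurable_sum) (auto simp: bc)
  from measurable_compose_countable[OF this X]
  show ?case by (simp add: bc)
qed

lemma measurable_X [measurable]: "X k \<in> measurable M (count_space UNIV)"
  by (rule borel_measurable_past_M[OF indices_upto_subset measurable_X_past])

lemma measurable_X0 [measurable]: "X0 \<in> measurable M (count_space UNIV)"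
  using Z_measurable[of Init] by (simp add: inar_indices_def)

lemma measurable_\<epsilon> [measurable]: "\<epsilon> (Suc k) \<in> measurable M (count_space UNIV)"
  using Z_measurable[of "Innov (Suc k)"] by (simp add: inar_indices_def)

lemma measurable_X_past_ennreal [measurable]:
  "(\<lambda>w. f (X k w) :: ennreal) \<in> borel_measurable (past (indices_upto k))"
  by (rule measurable_compose[OF measurable_X_past]) simp

lemma measurable_\<xi>: "j \<ge> 1 \<Longrightarrow> \<xi> (Suc k) j \<in> measurable M (count_space UNIV)"
  using Z_measurable[of "Thin (Suc k) j"] by (simp add: inar_indices_def)

text \<open>Indicators of these events replace the thinning variables, which are 0-1 valued only
  almost surely.\<close>

definition succ_event :: "nat \<Rightarrow> nat \<Rightarrow> 'a set" where
  "succ_event k j = {w \<in> space M. \<xi> (Suc k) j w = 1}"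

lemma sets_succ_event [measurable]: "j \<ge> 1 \<Longrightarrow> succ_event k j \<in> sets M"
  using measurable_sets[OF measurable_\<xi>, of j "{1}" k]
  by (auto simp: succ_event_def vimage_def Int_def conj_commute)

lemma cexp_succ: "j \<ge> 1 \<Longrightarrow> cexp (indices_upto k) (indicator (succ_event k j)) (\<lambda>w. ennreal (\<alpha> w))"
  using cexp_event[OF indices_upto_subset, of "{Thin (Suc k) j}" k "\<lambda>_. 1"]
  by (auto simp: succ_event_def indices_upto_def inar_indices_def)

lemma cexp_succ_succ:
  assumes "j \<ge> 1" "i \<ge> 1"
  shows "cexp (indices_upto k) (\<lambda>w. indicator (succ_event k i) w * indicator (succ_event k j) w)
    (\<lambda>w. ennreal (if i = j then \<alpha> w else (\<alpha> w)\<^sup>2))"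
proof (cases "i = j")
  case True
  have "(\<lambda>w. indicator (succ_event k i) w * indicator (succ_event k j) w :: ennreal) = indicator (succ_event k j)"
    using True by (auto simp: fun_eq_iff indicator_def)
  then show ?thesis using cexp_succ[of j k] assms True by simp
next
  case False
  have "cexp (indices_upto k) (indicator {w \<in> space M. \<forall>i\<in>{Thin (Suc k) i, Thin (Suc k) j}. Z i w = 1})
      (\<lambda>w. ennreal (\<Prod>i\<in>{Thin (Suc k) i, Thin (Suc k) j}. mass1 i 1 (\<alpha> w)))"
    using assms by (intro cexp_event indices_upto_subset) (auto simp: indices_upto_def inar_indices_def)
  also have "(\<lambda>w. ennreal (\<Prod>i\<in>{Thin (Suc k) i, Thin (Suc k) j}. mass1 i 1 (\<alpha> w))) =
      (\<lambda>w. ennreal (if i = j then \<alpha> w else (\<alpha> w)\<^sup>2))"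
    using False by (simp add: power2_eq_square)
  also have "indicator {w \<in> space M. \<forall>i\<in>{Thin (Suc k) i, Thin (Suc k) j}. Z i w = 1} =
      (\<lambda>w. indicator (succ_event k i) w * indicator (succ_event k j) w :: ennreal)"
    by (auto simp: fun_eq_iff indicator_def succ_event_def)
  finally show ?thesis .
qed

lemma suminf_indicator_nat:
  fixes g :: "nat \<Rightarrow> ennreal" shows "(\<Sum>n. g n * indicator {w \<in> space M. Y w = n \<and> R w} w) =
    (if w \<in> space M \<and> R w then g (Y w) else 0)"
proof (cases "w \<in> space M \<and> R w")
  case True
  have "(\<Sum>n. g n * indicator {w \<in> space M. Y w = n \<and> R w} w) = g (Y w)"
    by (rule suminf_cmult_indicator) (use True in \<open>auto simp: disjoint_family_on_def\<close>)
  with True show ?thesis by simp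
qed (auto simp: indicator_def)

text \<open>The dummy conjunct \<open>True\<close> and the factor 1 give the shape of
  \<open>suminf_indicator_nat\<close> and \<open>suminf_poi_ennreal\<close>, shared with the joint
  event in \<open>cexp_innov_succ\<close>.\<close>

lemma cexp_innov_event:
  "cexp (indices_upto k) (indicator {w \<in> space M. \<epsilon> (Suc k) w = m \<and> True}) (\<lambda>w. ennreal (poi lam m * 1))"
  using cexp_event[OF indices_upto_subset, of "{Innov (Suc k)}" k "\<lambda>_. m"]
  by (auto simp: indices_upto_def inar_indices_def)

lemma cexp_innov:
  "cexp (indices_upto k) (\<lambda>w. ennreal (real (\<epsilon> (Suc k) w))) (\<lambda>w. ennreal lam)"
  "cexp (indices_upto k) (\<lambda>w. ennreal ((real (\<epsilon> (Suc k) w))\<^sup>2)) (\<lambda>w. ennreal (lam + lam\<^sup>2))"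
proof -
  have *: "cexp (indices_upto k) (\<lambda>w. g (\<epsilon> (Suc k) w)) (\<lambda>w. \<Sum>m. g m * ennreal (poi lam m * 1))"
    if [measurable]: "(\<lambda>w. g (\<epsilon> (Suc k) w)) \<in> borel_measurable M" for g :: "nat \<Rightarrow> ennreal"
    by (rule cexp_cong[OF cexp_suminf[OF cexp_mult[OF cexp_innov_event _ indices_upto_subset] indices_upto_subset]])
       (auto simp: suminf_indicator_nat[where R = "\<lambda>_. True", simplified])
  show "cexp (indices_upto k) (\<lambda>w. ennreal (real (\<epsilon> (Suc k) w))) (\<lambda>w. ennreal lam)"
    using *[of "\<lambda>m. ennreal (real m)"] suminf_poi_ennreal(1)[of lam 1] lam_pos by simp
  show "cexp (indices_upto k) (\<lambda>w. ennreal ((real (\<epsilon> (Suc k) w))\<^sup>2)) (\<lambda>w. ennreal (lam + lam\<^sup>2))"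
    using *[of "\<lambda>m. ennreal ((real m)\<^sup>2)"] suminf_poi_ennreal(2)[of lam 1] lam_pos by simp
qed

lemma cexp_innov_succ:
  assumes "j \<ge> 1"
  shows "cexp (indices_upto k) (\<lambda>w. ennreal (real (\<epsilon> (Suc k) w)) * indicator (succ_event k j) w) (\<lambda>w. ennreal (lam * \<alpha> w))"
proof -
  have ev: "cexp (indices_upto k) (indicator {w \<in> space M. \<epsilon> (Suc k) w = m \<and> \<xi> (Suc k) j w = 1}) (\<lambda>w. ennreal (poi lam m * \<alpha> w))" for m
  proof -
    have "cexp (indices_upto k) (indicator {w \<in> space M. \<forall>i\<in>{Innov (Suc k), Thin (Suc k) j}. Z i w = (if i = Innov (Suc k) then m else 1)})
        (\<lambda>w. ennreal (\<Prod>i\<in>{Innov (Suc k), Thin (Suc k) j}. mass1 i (if i = Innov (Suc k) then m else 1) (\<alpha> w)))"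
      using assms by (intro cexp_event indices_upto_subset) (auto simp: indices_upto_def inar_indices_def)
    then show ?thesis by simp
  qed
  show ?thesis
  proof (rule cexp_cong[OF cexp_suminf[OF cexp_mult[OF ev _ indices_upto_subset] indices_upto_subset]])
    show "(\<lambda>w. ennreal (real m)) \<in> borel_measurable (past (indices_upto k))" for m by simp
    show "AE w in M. ennreal (real (\<epsilon> (Suc k) w)) * indicator (succ_event k j) w =
       (\<Sum>m. ennreal (real m) * indicator {w \<in> space M. \<epsilon> (Suc k) w = m \<and> \<xi> (Suc k) j w = 1} w)"
      by (auto simp: suminf_indicator_nat succ_event_def)
    show "ennreal (lam * \<alpha> w) = (\<Sum>m. ennreal (real m) * ennreal (poi lam m * \<alpha> w))" if "w \<in> space M" for w
      using suminf_poi_ennreal(1)[of lam "\<alpha> w"] lam_pos \<alpha>_range[OF that] by simp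
  qed (use assms in measurable)
qed

text \<open>The conditional probabilities of the values 0 and 1 add up to 1, so for each j other
  values have probability 0; countably many j are then combined.\<close>

lemma AE_\<xi>_eq_indicator:
  "AE w in M. \<forall>j\<ge>1. \<xi> (Suc k) j w = indicator (succ_event k j) w"
proof -
  have "AE w in M. j \<ge> 1 \<longrightarrow> \<xi> (Suc k) j w = indicator (succ_event k j) w" for j
  proof (cases "j \<ge> 1")
    case True
    define E0 where "E0 = {w \<in> space M. \<xi> (Suc k) j w = 0}"
    have [measurable]: "E0 \<in> sets M"
      using measurable_sets[OF measurable_\<xi>, of j "{0}" k] True
      by (auto simp: E0_def vimage_def Int_def conj_commute)
    have [measurable]: "succ_event k j \<in> sets M" using True by measurable
    have prob: "emeasure M E = (\<integral>\<^sup>+w. ennreal (cond_prob_given M \<alpha> E w) \<partial>M)" if "E \<in> sets M" for E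
      using nn_integral_cond_prob[OF that, of "\<lambda>_. 1"] that by simp
    have "emeasure M (E0 \<union> succ_event k j) = emeasure M E0 + emeasure M (succ_event k j)"
    proof (rule plus_emeasure[symmetric])
      show "E0 \<inter> succ_event k j = {}" by (auto simp: E0_def succ_event_def)
    qed measurable
    also have "\<dots> = (\<integral>\<^sup>+w. ennreal (cond_prob_given M \<alpha> E0 w) \<partial>M) +
        (\<integral>\<^sup>+w. ennreal (cond_prob_given M \<alpha> (succ_event k j) w) \<partial>M)"
      by (simp add: prob)
    also have "\<dots> = (\<integral>\<^sup>+w. ennreal (1 - \<alpha> w) \<partial>M) + (\<integral>\<^sup>+w. ennreal (\<alpha> w) \<partial>M)"
      using \<xi>_zero[of "Suc k" j] \<xi>_one[of "Suc k" j] True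
      by (intro arg_cong2[where f = "(+)"] nn_integral_cong_AE) (auto simp: E0_def succ_event_def elim: AE_mp)
    also have "\<dots> = (\<integral>\<^sup>+w. ennreal (1 - \<alpha> w) + ennreal (\<alpha> w) \<partial>M)"
      by (rule nn_integral_add[symmetric]) auto
    also have "\<dots> = (\<integral>\<^sup>+w. 1 \<partial>M)"
      using \<alpha>_range by (intro nn_integral_cong) (auto simp: less_imp_le simp flip: ennreal_plus)
    also have "\<dots> = 1" by (simp add: emeasure_space_1)
    finally have "AE w in M. w \<in> E0 \<union> succ_event k j"
      by (intro AE_in_set_eq_1[THEN iffD2]) (auto simp: measure_def)
    then show ?thesis by (rule AE_mp) (auto simp: E0_def succ_event_def indicator_def intro!: AE_I2)
  qed auto
  then show ?thesis by (simp add: AE_all_countable)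
qed

lemma AE_X_Suc:
  "AE w in M. ennreal (real (X (Suc k) w)) =
     (\<Sum>j=1..X k w. indicator (succ_event k j) w) + ennreal (real (\<epsilon> (Suc k) w))"
  using AE_\<xi>_eq_indicator[of k]
proof eventually_elim
  case (elim w)
  have "ennreal (real (\<Sum>j=1..n. \<xi> (Suc k) j w)) = (\<Sum>j=1..n. indicator (succ_event k j) w)" for n
  proof -
    have "ennreal (real (\<Sum>j=1..n. \<xi> (Suc k) j w)) = (\<Sum>j=1..n. ennreal (real (\<xi> (Suc k) j w)))"
      by (simp add: sum_ennreal)
    also have "\<dots> = (\<Sum>j=1..n. indicator (succ_event k j) w)"
      using elim by (intro sum.cong) (auto simp: indicator_def)
    finally show ?thesis .
  qed
  then show ?case by (simp del: of_nat_sum add: ennreal_plus)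
qed

lemma cexp_X_Suc: "cexp (indices_upto k) (\<lambda>w. ennreal (real (X (Suc k) w))) (\<lambda>w. ennreal (\<alpha> w * real (X k w) + lam))"
proof -
  have "cexp (indices_upto k) (\<lambda>w. (\<Sum>j=1..n. indicator (succ_event k j) w) + ennreal (real (\<epsilon> (Suc k) w)))
      (\<lambda>w. (\<Sum>j=1..n. ennreal (\<alpha> w)) + ennreal lam)" for n
    by (intro cexp_add cexp_sum cexp_succ cexp_innov indices_upto_subset) auto
  from cexp_random_index[OF this measurable_X_past indices_upto_subset]
  show ?thesis
  proof (rule cexp_cong)
    fix w assume "w \<in> space M"
    then show "ennreal (\<alpha> w * real (X k w) + lam) = (\<Sum>j=1..X k w. ennreal (\<alpha> w)) + ennreal lam"
      using \<alpha>_range[of w] lam_pos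
      by (simp add: ennreal_of_nat_eq_real_of_nat ennreal_plus mult.commute flip: ennreal_mult)
  qed (rule AE_X_Suc, measurable)
qed

text \<open>For \<open>X k = n\<close> the square expands into n diagonal terms of mean \<alpha>,
  n^2 - n off-diagonal ones of mean \<alpha>^2, 2 n mixed ones of mean lam \<alpha>, and the squared
  innovation.\<close>

lemma cexp_X_Suc_square:
  "cexp (indices_upto k) (\<lambda>w. ennreal ((real (X (Suc k) w))\<^sup>2))
    (\<lambda>w. ennreal (real (X k w) * \<alpha> w + (real (X k w) * real (X k w) - real (X k w)) * (\<alpha> w)\<^sup>2
          + 2 * real (X k w) * lam * \<alpha> w + (lam + lam\<^sup>2)))"
proof -
  have "cexp (indices_upto k) (\<lambda>w. (\<Sum>i=1..n. \<Sum>j=1..n. indicator (succ_event k i) w * indicator (succ_event k j) w)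
        + (\<Sum>i\<in>{1,2::nat}. \<Sum>j=1..n. ennreal (real (\<epsilon> (Suc k) w)) * indicator (succ_event k j) w)
        + ennreal ((real (\<epsilon> (Suc k) w))\<^sup>2))
      (\<lambda>w. (\<Sum>i=1..n. \<Sum>j=1..n. ennreal (if i = j then \<alpha> w else (\<alpha> w)\<^sup>2))
        + (\<Sum>i\<in>{1,2::nat}. \<Sum>j=1..n. ennreal (lam * \<alpha> w)) + ennreal (lam + lam\<^sup>2))" for n
    by (intro cexp_add cexp_sum cexp_succ_succ cexp_innov_succ cexp_innov indices_upto_subset) auto
  from cexp_random_index[OF this measurable_X_past indices_upto_subset]
  show ?thesis
  proof (rule cexp_cong)
    show "AE w in M. ennreal ((real (X (Suc k) w))\<^sup>2) =
       (\<Sum>i=1..X k w. \<Sum>j=1..X k w. indicator (succ_event k i) w * indicator (succ_event k j) w)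
        + (\<Sum>i\<in>{1,2::nat}. \<Sum>j=1..X k w. ennreal (real (\<epsilon> (Suc k) w)) * indicator (succ_event k j) w)
        + ennreal ((real (\<epsilon> (Suc k) w))\<^sup>2)"
      using AE_X_Suc[of k]
    proof eventually_elim
      case (elim w)
      have "ennreal ((real (X (Suc k) w))\<^sup>2) = (ennreal (real (X (Suc k) w)))\<^sup>2"
        by (simp add: ennreal_power del: inar1.simps)
      then show ?case
        unfolding elim square_sum_plus by (simp add: ennreal_power)
    qed
  next
    fix w assume "w \<in> space M"
    then have \<alpha>: "0 < \<alpha> w" "\<alpha> w < 1" using \<alpha>_range[of w] by auto
    define n where "n = X k w"
    have "(\<Sum>i=1..n. \<Sum>j=1..n. ennreal (if i = j then \<alpha> w else (\<alpha> w)\<^sup>2))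
        + (\<Sum>i\<in>{1,2::nat}. \<Sum>j=1..n. ennreal (lam * \<alpha> w)) + ennreal (lam + lam\<^sup>2) =
        ennreal ((\<Sum>i=1..n. \<Sum>j=1..n. if i = j then \<alpha> w else (\<alpha> w)\<^sup>2)
        + (\<Sum>i\<in>{1,2::nat}. \<Sum>j=1..n. lam * \<alpha> w) + (lam + lam\<^sup>2))"
      using \<alpha> lam_pos
      by (subst ennreal_plus, (auto intro!: add_nonneg_nonneg sum_nonneg)[2])+
         (simp add: sum_ennreal sum_nonneg ennreal_mult ennreal_of_nat_eq_real_of_nat)
    also have "\<dots> = ennreal (real n * \<alpha> w + (real n * real n - real n) * (\<alpha> w)\<^sup>2
          + 2 * real n * lam * \<alpha> w + (lam + lam\<^sup>2))"
      unfolding sum_square_diag by (simp add: mult.assoc)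
    finally show "ennreal (real (X k w) * \<alpha> w + (real (X k w) * real (X k w) - real (X k w)) * (\<alpha> w)\<^sup>2
          + 2 * real (X k w) * lam * \<alpha> w + (lam + lam\<^sup>2)) =
        (\<Sum>i=1..X k w. \<Sum>j=1..X k w. ennreal (if i = j then \<alpha> w else (\<alpha> w)\<^sup>2))
        + (\<Sum>i\<in>{1,2::nat}. \<Sum>j=1..X k w. ennreal (lam * \<alpha> w)) + ennreal (lam + lam\<^sup>2)"
      by (simp add: n_def)
  qed measurable
qed

section \<open>Conditional moments of the path given the mixing variable\<close>

abbreviation \<mu> :: "'a \<Rightarrow> real" where "\<mu> w \<equiv> lam / (1 - \<alpha> w)"

lemma \<mu>_pos: "w \<in> space M \<Longrightarrow> \<mu> w > 0"
  using \<alpha>_range[of w] lam_pos by simp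

text \<open>Stationarity of the mean: \<mu> is the fixed point of x \<mapsto> \<alpha> x + lam, the
  conditional mean recursion.\<close>

lemma \<mu>_eq: "w \<in> space M \<Longrightarrow> \<alpha> w * \<mu> w + lam = \<mu> w"
  using \<alpha>_range[of w] by (simp add: field_simps)

lemma cexp_X0_event:
  "cexp {} (indicator {w \<in> space M. X 0 w = m \<and> True}) (\<lambda>w. ennreal (poi (\<mu> w) m * 1))"
  using cexp_event[of "{}" "{Init}" "\<lambda>_. m"] by (auto simp: inar_indices_def)

lemma cexp_X0:
  "cexp {} (\<lambda>w. ennreal (real (X 0 w))) (\<lambda>w. ennreal (\<mu> w))"
  "cexp {} (\<lambda>w. ennreal ((real (X 0 w))\<^sup>2)) (\<lambda>w. ennreal (\<mu> w + (\<mu> w)\<^sup>2))"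
proof -
  have *: "cexp {} (\<lambda>w. g (X 0 w)) (\<lambda>w. \<Sum>m. g m * ennreal (poi (\<mu> w) m * 1))"
    if [measurable]: "(\<lambda>w. g (X 0 w)) \<in> borel_measurable M" for g :: "nat \<Rightarrow> ennreal"
    by (rule cexp_cong[OF cexp_suminf[OF cexp_mult[OF cexp_X0_event]]])
       (auto simp: suminf_indicator_nat[where R = "\<lambda>_. True", simplified])
  show "cexp {} (\<lambda>w. ennreal (real (X 0 w))) (\<lambda>w. ennreal (\<mu> w))"
    by (rule cexp_cong[OF *[of "\<lambda>m. ennreal (real m)"]])
       (use suminf_poi_ennreal(1)[of "\<mu> w" 1 for w] \<mu>_pos in \<open>auto simp: less_imp_le\<close>)
  show "cexp {} (\<lambda>w. ennreal ((real (X 0 w))\<^sup>2)) (\<lambda>w. ennreal (\<mu> w + (\<mu> w)\<^sup>2))"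
    by (rule cexp_cong[OF *[of "\<lambda>m. ennreal ((real m)\<^sup>2)"]])
       (use suminf_poi_ennreal(2)[of "\<mu> w" 1 for w] \<mu>_pos in \<open>auto simp: less_imp_le\<close>)
qed

lemma cexp_X: "cexp {} (\<lambda>w. ennreal (real (X k w))) (\<lambda>w. ennreal (\<mu> w))"
proof (induction k)
  case 0
  show ?case by (rule cexp_X0)
next
  case (Suc k)
  have "cexp {} (\<lambda>w. ennreal (\<alpha> w) * ennreal (real (X k w)) + ennreal lam) (\<lambda>w. ennreal (\<alpha> w) * ennreal (\<mu> w) + ennreal lam)"
    by (intro cexp_add cexp_mult cexp_self Suc) auto
  then have "cexp {} (\<lambda>w. ennreal (\<alpha> w * real (X k w) + lam)) (\<lambda>w. ennreal (\<mu> w))"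
  proof (rule cexp_cong)
    show "AE w in M. ennreal (\<alpha> w * real (X k w) + lam) = ennreal (\<alpha> w) * ennreal (real (X k w)) + ennreal lam"
      using \<alpha>_range lam_pos by (intro AE_I2) (auto simp: less_imp_le simp flip: ennreal_mult ennreal_plus)
    show "ennreal (\<mu> w) = ennreal (\<alpha> w) * ennreal (\<mu> w) + ennreal lam" if "w \<in> space M" for w
      using \<alpha>_range[OF that] lam_pos \<mu>_eq[OF that] \<mu>_pos[OF that]
      by (simp add: less_imp_le flip: ennreal_mult ennreal_plus)
  qed measurable
  then show ?case by (rule cexp_tower[OF cexp_X_Suc]) simp
qed

text \<open>Taking the one-step formula down to \<alpha> gives a recursion in the first two moments,
  of which the Poisson value \<mu> + \<mu>^2 is the fixed point.\<close>

lemma cexp_X_square: "cexp {} (\<lambda>w. ennreal ((real (X k w))\<^sup>2)) (\<lambda>w. ennreal (\<mu> w + (\<mu> w)\<^sup>2))"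
proof (induction k)
  case 0
  show ?case by (rule cexp_X0)
next
  case (Suc k)
  have "cexp {} (\<lambda>w. ennreal ((\<alpha> w)\<^sup>2) * ennreal ((real (X k w))\<^sup>2)
         + ennreal (\<alpha> w * (1 - \<alpha> w) + 2 * \<alpha> w * lam) * ennreal (real (X k w)) + ennreal (lam + lam\<^sup>2))
       (\<lambda>w. ennreal ((\<alpha> w)\<^sup>2) * ennreal (\<mu> w + (\<mu> w)\<^sup>2)
         + ennreal (\<alpha> w * (1 - \<alpha> w) + 2 * \<alpha> w * lam) * ennreal (\<mu> w) + ennreal (lam + lam\<^sup>2))"
    by (intro cexp_add cexp_mult cexp_self Suc cexp_X) auto
  then have "cexp {} (\<lambda>w. ennreal (real (X k w) * \<alpha> w + (real (X k w) * real (X k w) - real (X k w)) * (\<alpha> w)\<^sup>2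
          + 2 * real (X k w) * lam * \<alpha> w + (lam + lam\<^sup>2))) (\<lambda>w. ennreal (\<mu> w + (\<mu> w)\<^sup>2))"
  proof (rule cexp_cong)
    have pos: "0 \<le> \<alpha> w * (1 - \<alpha> w) + 2 * \<alpha> w * lam" if "w \<in> space M" for w
      using \<alpha>_range[OF that] lam_pos by simp
    show "AE w in M. ennreal (real (X k w) * \<alpha> w + (real (X k w) * real (X k w) - real (X k w)) * (\<alpha> w)\<^sup>2
          + 2 * real (X k w) * lam * \<alpha> w + (lam + lam\<^sup>2)) = ennreal ((\<alpha> w)\<^sup>2) * ennreal ((real (X k w))\<^sup>2)
         + ennreal (\<alpha> w * (1 - \<alpha> w) + 2 * \<alpha> w * lam) * ennreal (real (X k w)) + ennreal (lam + lam\<^sup>2)"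
    proof (intro AE_I2)
      fix w assume w: "w \<in> space M"
      have "real (X k w) * \<alpha> w + (real (X k w) * real (X k w) - real (X k w)) * (\<alpha> w)\<^sup>2
          + 2 * real (X k w) * lam * \<alpha> w + (lam + lam\<^sup>2) = (\<alpha> w)\<^sup>2 * (real (X k w))\<^sup>2
         + (\<alpha> w * (1 - \<alpha> w) + 2 * \<alpha> w * lam) * real (X k w) + (lam + lam\<^sup>2)"
        by (simp add: power2_eq_square algebra_simps)
      then show "ennreal (real (X k w) * \<alpha> w + (real (X k w) * real (X k w) - real (X k w)) * (\<alpha> w)\<^sup>2
          + 2 * real (X k w) * lam * \<alpha> w + (lam + lam\<^sup>2)) = ennreal ((\<alpha> w)\<^sup>2) * ennreal ((real (X k w))\<^sup>2)
         + ennreal (\<alpha> w * (1 - \<alpha> w) + 2 * \<alpha> w * lam) * ennreal (real (X k w)) + ennreal (lam + lam\<^sup>2)"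
        using pos[OF w] lam_pos by (simp add: less_imp_le flip: ennreal_mult ennreal_plus)
    qed
    fix w assume w: "w \<in> space M"
    \<comment> \<open>With lam eliminated, the fixed-point equation is a polynomial identity in
      \<alpha> and \<mu>.\<close>
    have "lam = (1 - \<alpha> w) * \<mu> w" using \<alpha>_range[OF w] by simp
    then have "(\<alpha> w)\<^sup>2 * (\<mu> w + (\<mu> w)\<^sup>2) + (\<alpha> w * (1 - \<alpha> w) + 2 * \<alpha> w * lam) * \<mu> w + (lam + lam\<^sup>2) = \<mu> w + (\<mu> w)\<^sup>2"
      by algebra
    then show "ennreal (\<mu> w + (\<mu> w)\<^sup>2) = ennreal ((\<alpha> w)\<^sup>2) * ennreal (\<mu> w + (\<mu> w)\<^sup>2)
         + ennreal (\<alpha> w * (1 - \<alpha> w) + 2 * \<alpha> w * lam) * ennreal (\<mu> w) + ennreal (lam + lam\<^sup>2)"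
      using pos[OF w] lam_pos \<mu>_pos[OF w]
      by (simp add: less_imp_le del: times_divide_eq_right flip: ennreal_mult ennreal_plus)
  qed measurable
  then show ?case by (rule cexp_tower[OF cexp_X_Suc_square]) simp
qed

text \<open>\<open>X 0\<close> belongs to every history, so it multiplies the one-step mean
  recursion; the covariance part \<mu> is contracted by \<alpha> at each step while \<mu>^2 is
  preserved.\<close>

lemma cexp_X0_X: "cexp {} (\<lambda>w. ennreal (real (X 0 w) * real (X k w))) (\<lambda>w. ennreal (\<alpha> w ^ k * \<mu> w + (\<mu> w)\<^sup>2))"
proof (induction k)
  case 0
  show ?case using cexp_X0(2) by (simp add: power2_eq_square)
next
  case (Suc k)
  have U: "(\<lambda>w. ennreal (real (X 0 w))) \<in> borel_measurable (past (indices_upto k))"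
    by (rule measurable_past_mono[OF indices_upto_mono[of 0 k] measurable_X_past_ennreal]) simp
  have 1: "cexp (indices_upto k) (\<lambda>w. ennreal (real (X 0 w) * real (X (Suc k) w))) (\<lambda>w. ennreal (real (X 0 w)) * ennreal (\<alpha> w * real (X k w) + lam))"
    by (rule cexp_cong[OF cexp_mult[OF cexp_X_Suc U indices_upto_subset]]) (auto simp: ennreal_mult simp del: inar1.simps)
  have "cexp {} (\<lambda>w. ennreal (\<alpha> w) * ennreal (real (X 0 w) * real (X k w)) + ennreal lam * ennreal (real (X 0 w)))
      (\<lambda>w. ennreal (\<alpha> w) * ennreal (\<alpha> w ^ k * \<mu> w + (\<mu> w)\<^sup>2) + ennreal lam * ennreal (\<mu> w))"
    by (intro cexp_add cexp_mult cexp_self Suc cexp_X) auto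
  then have "cexp {} (\<lambda>w. ennreal (real (X 0 w)) * ennreal (\<alpha> w * real (X k w) + lam)) (\<lambda>w. ennreal (\<alpha> w ^ Suc k * \<mu> w + (\<mu> w)\<^sup>2))"
  proof (rule cexp_cong)
    show "AE w in M. ennreal (real (X 0 w)) * ennreal (\<alpha> w * real (X k w) + lam) =
       ennreal (\<alpha> w) * ennreal (real (X 0 w) * real (X k w)) + ennreal lam * ennreal (real (X 0 w))"
      using \<alpha>_range lam_pos
      by (intro AE_I2) (auto simp: less_imp_le algebra_simps simp flip: ennreal_mult ennreal_plus)
    fix w assume w: "w \<in> space M"
    have "lam = (1 - \<alpha> w) * \<mu> w" using \<alpha>_range[OF w] by simp
    then have "\<alpha> w * (\<alpha> w ^ k * \<mu> w + (\<mu> w)\<^sup>2) + lam * \<mu> w = \<alpha> w ^ Suc k * \<mu> w + (\<mu> w)\<^sup>2"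
      unfolding power_Suc by algebra
    then show "ennreal (\<alpha> w ^ Suc k * \<mu> w + (\<mu> w)\<^sup>2) = ennreal (\<alpha> w) * ennreal (\<alpha> w ^ k * \<mu> w + (\<mu> w)\<^sup>2) + ennreal lam * ennreal (\<mu> w)"
      using lam_pos \<mu>_pos[OF w] \<alpha>_range[OF w]
      by (simp add: less_imp_le del: times_divide_eq_right power_Suc flip: ennreal_mult ennreal_plus)
  qed measurable
  from cexp_tower[OF 1 this] show ?case by simp
qed

text \<open>
  Away from \<open>\<alpha> = 1\<close> all second moments are finite and can be subtracted; Fatou removes the cutoff.
\<close>

definition cutoff :: "nat \<Rightarrow> 'a \<Rightarrow> real" where
  "cutoff r w = indicator {..1 - inverse (real (Suc r))} (\<alpha> w)"

lemma cutoff_measurable [measurable]: "cutoff r \<in> borel_measurable M"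
  unfolding cutoff_def by measurable

lemma cutoff_measurable_past: "(\<lambda>w. ennreal (cutoff r w)) \<in> borel_measurable (past H)"
  unfolding cutoff_def by measurable

lemma cutoff_01: "0 \<le> cutoff r w" "cutoff r w \<le> 1"
  by (auto simp: cutoff_def indicator_def)

lemma cutoff_eventually:
  assumes "w \<in> space M" shows "eventually (\<lambda>r. cutoff r w = 1) sequentially"
proof -
  have "(\<lambda>r. 1 - inverse (real (Suc r))) \<longlonglongrightarrow> 1 - 0"
    by (intro tendsto_intros LIMSEQ_inverse_real_of_nat)
  from order_tendstoD(1)[OF this, of "\<alpha> w"] \<alpha>_range[OF assms]
  have "eventually (\<lambda>r. \<alpha> w < 1 - inverse (real (Suc r))) sequentially" by simp
  then show ?thesis by eventually_elim (simp add: cutoff_def)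
qed

lemma cutoff_\<mu>_le:
  assumes "w \<in> space M" shows "cutoff r w * \<mu> w \<le> lam * real (Suc r)"
proof (cases "\<alpha> w \<le> 1 - inverse (real (Suc r))")
  case True
  then have "inverse (real (Suc r)) \<le> 1 - \<alpha> w" by simp
  then have "\<mu> w \<le> lam / inverse (real (Suc r))"
    using lam_pos \<alpha>_range[OF assms] by (intro divide_left_mono mult_pos_pos) auto
  with True show ?thesis by (simp add: cutoff_def divide_inverse del: of_nat_Suc)
next
  case False
  then show ?thesis using lam_pos by (simp add: cutoff_def)
qed

lemma nn_integral_cutoff_\<mu>: "(\<integral>\<^sup>+w. ennreal (cutoff r w) * ennreal (\<mu> w) \<partial>M) < \<top>"
proof -
  have "(\<integral>\<^sup>+w. ennreal (cutoff r w) * ennreal (\<mu> w) \<partial>M) \<le> (\<integral>\<^sup>+w. ennreal (lam * real (Suc r)) \<partial>M)"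
    using cutoff_\<mu>_le[of _ r] \<mu>_pos cutoff_01
    by (intro nn_integral_mono) (auto simp: less_imp_le ennreal_leI simp del: times_divide_eq_right of_nat_Suc simp flip: ennreal_mult)
  also have "\<dots> < \<top>" by (simp add: emeasure_space_1)
  finally show ?thesis .
qed

text \<open>The value of the integral is free of \<open>k\<close>, which is what makes the cut-off
  differences centred.\<close>

lemma integrable_cutoff_X: "integrable M (\<lambda>w. cutoff r w * real (X k w))"
  and integral_cutoff_X: "(LINT w|M. cutoff r w * real (X k w)) = enn2real (\<integral>\<^sup>+w. ennreal (cutoff r w) * ennreal (\<mu> w) \<partial>M)"
proof -
  have nn: "(\<integral>\<^sup>+w. ennreal (cutoff r w * real (X k w)) \<partial>M) = (\<integral>\<^sup>+w. ennreal (cutoff r w) * ennreal (\<mu> w) \<partial>M)"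
    using cexpD(3)[OF cexp_X[of k] cutoff_measurable_past, of r] cutoff_01 by (simp add: ennreal_mult)
  show "integrable M (\<lambda>w. cutoff r w * real (X k w))"
    by (rule integrableI_nonneg) (use nn nn_integral_cutoff_\<mu> cutoff_01 in auto)
  show "(LINT w|M. cutoff r w * real (X k w)) = enn2real (\<integral>\<^sup>+w. ennreal (cutoff r w) * ennreal (\<mu> w) \<partial>M)"
    by (subst integral_eq_nn_integral) (use nn cutoff_01 in auto)
qed

lemma nn_integral_cutoff_diff_square:
  "(\<integral>\<^sup>+w. ennreal (cutoff r w * (real (X k w) - real (X 0 w))\<^sup>2) \<partial>M) \<le> ennreal (2 * lam * real k)"
proof -
  define u where "u w = ennreal (cutoff r w)" for w
  have [measurable]: "u \<in> borel_measurable M" unfolding u_def by measurable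
  have U: "u \<in> borel_measurable (past {})" unfolding u_def by (rule cutoff_measurable_past)
  let ?D = "\<integral>\<^sup>+w. ennreal (cutoff r w * (real (X k w) - real (X 0 w))\<^sup>2) \<partial>M"
  let ?I1 = "\<integral>\<^sup>+w. u w * ennreal (\<alpha> w ^ k * \<mu> w + (\<mu> w)\<^sup>2) \<partial>M"
  have I1: "(\<integral>\<^sup>+w. u w * ennreal (real (X 0 w) * real (X k w)) \<partial>M) = ?I1"
    by (rule cexpD(3)[OF cexp_X0_X U])
  have "?D + 2 * ?I1 = (\<integral>\<^sup>+w. ennreal (cutoff r w * (real (X k w) - real (X 0 w))\<^sup>2) + 2 * (u w * ennreal (real (X 0 w) * real (X k w))) \<partial>M)"
    unfolding I1[symmetric] by (simp add: nn_integral_add nn_integral_cmult)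
  also have "\<dots> = (\<integral>\<^sup>+w. u w * ennreal ((real (X k w))\<^sup>2) + u w * ennreal ((real (X 0 w))\<^sup>2) \<partial>M)"
  proof (rule nn_integral_cong)
    fix w
    have "cutoff r w * (real (X k w) - real (X 0 w))\<^sup>2 + 2 * (cutoff r w * (real (X 0 w) * real (X k w))) =
       cutoff r w * (real (X k w))\<^sup>2 + cutoff r w * (real (X 0 w))\<^sup>2"
      by (simp add: power2_eq_square algebra_simps)
    moreover have "2 * ennreal x = ennreal (2 * x)" if "x \<ge> 0" for x
      using that by (simp add: ennreal_mult)
    ultimately show "ennreal (cutoff r w * (real (X k w) - real (X 0 w))\<^sup>2) + 2 * (u w * ennreal (real (X 0 w) * real (X k w)))
       = u w * ennreal ((real (X k w))\<^sup>2) + u w * ennreal ((real (X 0 w))\<^sup>2)"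
      using cutoff_01[of r w] unfolding u_def
      by (simp del: inar1.simps flip: ennreal_mult ennreal_plus)
  qed
  also have "\<dots> = (\<integral>\<^sup>+w. u w * ennreal (\<mu> w + (\<mu> w)\<^sup>2) \<partial>M) + (\<integral>\<^sup>+w. u w * ennreal (\<mu> w + (\<mu> w)\<^sup>2) \<partial>M)"
    by (simp add: nn_integral_add cexpD(3)[OF cexp_X_square U] del: inar1.simps)
  also have "\<dots> = (\<integral>\<^sup>+w. u w * ennreal (\<mu> w + (\<mu> w)\<^sup>2) + u w * ennreal (\<mu> w + (\<mu> w)\<^sup>2) \<partial>M)"
    by (simp add: nn_integral_add)
  also have "\<dots> \<le> (\<integral>\<^sup>+w. 2 * (u w * ennreal (\<alpha> w ^ k * \<mu> w + (\<mu> w)\<^sup>2)) + ennreal (2 * lam * real k) \<partial>M)"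
  proof (rule nn_integral_mono)
    fix w assume w: "w \<in> space M"
    have \<alpha>: "0 < \<alpha> w" "\<alpha> w < 1" using \<alpha>_range[OF w] by auto
    \<comment> \<open>Bernoulli's inequality: the factor 1 - \<alpha> cancels the denominator of
      \<mu>, which makes the bound uniform in \<alpha> and in the cutoff.\<close>
    have "1 - real k * (1 - \<alpha> w) \<le> \<alpha> w ^ k"
      using Bernoulli_inequality[of "\<alpha> w - 1" k] \<alpha> by (simp add: algebra_simps)
    then have "(1 - real k * (1 - \<alpha> w)) * \<mu> w \<le> \<alpha> w ^ k * \<mu> w"
      using \<mu>_pos[OF w] by (intro mult_right_mono) auto
    moreover have "(1 - real k * (1 - \<alpha> w)) * \<mu> w = \<mu> w - lam * real k"
      using \<alpha> by (simp add: field_simps)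
    ultimately have "\<mu> w \<le> \<alpha> w ^ k * \<mu> w + lam * real k" by linarith
    then have "cutoff r w * (\<mu> w + (\<mu> w)\<^sup>2) \<le> cutoff r w * (\<alpha> w ^ k * \<mu> w + (\<mu> w)\<^sup>2 + lam * real k)"
      using cutoff_01[of r w] by (intro mult_left_mono) auto
    also have "\<dots> \<le> cutoff r w * (\<alpha> w ^ k * \<mu> w + (\<mu> w)\<^sup>2) + lam * real k"
      using cutoff_01[of r w] lam_pos by (simp add: distrib_left mult_left_le_one_le del: times_divide_eq_right)
    finally have "cutoff r w * (\<mu> w + (\<mu> w)\<^sup>2) + cutoff r w * (\<mu> w + (\<mu> w)\<^sup>2) \<le>
       2 * (cutoff r w * (\<alpha> w ^ k * \<mu> w + (\<mu> w)\<^sup>2)) + 2 * lam * real k" by linarith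
    moreover have "2 * ennreal x = ennreal (2 * x)" if "x \<ge> 0" for x
      using that by (simp add: ennreal_mult)
    ultimately show "u w * ennreal (\<mu> w + (\<mu> w)\<^sup>2) + u w * ennreal (\<mu> w + (\<mu> w)\<^sup>2) \<le>
        2 * (u w * ennreal (\<alpha> w ^ k * \<mu> w + (\<mu> w)\<^sup>2)) + ennreal (2 * lam * real k)"
      using cutoff_01[of r w] \<mu>_pos[OF w] \<alpha> lam_pos unfolding u_def
      by (simp add: less_imp_le ennreal_leI del: times_divide_eq_right flip: ennreal_mult ennreal_plus)
  qed
  also have "\<dots> = 2 * ?I1 + ennreal (2 * lam * real k)"
    by (simp add: nn_integral_add nn_integral_cmult emeasure_space_1)
  finally have "2 * ?I1 + ?D \<le> 2 * ?I1 + ennreal (2 * lam * real k)" by (simp add: add.commute)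
  \<comment> \<open>Cancellation in \<open>ennreal\<close> needs a finite summand; here the cutoff
    is essential.\<close>
  moreover have "?I1 \<noteq> \<top>"
  proof -
    have "?I1 \<le> (\<integral>\<^sup>+w. ennreal (lam * real (Suc r) + (lam * real (Suc r))\<^sup>2) \<partial>M)"
    proof (rule nn_integral_mono)
      fix w assume w: "w \<in> space M"
      have c: "cutoff r w * \<mu> w \<le> lam * real (Suc r)" by (rule cutoff_\<mu>_le[OF w])
      have "cutoff r w * (\<alpha> w ^ k * \<mu> w + (\<mu> w)\<^sup>2) = \<alpha> w ^ k * (cutoff r w * \<mu> w) + (cutoff r w * \<mu> w)\<^sup>2"
        by (auto simp: cutoff_def indicator_def)
      also have "\<dots> \<le> 1 * (lam * real (Suc r)) + (lam * real (Suc r))\<^sup>2"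
      proof (rule add_mono)
        have nn: "0 \<le> cutoff r w * \<mu> w" using \<mu>_pos[OF w] cutoff_01[of r w] by (intro mult_nonneg_nonneg) auto
        show "\<alpha> w ^ k * (cutoff r w * \<mu> w) \<le> 1 * (lam * real (Suc r))"
          by (rule mult_mono[OF _ c _ nn]) (use \<alpha>_range[OF w] in \<open>auto intro: power_le_one\<close>)
        show "(cutoff r w * \<mu> w)\<^sup>2 \<le> (lam * real (Suc r))\<^sup>2" by (rule power_mono[OF c nn])
      qed
      finally show "u w * ennreal (\<alpha> w ^ k * \<mu> w + (\<mu> w)\<^sup>2) \<le> ennreal (lam * real (Suc r) + (lam * real (Suc r))\<^sup>2)"
        using cutoff_01[of r w] \<mu>_pos[OF w] \<alpha>_range[OF w] unfolding u_def
        by (simp add: less_imp_le ennreal_leI del: times_divide_eq_right of_nat_Suc ennreal_plus flip: ennreal_mult)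
    qed
    also have "\<dots> < \<top>" by (simp add: emeasure_space_1)
    finally show ?thesis by simp
  qed
  ultimately show ?thesis by (simp add: ennreal_add_left_cancel_le ennreal_mult_eq_top_iff)
qed

lemma nn_integral_diff_square:
  "(\<integral>\<^sup>+w. ennreal ((real (X k w) - real (X 0 w))\<^sup>2) \<partial>M) \<le> ennreal (2 * lam * real k)"
proof -
  have "(\<integral>\<^sup>+w. ennreal ((real (X k w) - real (X 0 w))\<^sup>2) \<partial>M) =
      (\<integral>\<^sup>+w. liminf (\<lambda>r. ennreal (cutoff r w * (real (X k w) - real (X 0 w))\<^sup>2)) \<partial>M)"
  proof (rule nn_integral_cong)
    fix w assume "w \<in> space M"
    have "(\<lambda>r. ennreal (cutoff r w * (real (X k w) - real (X 0 w))\<^sup>2)) \<longlonglongrightarrow> ennreal ((real (X k w) - real (X 0 w))\<^sup>2)"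
      by (rule tendsto_eventually, rule eventually_mono[OF cutoff_eventually[OF \<open>w \<in> space M\<close>]]) simp
    then show "ennreal ((real (X k w) - real (X 0 w))\<^sup>2) = liminf (\<lambda>r. ennreal (cutoff r w * (real (X k w) - real (X 0 w))\<^sup>2))"
      by (simp add: lim_imp_Liminf)
  qed
  also have "\<dots> \<le> liminf (\<lambda>r. \<integral>\<^sup>+w. ennreal (cutoff r w * (real (X k w) - real (X 0 w))\<^sup>2) \<partial>M)"
    by (rule nn_integral_liminf) measurable
  also have "\<dots> \<le> liminf (\<lambda>r::nat. ennreal (2 * lam * real k))"
    by (intro Liminf_mono always_eventually allI nn_integral_cutoff_diff_square)
  also have "\<dots> = ennreal (2 * lam * real k)" by (simp add: Liminf_const)
  finally show ?thesis .
qed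

lemma integrable_diff_square: "integrable M (\<lambda>w. (real (X k w) - real (X 0 w))\<^sup>2)"
  by (rule integrableI_nonneg) (use nn_integral_diff_square[of k] in \<open>auto intro: le_less_trans simp del: inar1.simps\<close>)

lemma integral_diff_square_le: "(LINT w|M. (real (X k w) - real (X 0 w))\<^sup>2) \<le> 2 * lam * real k"
  using nn_integral_diff_square[of k] lam_pos
  by (simp add: nn_integral_eq_integral[OF integrable_diff_square] del: inar1.simps)

lemma integrable_diff: "integrable M (\<lambda>w. real (X k w) - real (X 0 w))"
  by (rule Bochner_Integration.integrable_bound[of _ "\<lambda>w. 1 + (real (X k w) - real (X 0 w))\<^sup>2"])
     (use integrable_diff_square[of k] abs_le_one_plus_square[of "real (X k w) - real (X 0 w)" for w] in \<open>auto simp del: inar1.simps\<close>)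

text \<open>\<open>X k\<close> and \<open>X 0\<close> need not be integrable separately. The cut-off
  differences have mean 0 and are dominated by the absolute difference, which is integrable.\<close>

lemma integral_diff_eq_0: "(LINT w|M. real (X k w) - real (X 0 w)) = 0"
proof -
  have "(\<lambda>r. LINT w|M. cutoff r w * (real (X k w) - real (X 0 w))) \<longlonglongrightarrow> (LINT w|M. real (X k w) - real (X 0 w))"
  proof (rule integral_dominated_convergence[where w = "\<lambda>w. \<bar>real (X k w) - real (X 0 w)\<bar>"])
    show "AE w in M. (\<lambda>r. cutoff r w * (real (X k w) - real (X 0 w))) \<longlonglongrightarrow> real (X k w) - real (X 0 w)"
    proof (rule AE_I2)
      fix w assume "w \<in> space M"
      show "(\<lambda>r. cutoff r w * (real (X k w) - real (X 0 w))) \<longlonglongrightarrow> real (X k w) - real (X 0 w)"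
        by (rule tendsto_eventually, rule eventually_mono[OF cutoff_eventually[OF \<open>w \<in> space M\<close>]]) simp
    qed
    show "AE w in M. norm (cutoff r w * (real (X k w) - real (X 0 w))) \<le> \<bar>real (X k w) - real (X 0 w)\<bar>" for r
      using cutoff_01[of r] by (intro AE_I2) (auto simp: abs_mult intro: mult_left_le_one_le)
  qed (use integrable_diff[of k] in \<open>auto simp del: inar1.simps\<close>)
  moreover have "(LINT w|M. cutoff r w * (real (X k w) - real (X 0 w))) = 0" for r
    unfolding right_diff_distrib
    by (simp only: Bochner_Integration.integral_diff[OF integrable_cutoff_X integrable_cutoff_X] integral_cutoff_X)
  ultimately show ?thesis by (simp add: LIMSEQ_const_iff del: inar1.simps)
qed

section \<open>Characteristic function of the centred initial value\<close>

text \<open>\<open>cexp\<close> only covers nonnegative weights. For vector-valued \<open>g\<close>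
  the two sides are integrals of \<open>g\<close> against images under \<alpha> of two measures, and
  these images coincide by the nonnegative case.\<close>

lemma integral_X0_event:
  fixes g :: "real \<Rightarrow> 'c :: {banach, second_countable_topology}"
  assumes [measurable]: "g \<in> borel_measurable borel"
  shows "(\<integral>w. indicator {w \<in> space M. X0 w = m} w *\<^sub>R g (\<alpha> w) \<partial>M) = (\<integral>w. poi (\<mu> w) m *\<^sub>R g (\<alpha> w) \<partial>M)"
proof -
  let ?E = "{w \<in> space M. X0 w = m}"
  let ?D1 = "density M (\<lambda>w. ennreal (indicator ?E w))" and ?D2 = "density M (\<lambda>w. ennreal (poi (\<mu> w) m))"
  have \<alpha>[measurable]: "\<alpha> \<in> borel_measurable ?D1" "\<alpha> \<in> borel_measurable ?D2" by auto
  have eq: "distr ?D1 borel \<alpha> = distr ?D2 borel \<alpha>"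
  proof (rule measure_eqI)
    fix C assume "C \<in> sets (distr ?D1 borel \<alpha>)"
    then have [measurable]: "C \<in> sets borel" by simp
    have "(\<integral>\<^sup>+w. indicator C (\<alpha> w) * indicator ?E w \<partial>M) = (\<integral>\<^sup>+w. indicator C (\<alpha> w) * ennreal (poi (\<mu> w) m) \<partial>M)"
      using cexpD(3)[OF cexp_X0_event, of "\<lambda>w. indicator C (\<alpha> w)" m] by simp
    moreover have "emeasure (distr ?D1 borel \<alpha>) C = (\<integral>\<^sup>+w. indicator C (\<alpha> w) * indicator ?E w \<partial>M)"
      by (auto simp: emeasure_distr emeasure_density ennreal_indicator intro!: nn_integral_cong split: split_indicator)
    moreover have "emeasure (distr ?D2 borel \<alpha>) C = (\<integral>\<^sup>+w. indicator C (\<alpha> w) * ennreal (poi (\<mu> w) m) \<partial>M)"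
      by (auto simp: emeasure_distr emeasure_density intro!: nn_integral_cong split: split_indicator)
    ultimately show "emeasure (distr ?D1 borel \<alpha>) C = emeasure (distr ?D2 borel \<alpha>) C" by simp
  qed simp
  have "(\<integral>w. indicator ?E w *\<^sub>R g (\<alpha> w) \<partial>M) = (\<integral>w. g (\<alpha> w) \<partial>?D1)"
    by (subst integral_density) auto
  also have "\<dots> = (\<integral>x. g x \<partial>distr ?D1 borel \<alpha>)" by (rule integral_distr[symmetric]) auto
  also have "\<dots> = (\<integral>w. g (\<alpha> w) \<partial>?D2)" unfolding eq by (rule integral_distr) auto
  also have "\<dots> = (\<integral>w. poi (\<mu> w) m *\<^sub>R g (\<alpha> w) \<partial>M)"
    using \<mu>_pos by (subst integral_density) (auto intro!: AE_I2 poi_nonneg simp: less_imp_le)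
  finally show ?thesis .
qed

text \<open>Both sides are expanded over the values m of \<open>X0\<close>: on the left through the
  events \<open>X0 = m\<close>, on the right through the Poisson series. The terms agree by
  \<open>integral_X0_event\<close>.\<close>

lemma char_X0_centered:
  "(CLINT w|M. iexp (t * (real (X0 w) - \<mu> w))) = (CLINT w|M. exp (of_real (\<mu> w) * (iexp t - 1 - \<i> * of_real t)))"
proof -
  define E where "E m = {w \<in> space M. X0 w = m}" for m
  have [measurable]: "E m \<in> sets M" for m unfolding E_def by measurable
  define g where "g m x = iexp (t * (real m - lam / (1 - x)))" for m x
  have [measurable]: "g m \<in> borel_measurable borel" for m unfolding g_def by measurable
  have norm_g: "norm (g m x) = 1" for m x unfolding g_def norm_exp_i_times by simp
  have eq: "(CLINT w|M. indicator (E m) w *\<^sub>R g m (\<alpha> w)) = (CLINT w|M. poi (\<mu> w) m *\<^sub>R g m (\<alpha> w))" for m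
    unfolding E_def by (rule integral_X0_event) measurable
  have prob_E: "(LINT w|M. poi (\<mu> w) m) = prob (E m)" for m
    using integral_X0_event[of "\<lambda>_. 1::real" m] by (simp add: E_def)
  have int_poi: "integrable M (\<lambda>w. poi (\<mu> w) m)" for m
  proof (rule integrable_const_bound[where B = 1])
    show "AE w in M. norm (poi (\<mu> w) m) \<le> 1"
    proof (rule AE_I2)
      fix w assume "w \<in> space M"
      then have "poi (\<mu> w) m = pmf (poisson_pmf (\<mu> w)) m" using pmf_poisson_poi[OF \<mu>_pos] by simp
      then show "norm (poi (\<mu> w) m) \<le> 1" by (simp add: pmf_le_1)
    qed
  qed measurable
  \<comment> \<open>These probabilities bound the terms of both series, so one summability justifies
    both interchanges.\<close>
  have summable_E: "summable (\<lambda>m. prob (E m))"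
    by (rule sums_summable, rule finite_measure_UNION) (auto simp: disjoint_family_on_def E_def)
  have 1: "(\<lambda>m. CLINT w|M. indicator (E m) w *\<^sub>R g m (\<alpha> w)) sums (CLINT w|M. \<Sum>m. indicator (E m) w *\<^sub>R g m (\<alpha> w))"
  proof (rule sums_integral)
    show "integrable M (\<lambda>w. indicator (E m) w *\<^sub>R g m (\<alpha> w))" for m
      by (rule integrable_const_bound[where B = 1]) (auto simp: norm_g indicator_def)
    have "summable (\<lambda>m. norm (indicator (E m) w *\<^sub>R g m (\<alpha> w)))" for w
      by (rule summable_finite[of "{X0 w}"]) (auto simp: E_def)
    then show "AE w in M. summable (\<lambda>m. norm (indicator (E m) w *\<^sub>R g m (\<alpha> w)))" by simp
    show "summable (\<lambda>m. LINT w|M. norm (indicator (E m) w *\<^sub>R g m (\<alpha> w)))"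
      using summable_E by (simp add: norm_g)
  qed
  have 2: "(\<lambda>m. CLINT w|M. poi (\<mu> w) m *\<^sub>R g m (\<alpha> w)) sums (CLINT w|M. \<Sum>m. poi (\<mu> w) m *\<^sub>R g m (\<alpha> w))"
  proof (rule sums_integral)
    show "integrable M (\<lambda>w. poi (\<mu> w) m *\<^sub>R g m (\<alpha> w))" for m
      by (rule Bochner_Integration.integrable_bound[OF int_poi[of m]]) (auto simp: norm_g)
    show "AE w in M. summable (\<lambda>m. norm (poi (\<mu> w) m *\<^sub>R g m (\<alpha> w)))"
      using sums_summable[OF poi_sums] \<mu>_pos
      by (intro AE_I2) (auto simp: norm_g poi_nonneg less_imp_le)
    have "(LINT w|M. norm (poi (\<mu> w) m *\<^sub>R g m (\<alpha> w))) = prob (E m)" for m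
      unfolding prob_E[symmetric] using \<mu>_pos
      by (intro Bochner_Integration.integral_cong) (auto simp: norm_g poi_nonneg less_imp_le)
    then show "summable (\<lambda>m. LINT w|M. norm (poi (\<mu> w) m *\<^sub>R g m (\<alpha> w)))"
      using summable_E by simp
  qed
  have s1: "(\<Sum>m. indicator (E m) w *\<^sub>R g m (\<alpha> w)) = iexp (t * (real (X0 w) - \<mu> w))" if "w \<in> space M" for w
  proof -
    have "(\<lambda>m. indicator (E m) w *\<^sub>R g m (\<alpha> w)) = (\<lambda>m. if m = X0 w then g m (\<alpha> w) else 0)"
      using that by (auto simp: E_def fun_eq_iff indicator_def)
    then show ?thesis using sums_single[of "X0 w" "\<lambda>m. g m (\<alpha> w)"] by (simp add: sums_iff g_def)
  qed
  have s2: "(\<Sum>m. poi (\<mu> w) m *\<^sub>R g m (\<alpha> w)) = exp (of_real (\<mu> w) * (iexp t - 1 - \<i> * of_real t))" for w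
  proof -
    have 1: "(\<lambda>m. poi (\<mu> w) m *\<^sub>R iexp (t * real m) * iexp (- t * \<mu> w)) sums
        (exp (of_real (\<mu> w) * (iexp t - 1)) * iexp (- t * \<mu> w))"
      by (intro sums_mult2 poi_char_sums)
    have 2: "poi (\<mu> w) m *\<^sub>R iexp (t * real m) * iexp (- t * \<mu> w) = poi (\<mu> w) m *\<^sub>R g m (\<alpha> w)" for m
      unfolding g_def by (simp add: algebra_simps exp_add[symmetric] del: of_real_divide)
    have 3: "exp (of_real r * (iexp t - 1)) * iexp (- t * r) =
        exp (of_real r * (iexp t - 1 - \<i> * of_real t))" for r
      by (simp add: algebra_simps exp_add[symmetric])
    show ?thesis using 1 unfolding 2 3 by (rule sums_unique[symmetric])
  qed
  have "(CLINT w|M. iexp (t * (real (X0 w) - \<mu> w))) = (CLINT w|M. \<Sum>m. indicator (E m) w *\<^sub>R g m (\<alpha> w))"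
    using s1 by (intro Bochner_Integration.integral_cong) auto
  also have "\<dots> = (CLINT w|M. \<Sum>m. poi (\<mu> w) m *\<^sub>R g m (\<alpha> w))"
    using 1 2 unfolding eq by (rule sums_unique2)
  also have "\<dots> = (CLINT w|M. exp (of_real (\<mu> w) * (iexp t - 1 - \<i> * of_real t)))"
    by (simp only: s2)
  finally show ?thesis .
qed

text \<open>
  \<open>\<psi>\<close> itself need not be measurable outside \<open>(0, 1)\<close> and may be negative on a null set.
\<close>

definition mix_density :: "real \<Rightarrow> real" where
  "mix_density x = enn2real (ennreal (indicator {0<..<1} x * (\<psi> x * (1 - x) powr \<beta>)))"

lemma distr_\<alpha>: "distr M lborel \<alpha> = density lborel (\<lambda>x. ennreal (mix_density x))"
  using distributed_distr_eq_density[OF \<alpha>_density] by (simp add: mix_density_def)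

lemma mix_density_measurable [measurable]: "mix_density \<in> borel_measurable borel"
proof -
  have "(\<lambda>x. ennreal (indicator {0<..<1} x * (\<psi> x * (1 - x) powr \<beta>))) \<in> borel_measurable borel"
    using distributed_borel_measurable[OF \<alpha>_density] by simp
  then show ?thesis unfolding mix_density_def by measurable
qed

lemma mix_density_nonneg: "mix_density x \<ge> 0"
  by (simp add: mix_density_def)

lemma integral_\<alpha>:
  fixes g :: "real \<Rightarrow> 'c :: {banach, second_countable_topology}"
  assumes [measurable]: "g \<in> borel_measurable borel"
  shows "(\<integral>w. g (\<alpha> w) \<partial>M) = (\<integral>x. mix_density x *\<^sub>R g x \<partial>lborel)"
proof -
  have "(\<integral>w. g (\<alpha> w) \<partial>M) = (\<integral>x. g x \<partial>distr M lborel \<alpha>)"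
    by (rule integral_distr[symmetric]) auto
  also have "\<dots> = (\<integral>x. mix_density x *\<^sub>R g x \<partial>lborel)"
    unfolding distr_\<alpha> by (rule integral_density) (auto simp: mix_density_nonneg)
  finally show ?thesis .
qed

lemma integrable_mix_density: "integrable lborel mix_density"
proof -
  \<comment> \<open>A nonintegrable function has integral 0 by convention, so the value 1 proves
    integrability.\<close>
  have "(\<integral>x. mix_density x \<partial>lborel) = 1"
    using integral_\<alpha>[of "\<lambda>_. 1 :: real"] by (simp add: prob_space)
  then show ?thesis using not_integrable_integral_eq by fastforce
qed

text \<open>Near 1 the positive limit forces \<psi> to be positive, so the truncation in
  \<open>mix_density\<close> has no effect there.\<close>

lemma mix_density_tendsto: "((\<lambda>x. mix_density x / (1 - x) powr \<beta>) \<longlongrightarrow> \<psi>1) (at_left 1)"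
proof (rule Lim_transform_eventually[OF \<psi>_limit])
  have "eventually (\<lambda>x. \<psi> x > 0) (at_left 1)"
    using \<psi>_limit \<psi>1_pos by (rule order_tendstoD)
  moreover have "eventually (\<lambda>x::real. x \<in> {0<..<1}) (at_left 1)"
    by (rule eventually_at_left_real) simp
  ultimately show "eventually (\<lambda>x. \<psi> x = mix_density x / (1 - x) powr \<beta>) (at_left 1)"
    by eventually_elim (simp add: mix_density_def)
qed

definition cf :: "real \<Rightarrow> complex" where
  "cf s = (CLINT w|M. iexp (s * (real (X0 w) - \<mu> w)))"

lemma cf_asymptotics:
  assumes \<beta>: "-1 < \<beta>" "\<beta> < 0" and s: "s \<longlonglongrightarrow> 0" "\<And>n. s n \<noteq> 0"
  shows "(\<lambda>n. (1 - cf (s n)) /\<^sub>R \<bar>s n\<bar> powr (2 * (1 + \<beta>)))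
    \<longlonglongrightarrow> of_real (\<psi>1 * (lam / 2) powr (1 + \<beta>) * (Gamma (- \<beta>) / (1 + \<beta>)))"
proof -
  have [measurable]: "iexp_rem \<in> borel_measurable borel" unfolding iexp_rem_def by measurable
  have eq: "1 - cf t = (CLINT x|lborel. mix_density x *\<^sub>R (1 - exp (of_real (lam / (1 - x)) * iexp_rem t)))" for t
  proof -
    have "cf t = (CLINT w|M. exp (of_real (\<mu> w) * iexp_rem t))"
      unfolding cf_def char_X0_centered iexp_rem_def ..
    also have "1 - \<dots> = (CLINT w|M. 1 - exp (of_real (\<mu> w) * iexp_rem t))"
    proof (subst Bochner_Integration.integral_diff)
      show "integrable M (\<lambda>w. exp (of_real (\<mu> w) * iexp_rem t))"
      proof (rule integrable_const_bound[where B = 1])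
        show "AE w in M. cmod (exp (of_real (\<mu> w) * iexp_rem t)) \<le> 1"
        proof (rule AE_I2)
          fix w assume "w \<in> space M"
          then have "\<mu> w * Re (iexp_rem t) \<le> 0"
            using \<mu>_pos[of w] Re_iexp_rem[of t] by (intro mult_nonneg_nonpos) auto
          then show "cmod (exp (of_real (\<mu> w) * iexp_rem t)) \<le> 1"
            by (simp add: norm_exp_eq_Re)
        qed
      qed measurable
    qed (auto simp: prob_space)
    also have "\<dots> = (CLINT x|lborel. mix_density x *\<^sub>R (1 - exp (of_real (lam / (1 - x)) * iexp_rem t)))"
      by (rule integral_\<alpha>) measurable
    finally show ?thesis .
  qed
  show ?thesis unfolding eq
    by (rule mixture_exp_asymptotics[OF integrable_mix_density mix_density_nonneg _ mix_density_tendsto \<psi>1_pos \<beta> lam_pos s])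
       (auto simp: mix_density_def)
qed

lemma cmod_cf_le_1: "cmod (cf s) \<le> 1"
proof -
  have "cmod (cf s) \<le> (LINT w|M. cmod (iexp (s * (real (X0 w) - \<mu> w))))"
    unfolding cf_def by (rule integral_norm_bound)
  then show ?thesis by (simp add: prob_space)
qed

section \<open>The accumulated difference from the initial value\<close>

definition excess :: "nat \<Rightarrow> 'a \<Rightarrow> real" where
  "excess m w = (\<Sum>k=1..m. real (X k w) - real (X 0 w))"

lemma excess_measurable [measurable]: "excess m \<in> borel_measurable M"
  unfolding excess_def by measurable

lemma integrable_excess: "integrable M (excess m)"
  and expectation_excess: "expectation (excess m) = 0"
  unfolding excess_def
  by (auto simp del: inar1.simps simp: integral_diff_eq_0 integrable_diff intro!: Bochner_Integration.integrable_sum)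

text \<open>Origin of the cube: Cauchy-Schwarz costs one factor m, there are m squares, and each has
  mean at most 2 lam m.\<close>

lemma integrable_excess_square: "integrable M (\<lambda>w. (excess m w)\<^sup>2)"
  and expectation_excess_square: "expectation (\<lambda>w. (excess m w)\<^sup>2) \<le> 2 * lam * real m ^ 3"
proof -
  define b where "b w = (\<Sum>k=1..m. (real (X k w) - real (X 0 w))\<^sup>2) * real m" for w
  have le: "(excess m w)\<^sup>2 \<le> b w" for w
    using sum_squared_le_sum_of_squares[of "\<lambda>k. real (X k w) - real (X 0 w)" "{1..m}"]
    by (simp add: excess_def b_def del: inar1.simps)
  have int: "integrable M b"
    unfolding b_def by (intro integrable_mult_left Bochner_Integration.integrable_sum integrable_diff_square)
  show 1: "integrable M (\<lambda>w. (excess m w)\<^sup>2)"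
    by (rule Bochner_Integration.integrable_bound[OF int]) (auto intro!: AE_I2 order_trans[OF le])
  have "expectation (\<lambda>w. (excess m w)\<^sup>2) \<le> expectation b"
    by (rule integral_mono[OF 1 int le])
  also have "\<dots> = (\<Sum>k=1..m. expectation (\<lambda>w. (real (X k w) - real (X 0 w))\<^sup>2)) * real m"
    unfolding b_def by (simp add: Bochner_Integration.integral_sum integrable_diff_square del: inar1.simps)
  also have "\<dots> \<le> (\<Sum>k=1..m. 2 * lam * real m) * real m"
  proof (intro mult_right_mono sum_mono)
    fix k assume "k \<in> {1..m}"
    then have "2 * lam * real k \<le> 2 * lam * real m" using lam_pos by (intro mult_left_mono) auto
    with integral_diff_square_le[of k] show "expectation (\<lambda>w. (real (X k w) - real (X 0 w))\<^sup>2) \<le> 2 * lam * real m"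
      by linarith
  qed simp
  also have "\<dots> = 2 * lam * real m ^ 3" by (simp add: power3_eq_cube)
  finally show "expectation (\<lambda>w. (excess m w)\<^sup>2) \<le> 2 * lam * real m ^ 3" .
qed

lemma process_measurable: "(\<lambda>w. (\<alpha> w, \<lambda>k. X k w)) \<in> measurable M pair_space"
  unfolding pair_space_def
  by (intro measurable_Pair \<alpha>_measurable measurable_PiM_single') (auto simp: measurable_X)

end

section \<open>The aggregated process\<close>

locale inar1_aggregation = P: randomized_inar1 P lam \<beta> \<psi> \<psi>1 \<alpha> X0 \<xi> \<epsilon> + prob_space M
  for P :: "'a measure" and lam \<beta> :: real and \<psi> :: "real \<Rightarrow> real" and \<psi>1 :: real
    and \<alpha> :: "'a \<Rightarrow> real" and X0 :: "'a \<Rightarrow> nat"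
    and \<xi> :: "nat \<Rightarrow> nat \<Rightarrow> 'a \<Rightarrow> nat" and \<epsilon> :: "nat \<Rightarrow> 'a \<Rightarrow> nat"
    and M :: "'b measure" +
  fixes A :: "nat \<Rightarrow> 'b \<Rightarrow> real" and Xs :: "nat \<Rightarrow> nat \<Rightarrow> 'b \<Rightarrow> nat" and N :: "nat \<Rightarrow> nat"
  assumes copies: "independent_copies M pair_space (\<lambda>j w. (A j w, \<lambda>k. Xs j k w))
           P (\<lambda>w. (\<alpha> w, \<lambda>k. inar1 X0 \<xi> \<epsilon> k w))"
    and \<beta>: "- 1 < \<beta>" "\<beta> < 0"
    and N_pos: "\<And>n. n \<ge> 1 \<Longrightarrow> N n > 0"
    and growth: "filterlim (\<lambda>n. real (N n) powr (- \<beta> / (1 + \<beta>)) * inverse (real n)) at_top sequentially"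
begin

abbreviation "p \<equiv> 2 * (1 + \<beta>)"

abbreviation "K \<equiv> \<psi>1 * (lam / 2) powr (1 + \<beta>) * (Gamma (- \<beta>) / (1 + \<beta>))"

definition copy :: "nat \<Rightarrow> 'b \<Rightarrow> real \<times> (nat \<Rightarrow> nat)" where
  "copy j w = (A j w, \<lambda>k. Xs j k w)"

text \<open>A functional on path space instead of a random variable: composing it with
  \<open>copy j\<close> lets independence and equality in law transfer directly from the
  copies.\<close>

definition centered_init :: "real \<times> (nat \<Rightarrow> nat) \<Rightarrow> real" where
  "centered_init z = real (snd z 0) - lam / (1 - fst z)"

definition path_excess :: "nat \<Rightarrow> real \<times> (nat \<Rightarrow> nat) \<Rightarrow> real" where
  "path_excess m z = (\<Sum>k=1..m. real (snd z k) - real (snd z 0))"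

lemma coordinate_measurable [measurable]: "(\<lambda>z. real (snd z k)) \<in> borel_measurable pair_space"
proof -
  have "(\<lambda>z. snd z k) \<in> measurable pair_space (count_space UNIV)"
    unfolding pair_space_def by measurable
  then show ?thesis by measurable
qed

lemma fst_measurable_pair_space [measurable]: "fst \<in> borel_measurable pair_space"
  unfolding pair_space_def by measurable

lemma centered_init_measurable [measurable]: "centered_init \<in> borel_measurable pair_space"
  unfolding centered_init_def by measurable

lemma path_excess_measurable [measurable]: "path_excess m \<in> borel_measurable pair_space"
  unfolding path_excess_def by measurable

lemma indep_copies: "indep_vars (\<lambda>_. pair_space) copy {1..}"
  using copies unfolding independent_copies_def copy_def by blast

lemma copy_measurable: "j \<ge> 1 \<Longrightarrow> copy j \<in> measurable M pair_space"
  using indep_copies by (auto simp: indep_vars_def)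

lemma distr_copy: "j \<ge> 1 \<Longrightarrow> distr M pair_space (copy j) = distr P pair_space (\<lambda>w. (\<alpha> w, \<lambda>k. P.X k w))"
  using copies unfolding independent_copies_def copy_def by blast

lemma integral_copy:
  fixes h :: "_ \<Rightarrow> 'c :: {banach, second_countable_topology}"
  assumes j: "j \<ge> 1" and [measurable]: "h \<in> borel_measurable pair_space"
  shows "(\<integral>w. h (copy j w) \<partial>M) = (\<integral>w. h (\<alpha> w, \<lambda>k. P.X k w) \<partial>P)"
    and "integrable M (\<lambda>w. h (copy j w)) \<longleftrightarrow> integrable P (\<lambda>w. h (\<alpha> w, \<lambda>k. P.X k w))"
proof -
  have "(\<integral>w. h (copy j w) \<partial>M) = (\<integral>z. h z \<partial>distr M pair_space (copy j))"
    using copy_measurable[OF j] by (intro integral_distr[symmetric]) auto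
  also have "\<dots> = (\<integral>w. h (\<alpha> w, \<lambda>k. P.X k w) \<partial>P)"
    unfolding distr_copy[OF j] by (intro integral_distr P.process_measurable) auto
  finally show "(\<integral>w. h (copy j w) \<partial>M) = (\<integral>w. h (\<alpha> w, \<lambda>k. P.X k w) \<partial>P)" .
  have "integrable M (\<lambda>w. h (copy j w)) \<longleftrightarrow> integrable (distr M pair_space (copy j)) h"
    using copy_measurable[OF j] by (intro integrable_distr_eq[symmetric]) auto
  also have "\<dots> \<longleftrightarrow> integrable P (\<lambda>w. h (\<alpha> w, \<lambda>k. P.X k w))"
    unfolding distr_copy[OF j] by (intro integrable_distr_eq P.process_measurable) auto
  finally show "integrable M (\<lambda>w. h (copy j w)) \<longleftrightarrow> integrable P (\<lambda>w. h (\<alpha> w, \<lambda>k. P.X k w))" .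
qed

lemma indep_comp_copy:
  assumes [measurable]: "h \<in> borel_measurable pair_space"
  shows "indep_vars (\<lambda>_. borel) (\<lambda>j w. h (copy j w)) {1..n}"
  by (rule indep_vars_compose2[OF indep_vars_subset[OF indep_copies]]) auto

section \<open>The normalised sum of the initial values\<close>

text \<open>The exponent is chosen so that \<open>N n * scale n powr p = 1\<close> for positive
  \<open>N n\<close>, which balances the order |s|^p of \<open>1 - cf s\<close>.\<close>

definition scale :: "nat \<Rightarrow> real" where
  "scale n = real (N n) powr (- (1 / p))"

definition init_sum :: "nat \<Rightarrow> 'b \<Rightarrow> real" where
  "init_sum n w = scale n * (\<Sum>j=1..N n. centered_init (copy j w))"

lemma comp_copy_measurable:
  "h \<in> borel_measurable pair_space \<Longrightarrow> j \<in> {1..n} \<Longrightarrow> (\<lambda>w. h (copy j w)) \<in> borel_measurable M"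
  using copy_measurable by (auto intro: measurable_compose)

lemma init_sum_measurable [measurable]: "init_sum n \<in> borel_measurable M"
  unfolding init_sum_def
  by (intro borel_measurable_times borel_measurable_const borel_measurable_sum comp_copy_measurable[OF centered_init_measurable])

lemma real_distribution_init_sum: "real_distribution (distr M borel (init_sum n))"
  by simp

lemma char_init_sum: "char (distr M borel (init_sum n)) \<theta> = P.cf (scale n * \<theta>) ^ N n"
proof -
  have "char (distr M borel (init_sum n)) \<theta> =
      char (distr M borel (\<lambda>w. \<Sum>j=1..N n. scale n * centered_init (copy j w))) \<theta>"
    by (simp add: init_sum_def[abs_def] sum_distrib_left)
  also have "\<dots> = (\<Prod>j=1..N n. char (distr M borel (\<lambda>w. scale n * centered_init (copy j w))) \<theta>)"
    by (rule char_distr_sum, rule indep_comp_copy) measurable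
  also have "\<dots> = (\<Prod>j=1..N n. P.cf (scale n * \<theta>))"
  proof (rule prod.cong)
    fix j assume j: "j \<in> {1..N n}"
    have "char (distr M borel (\<lambda>w. scale n * centered_init (copy j w))) \<theta> =
        (CLINT w|M. iexp (\<theta> * (scale n * centered_init (copy j w))))"
      unfolding char_def using comp_copy_measurable[OF centered_init_measurable j]
      by (subst integral_distr) auto
    also have "\<dots> = (CLINT w|P. iexp (\<theta> * (scale n * centered_init (\<alpha> w, \<lambda>k. P.X k w))))"
      using j by (intro integral_copy(1)[where h = "\<lambda>z. iexp (\<theta> * (scale n * centered_init z))"]) auto
    also have "\<dots> = P.cf (scale n * \<theta>)"
      by (simp add: P.cf_def centered_init_def mult_ac)
    finally show "char (distr M borel (\<lambda>w. scale n * centered_init (copy j w))) \<theta> = P.cf (scale n * \<theta>)" .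
  qed simp
  finally show ?thesis by simp
qed

text \<open>For n at least 1 the factor 1 / n only decreases the product, so the growth condition
  already forces a positive power of \<open>N n\<close> to infinity.\<close>

lemma N_at_top: "filterlim N at_top sequentially"
  unfolding filterlim_at_top
proof
  fix Z :: nat
  define a where "a = - \<beta> / (1 + \<beta>)"
  have a: "a > 0" unfolding a_def using \<beta> by (intro divide_pos_pos) auto
  have "eventually (\<lambda>n. real (Suc Z) powr a \<le> real (N n) powr a * inverse (real n)) sequentially"
    using growth unfolding filterlim_at_top a_def by blast
  then show "eventually (\<lambda>n. Z \<le> N n) sequentially"
    using eventually_ge_at_top[of 1]
  proof eventually_elim
    case (elim n)
    have "real (N n) powr a * inverse (real n) \<le> real (N n) powr a * 1"
      using elim by (intro mult_left_mono) (auto simp: field_simps)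
    with elim have "real (Suc Z) powr a \<le> real (N n) powr a" by simp
    then have "real (Suc Z) \<le> real (N n)"
      using a powr_less_mono2[of a "real (N n)" "real (Suc Z)"] by (metis not_le of_nat_0_le_iff)
    then show ?case by simp
  qed
qed

lemma scale_powr: "N n > 0 \<Longrightarrow> scale n powr p = inverse (real (N n))"
proof -
  have "- (1 / p) * p = - 1" using \<beta> by simp
  then show "N n > 0 \<Longrightarrow> scale n powr p = inverse (real (N n))"
    unfolding scale_def powr_powr by (simp only:) (simp add: powr_minus)
qed

lemma scale_tendsto_0: "scale \<longlonglongrightarrow> 0"
proof -
  have "((\<lambda>x::real. x powr (- (1 / p))) \<longlongrightarrow> 0) at_top"
    using \<beta> by (intro tendsto_neg_powr filterlim_ident) auto
  from filterlim_compose[OF this filterlim_compose[OF filterlim_real_sequentially N_at_top]]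
  show ?thesis unfolding scale_def[abs_def] .
qed

lemma K_pos: "K > 0"
  using P.\<psi>1_pos P.lam_pos \<beta> by (simp add: Gamma_real_pos)

text \<open>At s = scale \<theta> the quantity N (1 - cf s) is |\<theta>|^p times the normalised
  quotient of \<open>cf_asymptotics\<close>, hence tends to K |\<theta>|^p;
  \<open>power_tendsto_exp\<close> does the rest.\<close>

lemma char_init_sum_tendsto:
  "(\<lambda>n. char (distr M borel (init_sum n)) \<theta>) \<longlonglongrightarrow> of_real (exp (- K * \<bar>\<theta>\<bar> powr p))"
\<comment> \<open>For \<theta> = 0 all arguments of \<open>cf\<close> would be 0, which
  \<open>cf_asymptotics\<close> excludes.\<close>
proof (cases "\<theta> = 0")
  case True
  then show ?thesis using \<beta> by (simp add: char_init_sum P.cf_def P.prob_space)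
next
  case False
  \<comment> \<open>The shift avoids n = 0, where \<open>N 0\<close>, and with it
    \<open>scale 0\<close>, may be 0.\<close>
  define s where "s n = scale (Suc n) * \<theta>" for n
  have scale_pos: "scale (Suc n) > 0" for n using N_pos[of "Suc n"] by (simp add: scale_def)
  have s: "s \<longlonglongrightarrow> 0"
    unfolding s_def using tendsto_mult_left_zero[OF LIMSEQ_Suc[OF scale_tendsto_0]] by simp
  have s0: "s n \<noteq> 0" for n using scale_pos[of n] False by (simp add: s_def)
  have "(\<lambda>n. P.cf (s n) ^ N (Suc n)) \<longlonglongrightarrow> of_real (exp (- (K * \<bar>\<theta>\<bar> powr p)))"
  proof (rule power_tendsto_exp)
    show "cmod (P.cf (s n)) \<le> 1" for n by (rule P.cmod_cf_le_1)
    show "filterlim (\<lambda>n. N (Suc n)) at_top sequentially"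
      using N_at_top by (simp add: filterlim_sequentially_Suc)
    show "0 \<le> K * \<bar>\<theta>\<bar> powr p" by (rule mult_nonneg_nonneg[OF less_imp_le[OF K_pos]]) simp
    have "(\<lambda>n. \<bar>\<theta>\<bar> powr p *\<^sub>R ((1 - P.cf (s n)) /\<^sub>R \<bar>s n\<bar> powr p)) \<longlonglongrightarrow> \<bar>\<theta>\<bar> powr p *\<^sub>R of_real K"
      by (intro tendsto_scaleR tendsto_const P.cf_asymptotics \<beta> s s0)
    moreover have "\<bar>\<theta>\<bar> powr p *\<^sub>R ((1 - P.cf (s n)) /\<^sub>R \<bar>s n\<bar> powr p) = of_nat (N (Suc n)) * (1 - P.cf (s n))" for n
    proof -
      have "\<bar>s n\<bar> powr p = inverse (real (N (Suc n))) * \<bar>\<theta>\<bar> powr p"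
        using scale_pos[of n] scale_powr[of "Suc n"] N_pos[of "Suc n"]
        by (simp add: s_def abs_mult powr_mult)
      then have "\<bar>\<theta>\<bar> powr p * inverse (\<bar>s n\<bar> powr p) = real (N (Suc n))"
        using False by simp
      then show ?thesis by (simp only: scaleR_scaleR) (simp add: scaleR_conv_of_real)
    qed
    ultimately show "(\<lambda>n. of_nat (N (Suc n)) * (1 - P.cf (s n))) \<longlonglongrightarrow> of_real (K * \<bar>\<theta>\<bar> powr p)"
      by (simp only:) (simp add: scaleR_conv_of_real mult.commute)
  qed
  then have "(\<lambda>n. char (distr M borel (init_sum (Suc n))) \<theta>) \<longlonglongrightarrow> of_real (exp (- K * \<bar>\<theta>\<bar> powr p))"
    by (simp only: char_init_sum s_def mult_minus_left)
  then show ?thesis by (rule LIMSEQ_imp_Suc)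
qed

lemma isCont_limit_char: "isCont (\<lambda>\<theta>. of_real (exp (- K * \<bar>\<theta>\<bar> powr p)) :: complex) 0"
proof -
  have "((\<lambda>\<theta>::real. \<bar>\<theta>\<bar> powr p) \<longlongrightarrow> \<bar>0\<bar> powr p) (at 0)"
    using \<beta> by (intro tendsto_powr' tendsto_intros) auto
  then show ?thesis unfolding isCont_def by (intro tendsto_of_real tendsto_exp tendsto_mult_left)
qed

section \<open>Reduction to a random line\<close>

lemma aggregated_eq:
  "aggregated lam A Xs (N n) n t w =
    (\<Sum>j=1..N n. path_excess (nat \<lfloor>real n * t\<rfloor>) (copy j w)) +
    real (nat \<lfloor>real n * t\<rfloor>) * (\<Sum>j=1..N n. centered_init (copy j w))"
  unfolding aggregated_def
  by (simp add: path_excess_def centered_init_def copy_def sum.distrib[symmetric] sum_distrib_left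
      sum_subtractf right_diff_distrib)

lemma aggregated_measurable [measurable]: "aggregated lam A Xs (N n) n t \<in> borel_measurable M"
  unfolding measurable_cong[OF aggregated_eq]
  by (intro borel_measurable_add borel_measurable_times borel_measurable_const borel_measurable_sum
      comp_copy_measurable[OF centered_init_measurable] comp_copy_measurable[OF path_excess_measurable])

text \<open>Distinct copies are orthogonal, so the bound for one copy is only multiplied by their
  number.\<close>

lemma excess_sum_square:
  "integrable M (\<lambda>w. (\<Sum>j=1..n. path_excess m (copy j w))\<^sup>2)"
  "expectation (\<lambda>w. (\<Sum>j=1..n. path_excess m (copy j w))\<^sup>2) \<le> real n * (2 * lam * real m ^ 3)"
proof -
  have ex: "path_excess m (\<alpha> w, \<lambda>k. P.X k w) = P.excess m w" for w
    by (simp add: path_excess_def P.excess_def del: inar1.simps)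
  note tr = integral_copy[OF _ path_excess_measurable[of m], unfolded ex]
  have sq: "(\<lambda>z. (path_excess m z)\<^sup>2) \<in> borel_measurable pair_space" by measurable
  note tr2 = integral_copy[OF _ sq, unfolded ex]
  have "integrable M (\<lambda>w. (\<Sum>j\<in>{1..n}. path_excess m (copy j w))\<^sup>2) \<and>
     expectation (\<lambda>w. (\<Sum>j\<in>{1..n}. path_excess m (copy j w))\<^sup>2) \<le> real (card {1..n}) * (2 * lam * real m ^ 3)"
    by (rule expectation_sum_indep_square[OF _ indep_comp_copy[OF path_excess_measurable]])
       (auto simp: tr tr2 P.integrable_excess P.expectation_excess P.integrable_excess_square P.expectation_excess_square)
  then show "integrable M (\<lambda>w. (\<Sum>j=1..n. path_excess m (copy j w))\<^sup>2)"
    "expectation (\<lambda>w. (\<Sum>j=1..n. path_excess m (copy j w))\<^sup>2) \<le> real n * (2 * lam * real m ^ 3)" by auto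
qed

abbreviation Y :: "nat \<Rightarrow> real \<Rightarrow> 'b \<Rightarrow> real" where
  "Y n t w \<equiv> inverse (real n) * real (N n) powr (- (1 / p)) * aggregated lam A Xs (N n) n t w"

lemma growth_inverse: "(\<lambda>n. real (N n) powr (\<beta> / (1 + \<beta>)) * real n) \<longlonglongrightarrow> 0"
proof -
  have "(\<lambda>n. inverse (real (N n) powr (- \<beta> / (1 + \<beta>)) * inverse (real n))) \<longlonglongrightarrow> 0"
    by (rule tendsto_inverse_0_at_top[OF growth])
  then show ?thesis by (simp add: powr_minus)
qed

text \<open>Chebyshev's inequality: with m at most n t, the squared normalisation times N m^3 is of
  order N^(\<beta> / (1 + \<beta>)) n, the reciprocal of the quantity assumed to grow.\<close>

lemma excess_negligible:
  assumes t: "t \<ge> 0" and e: "e > 0"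
  shows "(\<lambda>n. prob {w \<in> space M. \<bar>inverse (real n) * scale n *
      (\<Sum>j=1..N n. path_excess (nat \<lfloor>real n * t\<rfloor>) (copy j w))\<bar> \<ge> e}) \<longlonglongrightarrow> 0"
proof (rule Lim_null_comparison)
  let ?T = "\<lambda>n w. inverse (real n) * scale n * (\<Sum>j=1..N n. path_excess (nat \<lfloor>real n * t\<rfloor>) (copy j w))"
  show "eventually (\<lambda>n. norm (prob {w \<in> space M. \<bar>?T n w\<bar> \<ge> e}) \<le>
      (2 * lam * t ^ 3 / e\<^sup>2) * (real (N n) powr (\<beta> / (1 + \<beta>)) * real n)) sequentially"
    using eventually_ge_at_top[of 1]
  proof eventually_elim
    case (elim n)
    define m where "m = nat \<lfloor>real n * t\<rfloor>"
    have m: "real m \<le> real n * t" using t by (simp add: m_def)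
    have sc: "(scale n)\<^sup>2 * real (N n) = real (N n) powr (\<beta> / (1 + \<beta>))"
    proof -
      \<comment> \<open>Twice the exponent of \<open>scale\<close>, plus 1 for the number of
        copies.\<close>
      have "\<beta> / (1 + \<beta>) = - (1 / p) + - (1 / p) + 1" using \<beta> by (simp add: field_simps)
      then show ?thesis using N_pos[of n] elim
        by (simp only: powr_add) (simp add: scale_def power2_eq_square)
    qed
    have [measurable]: "(\<lambda>w. \<Sum>j=1..N n. path_excess m (copy j w)) \<in> borel_measurable M"
      by (intro borel_measurable_sum comp_copy_measurable[OF path_excess_measurable])
    have sq: "(?T n w)\<^sup>2 = (inverse (real n) * scale n)\<^sup>2 * (\<Sum>j=1..N n. path_excess m (copy j w))\<^sup>2" for w
      by (simp add: m_def power_mult_distrib)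
    have "prob {w \<in> space M. \<bar>?T n w\<bar> \<ge> e} \<le> expectation (\<lambda>w. (?T n w)\<^sup>2) / e\<^sup>2"
    proof (rule prob_abs_ge_le_second_moment[OF _ _ e])
      show "integrable M (\<lambda>w. (?T n w)\<^sup>2)" unfolding sq by (intro integrable_mult_right excess_sum_square)
      show "?T n \<in> borel_measurable M" unfolding m_def[symmetric] by measurable
    qed
    also have "expectation (\<lambda>w. (?T n w)\<^sup>2) =
        (inverse (real n) * scale n)\<^sup>2 * expectation (\<lambda>w. (\<Sum>j=1..N n. path_excess m (copy j w))\<^sup>2)"
      unfolding sq by simp
    also have "\<dots> \<le> (inverse (real n) * scale n)\<^sup>2 * (real (N n) * (2 * lam * real m ^ 3))"
      by (intro mult_left_mono excess_sum_square) simp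
    also have "\<dots> \<le> (inverse (real n) * scale n)\<^sup>2 * (real (N n) * (2 * lam * (real n * t) ^ 3))"
      using m P.lam_pos by (intro mult_left_mono power_mono) auto
    also have "\<dots> = (2 * lam * t ^ 3) * (((scale n)\<^sup>2 * real (N n)) * real n)"
      using elim by (simp add: power_mult_distrib power2_eq_square power3_eq_cube field_simps)
    finally show ?case unfolding sc using e by (simp add: divide_right_mono)
  qed
  show "(\<lambda>n. (2 * lam * t ^ 3 / e\<^sup>2) * (real (N n) powr (\<beta> / (1 + \<beta>)) * real n)) \<longlonglongrightarrow> 0"
    by (rule tendsto_mult_right_zero[OF growth_inverse])
qed

lemma floor_slope_tendsto:
  assumes t: "t \<ge> 0"
  shows "(\<lambda>n. real (nat \<lfloor>real n * t\<rfloor>) * inverse (real n) - t) \<longlonglongrightarrow> 0"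
proof (rule Lim_null_comparison[OF _ lim_inverse_n])
  show "eventually (\<lambda>n. norm (real (nat \<lfloor>real n * t\<rfloor>) * inverse (real n) - t) \<le> inverse (real n)) sequentially"
    using eventually_ge_at_top[of 1]
  proof eventually_elim
    case (elim n)
    have "\<bar>real (nat \<lfloor>real n * t\<rfloor>) - real n * t\<bar> \<le> 1" using t by (simp; linarith)
    then have "\<bar>real (nat \<lfloor>real n * t\<rfloor>) - real n * t\<bar> * inverse (real n) \<le> 1 * inverse (real n)"
      by (rule mult_right_mono) simp
    moreover have "real (nat \<lfloor>real n * t\<rfloor>) * inverse (real n) - t = (real (nat \<lfloor>real n * t\<rfloor>) - real n * t) * inverse (real n)"
      using elim by (simp add: field_simps)
    ultimately show ?case by (simp add: abs_mult)
  qed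
qed

text \<open>The distance has two sources: the accumulated differences, small in L2, and the rounding
  of n t, a null sequence times a tight one. Each is allowed half of \<open>e\<close>.\<close>

lemma Y_close_to_line:
  assumes tight: "tight (\<lambda>n. distr M borel (init_sum n))" and t: "t \<ge> 0" and e: "e > 0"
  shows "(\<lambda>n. prob {w \<in> space M. \<bar>Y n t w - init_sum n w * t\<bar> \<ge> e}) \<longlonglongrightarrow> 0"
proof (rule Lim_null_comparison)
  define a where "a n = real (nat \<lfloor>real n * t\<rfloor>) * inverse (real n) - t" for n
  define T where "T n w = inverse (real n) * scale n *
      (\<Sum>j=1..N n. path_excess (nat \<lfloor>real n * t\<rfloor>) (copy j w))" for n w
  have [measurable]: "T n \<in> borel_measurable M" for n
    unfolding T_def
    by (intro borel_measurable_times borel_measurable_const borel_measurable_sum comp_copy_measurable[OF path_excess_measurable])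
  have eq: "Y n t w - init_sum n w * t = T n w + a n * init_sum n w" for n w
    unfolding aggregated_eq T_def a_def init_sum_def scale_def by (simp add: algebra_simps)
  show "eventually (\<lambda>n. norm (prob {w \<in> space M. \<bar>Y n t w - init_sum n w * t\<bar> \<ge> e}) \<le>
      prob {w \<in> space M. \<bar>T n w\<bar> \<ge> e / 2} + prob {w \<in> space M. \<bar>a n * init_sum n w\<bar> \<ge> e / 2}) sequentially"
  proof (rule always_eventually, rule allI)
    fix n
    have "prob {w \<in> space M. \<bar>Y n t w - init_sum n w * t\<bar> \<ge> e} \<le>
        prob ({w \<in> space M. \<bar>T n w\<bar> \<ge> e / 2} \<union> {w \<in> space M. \<bar>a n * init_sum n w\<bar> \<ge> e / 2})"
      unfolding eq by (rule finite_measure_mono) (auto simp: not_le)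
    also have "\<dots> \<le> prob {w \<in> space M. \<bar>T n w\<bar> \<ge> e / 2} + prob {w \<in> space M. \<bar>a n * init_sum n w\<bar> \<ge> e / 2}"
      by (rule measure_Un_le) measurable
    finally show "norm (prob {w \<in> space M. \<bar>Y n t w - init_sum n w * t\<bar> \<ge> e}) \<le>
      prob {w \<in> space M. \<bar>T n w\<bar> \<ge> e / 2} + prob {w \<in> space M. \<bar>a n * init_sum n w\<bar> \<ge> e / 2}" by simp
  qed
  have "(\<lambda>n. prob {w \<in> space M. \<bar>T n w\<bar> \<ge> e / 2}) \<longlonglongrightarrow> 0"
    unfolding T_def using t e by (intro excess_negligible) auto
  moreover have "(\<lambda>n. prob {w \<in> space M. \<bar>a n * init_sum n w\<bar> \<ge> e / 2}) \<longlonglongrightarrow> 0"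
    using e floor_slope_tendsto[OF t]
    by (intro tight_mult_null[OF tight init_sum_measurable prob_space_axioms]) (auto simp: a_def)
  ultimately show "(\<lambda>n. prob {w \<in> space M. \<bar>T n w\<bar> \<ge> e / 2} + prob {w \<in> space M. \<bar>a n * init_sum n w\<bar> \<ge> e / 2}) \<longlonglongrightarrow> 0"
    using tendsto_add[of _ 0 _ _ 0] by fastforce
qed

theorem aggregated_fdd_converge:
  obtains Q where "real_distribution Q" "char Q = (\<lambda>\<theta>. of_real (exp (- K * \<bar>\<theta>\<bar> powr p)))"
    "fdd_converge {0..} M Y Q (\<lambda>t x. x * t)"
proof -
  note hyps = real_distribution_init_sum char_init_sum_tendsto isCont_limit_char
  have tight: "tight (\<lambda>n. distr M borel (init_sum n))"
    by (rule char_tendsto_imp_tight[OF hyps])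
  obtain Q where Q: "real_distribution Q" "char Q = (\<lambda>\<theta>. of_real (exp (- K * \<bar>\<theta>\<bar> powr p)))"
    "weak_conv_m (\<lambda>n. distr M borel (init_sum n)) Q"
    by (rule levy_continuity_limit_exists[OF hyps])
  have "fdd_converge {0..} M Y Q (\<lambda>t x. x * t)"
    by (rule fdd_converge_to_line[OF prob_space_axioms Q(1) init_sum_measurable _ tight Q(3) Y_close_to_line[OF tight]])
       auto
  with Q(1,2) show ?thesis by (rule that)
qed

end

theorem theorem1p1:
  fixes P :: "'a measure" and lam \<beta> :: real and \<psi> :: "real \<Rightarrow> real" and \<psi>1 :: real
    and \<alpha> :: "'a \<Rightarrow> real" and X0 :: "'a \<Rightarrow> nat"
    and \<xi> :: "nat \<Rightarrow> nat \<Rightarrow> 'a \<Rightarrow> nat" and \<epsilon> :: "nat \<Rightarrow> 'a \<Rightarrow> nat"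
    and M :: "'b measure" and A :: "nat \<Rightarrow> 'b \<Rightarrow> real" and X :: "nat \<Rightarrow> nat \<Rightarrow> 'b \<Rightarrow> nat"
    and N :: "nat \<Rightarrow> nat"
  assumes "randomized_inar1 P lam \<beta> \<psi> \<psi>1 \<alpha> X0 \<xi> \<epsilon>"
    and "prob_space M"
    and "independent_copies M pair_space (\<lambda>j w. (A j w, \<lambda>k. X j k w))
           P (\<lambda>w. (\<alpha> w, \<lambda>k. inar1 X0 \<xi> \<epsilon> k w))"
    and "- 1 < \<beta>" and "\<beta> < 0"
    and "\<And>n. n \<ge> 1 \<Longrightarrow> N n > 0"
    and "filterlim (\<lambda>n. real (N n) powr (- \<beta> / (1 + \<beta>)) * inverse (real n)) at_top sequentially"
  shows "\<exists>(Q :: real measure) (V :: real \<Rightarrow> real).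
           prob_space Q \<and> V \<in> borel_measurable Q \<and>
           symmetric_law (distr Q borel V) \<and> stable_law (2 * (1 + \<beta>)) (distr Q borel V) \<and>
           (\<forall>\<theta>. char (distr Q borel V) \<theta> =
              of_real (exp (- (\<psi>1 * (lam / 2) powr (1 + \<beta>) * (Gamma (- \<beta>) / (1 + \<beta>)))
                            * \<bar>\<theta>\<bar> powr (2 * (1 + \<beta>))))) \<and>
           fdd_converge {0..} M
             (\<lambda>n t w. inverse (real n) * real (N n) powr (- (1 / (2 * (1 + \<beta>))))
                        * aggregated lam A X (N n) n t w)
             Q (\<lambda>t w. V w * t)"
proof -
  interpret inar1_aggregation P lam \<beta> \<psi> \<psi>1 \<alpha> X0 \<xi> \<epsilon> M A X N
    using assms by (intro inar1_aggregation.intro inar1_aggregation_axioms.intro)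
  obtain Q where Q: "real_distribution Q" "char Q = (\<lambda>\<theta>. of_real (exp (- K * \<bar>\<theta>\<bar> powr p)))"
    and fdd: "fdd_converge {0..} M Y Q (\<lambda>t x. x * t)"
    by (rule aggregated_fdd_converge)
  interpret Q: real_distribution Q by fact
  \<comment> \<open>\<open>V\<close> is taken to be the identity on the real line under
    \<open>Q\<close>, so its law is \<open>Q\<close> itself.\<close>
  have distr: "distr Q borel (\<lambda>x. x) = Q" by (rule distr_id2) simp
  have "symmetric_law Q" by (rule symmetric_law_if_char_even[OF Q(1)]) (simp add: Q(2))
  moreover have "stable_law p Q"
    by (rule stable_law_if_char[OF Q(1), where K = K]) (use assms(4) in simp, simp only: Q(2))
  ultimately show ?thesis
    using Q.prob_space_axioms fdd Q(2) by (intro exI[of _ Q] exI[of _ "\<lambda>x. x"]) (simp add: distr)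
qed

end
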